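(* Let $n\ge 1$ and $0<\lambda\le\Lambda<\infty$. There exists a constant $C$ depending only on $n$, $\lambda$ and $\Lambda$ such that the following holds. Let $(a^{ij})_{n\times n}$ be a coefficient matrix on $Q_6$ which is uniformly elliptic with ellipticity constants $\lambda$ and $\Lambda$, and let $u\ge 0$ be a weak solution of $$(a^{ij}u_i)_j=0\quad\text{in } Q_6 .$$ Then $$\sup_{Q_1} u\le C\inf_{Q_1} u .$$
   Context: $Q_r(x_0)\subset\mathbb{R}^n$ denotes the (open, axis-parallel) cube with center $x_0$ and side-length $r$, and $Q_r:=Q_r(0)$. Subscripts on $u$ denote (weak) partial derivatives and repeated indices are summed from $1$ to $n$. The coefficients $a^{ij}:Q_6\to\mathbb{R}$ are measurable; uniformly elliptic with ellipticity constants $\lambda,\Lambda$ means $a^{ij}(x)\xi_i\xi_j\ge\lambda|\xi|^2$ for all $\xi\in\mathbb{R}^n$ and $|a^{ij}(x)|\le\Lambda$ for all $i,j$, for a.e. $x\in Q_6$. A weak solution is a function $u\in H^1(Q_6)=W^{1,2}(Q_6)$ with $\int_{Q_6}a^{ij}u_i\varphi_j\,dx=0$ for all $\varphi\in C_c^\infty(Q_6)$. Supremum and infimum (and the inequality $u\ge0$) are understood in the essential (almost everywhere) sense. *)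

theory Defs
  imports "HOL-Analysis.Analysis" "HOL-Probability.Essential_Supremum"
begin

definition cube :: "real ^ 'n \<Rightarrow> real \<Rightarrow> (real ^ 'n) set" where
  "cube x0 r = {x. \<forall>i. \<bar>x $ i - x0 $ i\<bar> < r / 2}"

definition essinf :: "'a measure \<Rightarrow> ('a \<Rightarrow> ereal) \<Rightarrow> ereal" where
  "essinf M f = - esssup M (\<lambda>x. - f x)"

definition partial_deriv :: "'n \<Rightarrow> (real ^ 'n \<Rightarrow> real) \<Rightarrow> real ^ 'n \<Rightarrow> real" where
  "partial_deriv i f x = frechet_derivative f (at x) (axis i 1)"

primrec C_diff :: "nat \<Rightarrow> (real ^ 'n \<Rightarrow> real) \<Rightarrow> bool" where
  "C_diff 0 f \<longleftrightarrow> continuous_on UNIV f"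
| "C_diff (Suc k) f \<longleftrightarrow> (\<forall>x. f differentiable at x) \<and> (\<forall>i. C_diff k (partial_deriv i f))"

(* Elements of C_c^infinity(\<Omega>), extended by zero to the whole space. *)
definition test_functions :: "(real ^ 'n) set \<Rightarrow> (real ^ 'n \<Rightarrow> real) set" where
  "test_functions \<Omega> =
    {\<phi>. (\<forall>k. C_diff k \<phi>) \<and> compact (closure {x. \<phi> x \<noteq> 0}) \<and> closure {x. \<phi> x \<noteq> 0} \<subseteq> \<Omega>}"

definition locally_integrable_on :: "(real ^ 'n \<Rightarrow> real) \<Rightarrow> (real ^ 'n) set \<Rightarrow> bool" where
  "locally_integrable_on f \<Omega> \<longleftrightarrow> (\<forall>K. compact K \<and> K \<subseteq> \<Omega> \<longrightarrow> integrable (lebesgue_on K) f)"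

definition has_weak_partial_deriv ::
  "(real ^ 'n) set \<Rightarrow> 'n \<Rightarrow> (real ^ 'n \<Rightarrow> real) \<Rightarrow> (real ^ 'n \<Rightarrow> real) \<Rightarrow> bool" where
  "has_weak_partial_deriv \<Omega> i u v \<longleftrightarrow>
    locally_integrable_on u \<Omega> \<and> locally_integrable_on v \<Omega> \<and>
    (\<forall>\<phi>\<in>test_functions \<Omega>.
      (LINT x|lebesgue_on \<Omega>. u x * partial_deriv i \<phi> x) = - (LINT x|lebesgue_on \<Omega>. v x * \<phi> x))"

definition L2 :: "(real ^ 'n) set \<Rightarrow> (real ^ 'n \<Rightarrow> real) set" where
  "L2 \<Omega> = {f. f \<in> borel_measurable (lebesgue_on \<Omega>) \<and> integrable (lebesgue_on \<Omega>) (\<lambda>x. (f x)\<^sup>2)}"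

(* Du represents the weak gradient of u; it is determined up to null sets of \<Omega>. *)
definition has_L2_weak_gradient ::
  "(real ^ 'n) set \<Rightarrow> (real ^ 'n \<Rightarrow> real) \<Rightarrow> ('n \<Rightarrow> real ^ 'n \<Rightarrow> real) \<Rightarrow> bool" where
  "has_L2_weak_gradient \<Omega> u Du \<longleftrightarrow> (\<forall>i. Du i \<in> L2 \<Omega> \<and> has_weak_partial_deriv \<Omega> i u (Du i))"

definition H1 :: "(real ^ 'n) set \<Rightarrow> (real ^ 'n \<Rightarrow> real) set" where
  "H1 \<Omega> = {u \<in> L2 \<Omega>. \<exists>Du. has_L2_weak_gradient \<Omega> u Du}"

definition uniformly_elliptic ::
  "(real ^ 'n) set \<Rightarrow> real \<Rightarrow> real \<Rightarrow> (real ^ 'n \<Rightarrow> real ^ 'n ^ 'n) \<Rightarrow> bool" where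
  "uniformly_elliptic \<Omega> lam Lam a \<longleftrightarrow>
    (AE x in lebesgue_on \<Omega>.
      (\<forall>\<xi>. (\<Sum>i\<in>UNIV. \<Sum>j\<in>UNIV. a x $ i $ j * \<xi> $ i * \<xi> $ j) \<ge> lam * (norm \<xi>)\<^sup>2) \<and>
      (\<forall>i j. \<bar>a x $ i $ j\<bar> \<le> Lam))"

(* By a.e. uniqueness of the weak gradient, the choice of Du is immaterial. *)
definition weak_solution ::
  "(real ^ 'n) set \<Rightarrow> (real ^ 'n \<Rightarrow> real ^ 'n ^ 'n) \<Rightarrow> (real ^ 'n \<Rightarrow> real) \<Rightarrow> bool" where
  "weak_solution \<Omega> a u \<longleftrightarrow> u \<in> H1 \<Omega> \<and>
    (\<exists>Du. has_L2_weak_gradient \<Omega> u Du \<and>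
      (\<forall>\<phi>\<in>test_functions \<Omega>.
        (LINT x|lebesgue_on \<Omega>.
          (\<Sum>i\<in>UNIV. \<Sum>j\<in>UNIV. a x $ i $ j * Du i x * partial_deriv j \<phi> x)) = 0))"

end

theory Submission
  imports Defs "HOL-Computational_Algebra.Polynomial"
begin

text \<open>
  This is the Harnack inequality of De Giorgi, Nash and Moser. Only three properties of a nonnegative
  solution u are used, each obtained by testing the equation with \<eta>^2 F(u) for a cut-off function \<eta>:
  the energy estimate on all superlevel sets for u itself, the same estimate for - ln (u + \<epsilon>)
  (which is a subsolution because - ln is convex), and a bound for the average
  of r^2 |D ln (u + \<epsilon>)|^2 over cubes of side r (lemmas caccioppoli_u, caccioppoli_mlog and log_gradient_cube).

  The energy estimates turn into pointwise upper bounds by De Giorgi's iteration (theorem de_giorgi).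
  Its gain of integrability is a Faber-Krahn inequality: a function that lives on a set A is controlled
  in L2 by |A|^(1/n) times its gradient. This inequality and the Poincare inequality on cubes follow
  from one elementary fact: on a convex set the L2 distance between w and its translate by h is at
  most |h| times the L2 norm of the gradient of w (lemma sobolev_shift_dist).

  The lower bound for u is now immediate. By the Poincare inequality - ln (u + \<epsilon>) is close in L2 to a
  constant c0, the centre of its oscillation, and the iteration yields - ln (u + \<epsilon>) \<le> c0 + d on
  the unit cube. The upper bound uses the same information on all scales. The centres for cubes of
  side 2^(-j) drift away from c0 at most linearly in j. If u exceeds M near a point y, and if ln M
  exceeds minus the centre of the cube of side r at y by a fixed amount, then u > M/2 only on a small part of
  that cube, so that by the iteration u must exceed N M somewhere in it (lemma growth). Choosing ln N
  as the drift per halving of r, the argument can be repeated with r/2 and N M. The side lengths are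
  summable, hence u would be unbounded near the unit cube, which contradicts the iteration applied
  to u. Thus ln (u + \<epsilon>) \<le> - c0 + const on the unit cube. Comparing both bounds
  eliminates c0, and \<epsilon> tends to 0. The repeated growth argument takes the place of the
  John-Nirenberg inequality or of a covering argument.

  Weak derivatives are handled by approximation. A Sobolev function is a limit of C1 functions in
  the H1 norm of a fixed set, and the chain rule, truncations and translation estimates are limits
  of their classical versions. Mollification shows that u is of this kind on the cube of side 5
  and that C1 functions supported there are admissible in the equation.
\<close>

section \<open>Squared L2 norms and restrictions of Lebesgue measure\<close>

definition L2sq :: "'a measure \<Rightarrow> ('a \<Rightarrow> 'b::euclidean_space) \<Rightarrow> ennreal" where
  "L2sq M f = (\<integral>\<^sup>+x. ennreal ((norm (f x))\<^sup>2) \<partial>M)"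

lemma L2sq_cong_AE: "AE x in M. f x = g x \<Longrightarrow> L2sq M f = L2sq M g"
  unfolding L2sq_def by (rule nn_integral_cong_AE) auto

lemma L2sq_le_scale:
  assumes "AE x in M. norm (f x) \<le> c * norm (g x)" "g \<in> borel_measurable M"
  shows "L2sq M f \<le> ennreal (c\<^sup>2) * L2sq M g"
proof -
  have "L2sq M f \<le> (\<integral>\<^sup>+x. ennreal (c\<^sup>2) * ennreal ((norm (g x))\<^sup>2) \<partial>M)"
    unfolding L2sq_def
  proof (rule nn_integral_mono_AE)
    show "AE x in M. ennreal ((norm (f x))\<^sup>2) \<le> ennreal (c\<^sup>2) * ennreal ((norm (g x))\<^sup>2)"
      using assms(1)
    proof eventually_elim
      case (elim x)
      have "(norm (f x))\<^sup>2 \<le> (c * norm (g x))\<^sup>2" using elim by (intro power_mono) auto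
      then show ?case by (simp flip: ennreal_mult add: power_mult_distrib)
    qed
  qed
  also have "\<dots> = ennreal (c\<^sup>2) * L2sq M g"
    unfolding L2sq_def using assms(2) by (intro nn_integral_cmult) measurable
  finally show ?thesis .
qed

lemma norm_sum_sq_le: "(norm (a + b))\<^sup>2 \<le> 2 * (norm a)\<^sup>2 + 2 * (norm (b::'a::real_normed_vector))\<^sup>2"
proof -
  have "(norm (a + b))\<^sup>2 \<le> (norm a + norm b)\<^sup>2" by (intro power_mono norm_triangle_ineq) auto
  also have "\<dots> \<le> 2 * (norm a)\<^sup>2 + 2 * (norm b)\<^sup>2"
    using sum_squares_bound[of "norm a" "norm b"] by (simp add: power2_sum)
  finally show ?thesis .
qed

lemma L2sq_add_le:
  assumes [measurable]: "f \<in> borel_measurable M" "g \<in> borel_measurable M"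
  shows "L2sq M (\<lambda>x. f x + g x) \<le> 2 * L2sq M f + 2 * L2sq M g"
proof -
  have "L2sq M (\<lambda>x. f x + g x) \<le> (\<integral>\<^sup>+x. 2 * ennreal ((norm (f x))\<^sup>2) + 2 * ennreal ((norm (g x))\<^sup>2) \<partial>M)"
    unfolding L2sq_def
  proof (rule nn_integral_mono)
    fix x
    have "ennreal ((norm (f x + g x))\<^sup>2) \<le> ennreal (2 * (norm (f x))\<^sup>2 + 2 * (norm (g x))\<^sup>2)"
      by (intro ennreal_leI norm_sum_sq_le)
    then show "ennreal ((norm (f x + g x))\<^sup>2) \<le> 2 * ennreal ((norm (f x))\<^sup>2) + 2 * ennreal ((norm (g x))\<^sup>2)"
      by (simp add: ennreal_mult)
  qed
  also have "\<dots> = 2 * L2sq M f + 2 * L2sq M g"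
    unfolding L2sq_def by (subst nn_integral_add) (auto simp: nn_integral_cmult)
  finally show ?thesis .
qed

lemma L2sq_add_le':
  assumes "f \<in> borel_measurable M" "g \<in> borel_measurable M" "AE x in M. h x = f x + g x"
  shows "L2sq M h \<le> 2 * L2sq M f + 2 * L2sq M g"
  using L2sq_add_le[OF assms(1,2)] L2sq_cong_AE[OF assms(3)] by simp

text \<open>All functions below are Borel on the whole space and only the measure is restricted to the set.
  In this way measurability never depends on the set.\<close>

definition leb :: "'a::euclidean_space set \<Rightarrow> 'a measure" where
  "leb S = density lborel (indicator S)"

lemma sets_leb[simp, measurable_cong]: "sets (leb S) = sets borel"
  and space_leb[simp]: "space (leb S) = UNIV"
  by (auto simp: leb_def)

lemma measurable_leb[simp]: "measurable (leb S) N = measurable borel N"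
  by (rule measurable_cong_sets) auto

lemma AE_leb: "S \<in> sets borel \<Longrightarrow> (AE x in leb S. P x) \<longleftrightarrow> (AE x in lborel. x \<in> S \<longrightarrow> P x)"
  unfolding leb_def by (subst AE_density) (auto simp: indicator_def)

lemma nn_integral_leb:
  "S \<in> sets borel \<Longrightarrow> f \<in> borel_measurable borel \<Longrightarrow> (\<integral>\<^sup>+x. f x \<partial>leb S) = (\<integral>\<^sup>+x. f x * indicator S x \<partial>lborel)"
  unfolding leb_def by (subst nn_integral_density) (auto simp: mult.commute)

lemma emeasure_leb: "S \<in> sets borel \<Longrightarrow> A \<in> sets borel \<Longrightarrow> emeasure (leb S) A = emeasure lborel (S \<inter> A)"
  unfolding leb_def
proof (subst emeasure_density)
  assume "S \<in> sets borel" "A \<in> sets borel"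
  then have "emeasure lborel (S \<inter> A) = (\<integral>\<^sup>+x. indicator (S \<inter> A) x \<partial>lborel)" by simp
  also have "\<dots> = (\<integral>\<^sup>+x. indicator S x * indicator A x \<partial>lborel)"
    by (rule nn_integral_cong) (rule indicator_inter_arith)
  finally show "(\<integral>\<^sup>+x. indicator S x * indicator A x \<partial>lborel) = emeasure lborel (S \<inter> A)" ..
qed auto

lemma finite_measure_leb: "bounded S \<Longrightarrow> S \<in> sets borel \<Longrightarrow> finite_measure (leb S)"
proof -
  assume S: "bounded S" "S \<in> sets borel"
  have "emeasure (leb S) UNIV < \<infinity>"
    using S emeasure_bounded_finite[of S] by (simp add: emeasure_leb)
  then show ?thesis by (intro finite_measureI) auto
qed

section \<open>Sobolev functions as limits of C1 functions\<close>

definition C1 :: "(real^'n \<Rightarrow> real) \<Rightarrow> (real^'n \<Rightarrow> real^'n) \<Rightarrow> bool" where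
  "C1 f f' \<longleftrightarrow> (\<forall>x. (f has_derivative (\<lambda>h. f' x \<bullet> h)) (at x)) \<and> continuous_on UNIV f'"

lemma C1_continuous: "C1 f f' \<Longrightarrow> continuous_on UNIV f"
  unfolding C1_def by (meson continuous_at_imp_continuous_on has_derivative_continuous)

lemma C1_measurable:
  assumes "C1 f f'" shows "f \<in> borel_measurable borel" "f' \<in> borel_measurable borel"
  using C1_continuous[OF assms] assms by (auto simp: C1_def intro: borel_measurable_continuous_onI)

lemma C1_grad_zero_on_open:
  assumes g: "C1 g g'" and T: "open T" "\<And>y. y \<in> T \<Longrightarrow> g y = 0" "x \<in> T"
  shows "g' x = 0"
proof -
  have "((\<lambda>x. 0) has_derivative (\<lambda>h. 0)) (at x)" by simp
  then have "(g has_derivative (\<lambda>h. 0)) (at x)"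
    by (rule has_derivative_transform_within_open[OF _ T(1) T(3)]) (simp add: T(2))
  moreover have "(g has_derivative (\<lambda>h. g' x \<bullet> h)) (at x)" using g by (simp add: C1_def)
  ultimately have "(\<lambda>h. g' x \<bullet> h) = (\<lambda>h. 0)" by (rule has_derivative_unique[symmetric])
  then have "g' x \<bullet> g' x = 0" by (rule fun_cong)
  then show ?thesis by simp
qed

definition C1r :: "(real \<Rightarrow> real) \<Rightarrow> (real \<Rightarrow> real) \<Rightarrow> bool" where
  "C1r F F' \<longleftrightarrow> (\<forall>s. (F has_real_derivative F' s) (at s)) \<and> continuous_on UNIV F'"

lemma C1r_continuous: "C1r F F' \<Longrightarrow> continuous_on UNIV F"
  unfolding C1r_def by (meson DERIV_continuous continuous_at_imp_continuous_on)

lemma C1r_measurable: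
  assumes "C1r F F'" shows "F \<in> borel_measurable borel" "F' \<in> borel_measurable borel"
  using C1r_continuous[OF assms] assms by (auto simp: C1r_def intro: borel_measurable_continuous_onI)

lemma C1r_lipschitz:
  assumes "C1r F F'" "\<And>s. \<bar>F' s\<bar> \<le> L"
  shows "\<bar>F s - F t\<bar> \<le> L * \<bar>s - t\<bar>"
  using field_differentiable_bound[of UNIV F F' L s t] assms by (auto simp: C1r_def)

lemma C1_chain:
  assumes "C1 f f'" "C1r F F'"
  shows "C1 (\<lambda>x. F (f x)) (\<lambda>x. F' (f x) *\<^sub>R f' x)"
  unfolding C1_def
proof (intro conjI allI)
  fix x
  have 1: "(f has_derivative (\<lambda>h. f' x \<bullet> h)) (at x)" using assms(1) by (simp add: C1_def)
  have 2: "(F has_derivative (\<lambda>h. h * F' (f x))) (at (f x))"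
    using assms(2) by (simp add: C1r_def has_field_derivative_def mult_commute_abs)
  from has_derivative_compose[OF 1 2]
  show "((\<lambda>x. F (f x)) has_derivative (\<lambda>h. F' (f x) *\<^sub>R f' x \<bullet> h)) (at x)"
    by (simp add: mult.commute)
next
  show "continuous_on UNIV (\<lambda>x. F' (f x) *\<^sub>R f' x)"
    using assms C1_continuous[OF assms(1)]
    by (auto simp: C1_def C1r_def intro!: continuous_intros continuous_on_compose2[of UNIV F'])
qed

lemma C1_mult:
  assumes "C1 f f'" "C1 g g'"
  shows "C1 (\<lambda>x. f x * g x) (\<lambda>x. f x *\<^sub>R g' x + g x *\<^sub>R f' x)"
  unfolding C1_def
proof (intro conjI allI)
  fix x
  have "((\<lambda>x. f x * g x) has_derivative (\<lambda>h. f x * (g' x \<bullet> h) + (f' x \<bullet> h) * g x)) (at x)"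
    using assms by (intro has_derivative_mult) (auto simp: C1_def)
  then show "((\<lambda>x. f x * g x) has_derivative (\<lambda>h. (f x *\<^sub>R g' x + g x *\<^sub>R f' x) \<bullet> h)) (at x)"
    by (simp add: inner_add_left mult.commute)
next
  show "continuous_on UNIV (\<lambda>x. f x *\<^sub>R g' x + g x *\<^sub>R f' x)"
    using assms C1_continuous[OF assms(1)] C1_continuous[OF assms(2)]
    by (auto simp: C1_def intro!: continuous_intros)
qed

text \<open>The closure of the C1 functions of the whole space in the H1 norm over the set S. The
  quantification over e instead of a sequence makes the closedness under limits a matter of the
  triangle inequality.\<close>

definition sobolev :: "(real^'n) set \<Rightarrow> (real^'n \<Rightarrow> real) \<Rightarrow> (real^'n \<Rightarrow> real^'n) \<Rightarrow> bool" where
  "sobolev S w W \<longleftrightarrow> w \<in> borel_measurable borel \<and> W \<in> borel_measurable borel \<and>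
     L2sq (leb S) w < \<infinity> \<and> L2sq (leb S) W < \<infinity> \<and>
     (\<forall>e>0. \<exists>f f'. C1 f f' \<and> L2sq (leb S) (\<lambda>x. f x - w x) < ennreal e \<and> L2sq (leb S) (\<lambda>x. f' x - W x) < ennreal e)"

lemma sobolevD:
  assumes "sobolev S w W"
  shows "w \<in> borel_measurable borel" "W \<in> borel_measurable borel" "L2sq (leb S) w < \<infinity>" "L2sq (leb S) W < \<infinity>"
  using assms by (auto simp: sobolev_def)

lemma ennreal_squeeze_zero:
  fixes A B :: "nat \<Rightarrow> ennreal"
  assumes "\<And>m. A m \<le> B m" "B \<longlonglongrightarrow> 0"
  shows "A \<longlonglongrightarrow> 0"
  by (rule tendsto_sandwich[OF _ _ tendsto_const assms(2)]) (simp_all add: assms(1))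

text \<open>The approximating functions are chosen with geometrically decaying errors: then the errors are
  summable, and the whole sequence converges almost everywhere, as the later limit arguments by
  Fatou's lemma and dominated convergence require.\<close>

lemma sobolev_seq:
  assumes "sobolev S w W"
  obtains f f' where "\<And>m::nat. C1 (f m) (f' m)"
    "(\<lambda>m. L2sq (leb S) (\<lambda>x. f m x - w x)) \<longlonglongrightarrow> 0"
    "(\<lambda>m. L2sq (leb S) (\<lambda>x. f' m x - W x)) \<longlonglongrightarrow> 0"
    "AE x in leb S. (\<lambda>m. f m x) \<longlonglongrightarrow> w x"
proof -
  have "\<exists>f f'. C1 f f' \<and> L2sq (leb S) (\<lambda>x. f x - w x) < ennreal ((1/2)^m) \<and>
          L2sq (leb S) (\<lambda>x. f' x - W x) < ennreal ((1/2)^m)" for m :: nat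
  proof -
    have "(0::real) < (1/2)^m" by simp
    then show ?thesis using assms unfolding sobolev_def by blast
  qed
  then have "\<forall>m. \<exists>f f'. C1 f f' \<and> L2sq (leb S) (\<lambda>x. f x - w x) < ennreal ((1/2)^m) \<and>
          L2sq (leb S) (\<lambda>x. f' x - W x) < ennreal ((1/2)^m)" by blast
  then obtain f f' where "\<forall>m. C1 (f m) (f' m) \<and> L2sq (leb S) (\<lambda>x. f m x - w x) < ennreal ((1/2)^m) \<and>
          L2sq (leb S) (\<lambda>x. f' m x - W x) < ennreal ((1/2)^m)" unfolding choice_iff by blast
  then have f: "\<And>m. C1 (f m) (f' m)"
      "\<And>m. L2sq (leb S) (\<lambda>x. f m x - w x) < ennreal ((1/2)^m)"
      "\<And>m. L2sq (leb S) (\<lambda>x. f' m x - W x) < ennreal ((1/2)^m)"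
    by blast+
  note [measurable] = C1_measurable[OF f(1)] sobolevD(1,2)[OF assms]
  have lim: "(\<lambda>m. ennreal ((1/2)^m)) \<longlonglongrightarrow> 0"
    using tendsto_ennrealI[OF LIMSEQ_power_zero[of "1/2::real"]] by simp
  have "(\<lambda>m. L2sq (leb S) (\<lambda>x. f m x - w x)) \<longlonglongrightarrow> 0"
    by (rule ennreal_squeeze_zero[OF _ lim]) (rule less_imp_le, rule f)
  moreover have "(\<lambda>m. L2sq (leb S) (\<lambda>x. f' m x - W x)) \<longlonglongrightarrow> 0"
    by (rule ennreal_squeeze_zero[OF _ lim]) (rule less_imp_le, rule f)
  moreover have "AE x in leb S. (\<lambda>m. f m x) \<longlonglongrightarrow> w x"
  proof -
    have "(\<integral>\<^sup>+x. (\<Sum>m. ennreal ((f m x - w x)\<^sup>2)) \<partial>leb S) = (\<Sum>m. \<integral>\<^sup>+x. ennreal ((f m x - w x)\<^sup>2) \<partial>leb S)"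
      by (rule nn_integral_suminf) measurable
    also have "\<dots> \<le> (\<Sum>m. ennreal ((1/2)^m))"
    proof (rule suminf_le)
      fix m show "(\<integral>\<^sup>+x. ennreal ((f m x - w x)\<^sup>2) \<partial>leb S) \<le> ennreal ((1/2)^m)"
        using f(2)[of m] unfolding L2sq_def by simp
    qed auto
    also have "\<dots> < \<infinity>"
    proof -
      have "(\<Sum>m. ennreal ((1/2)^m)) \<noteq> top"
        by (rule ennreal_suminf_neq_top) (simp_all add: summable_geometric)
      then show ?thesis unfolding infinity_ennreal_def less_top[symmetric] .
    qed
    finally have "(\<integral>\<^sup>+x. (\<Sum>m. ennreal ((f m x - w x)\<^sup>2)) \<partial>leb S) \<noteq> \<infinity>" by simp
    then have "AE x in leb S. (\<Sum>m. ennreal ((f m x - w x)\<^sup>2)) \<noteq> \<infinity>"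
      by (intro nn_integral_PInf_AE) measurable
    then show ?thesis
    proof eventually_elim
      case (elim x)
      then have "summable (\<lambda>m. (f m x - w x)\<^sup>2)"
        by (intro summable_suminf_not_top) (simp_all add: infinity_ennreal_def)
      then have "(\<lambda>m. (f m x - w x)\<^sup>2) \<longlonglongrightarrow> 0" by (rule summable_LIMSEQ_zero)
      then have "(\<lambda>m. sqrt ((f m x - w x)\<^sup>2)) \<longlonglongrightarrow> sqrt 0" by (rule tendsto_real_sqrt)
      then have "(\<lambda>m. f m x - w x) \<longlonglongrightarrow> 0" by (simp add: tendsto_rabs_zero_iff)
      then show ?case by (simp add: LIM_zero_iff)
    qed
  qed
  ultimately show ?thesis using that f(1) by blast
qed

lemma L2_lim_sum_zero:
  fixes A B :: "nat \<Rightarrow> ennreal"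
  assumes "A \<longlonglongrightarrow> 0" "B \<longlonglongrightarrow> 0" "a < \<infinity>" "b < \<infinity>"
  shows "(\<lambda>m. a * A m + b * B m) \<longlonglongrightarrow> 0"
proof -
  have "(\<lambda>m. a * A m) \<longlonglongrightarrow> a * 0" "(\<lambda>m. b * B m) \<longlonglongrightarrow> b * 0"
    by (rule ennreal_tendsto_cmult; use assms in simp)+
  from tendsto_add[OF this] show ?thesis by simp
qed

lemma sobolevI_seq:
  assumes [measurable]: "w \<in> borel_measurable borel" "W \<in> borel_measurable borel"
    and fin: "L2sq (leb S) w < \<infinity>" "L2sq (leb S) W < \<infinity>"
    and f: "\<And>m::nat. C1 (f m) (f' m)"
    "(\<lambda>m. L2sq (leb S) (\<lambda>x. f m x - w x)) \<longlonglongrightarrow> 0"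
    "(\<lambda>m. L2sq (leb S) (\<lambda>x. f' m x - W x)) \<longlonglongrightarrow> 0"
  shows "sobolev S w W"
  unfolding sobolev_def
proof (intro conjI allI impI assms)
  fix e :: real assume "0 < e"
  then have "0 < ennreal e" by simp
  with f have "eventually (\<lambda>m. L2sq (leb S) (\<lambda>x. f m x - w x) < ennreal e \<and> L2sq (leb S) (\<lambda>x. f' m x - W x) < ennreal e) sequentially"
    by (intro eventually_conj) (auto intro: order_tendstoD)
  then obtain m where "L2sq (leb S) (\<lambda>x. f m x - w x) < ennreal e \<and> L2sq (leb S) (\<lambda>x. f' m x - W x) < ennreal e"
    by (auto simp: eventually_sequentially)
  then show "\<exists>f f'. C1 f f' \<and> L2sq (leb S) (\<lambda>x. f x - w x) < ennreal e \<and> L2sq (leb S) (\<lambda>x. f' x - W x) < ennreal e"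
    using f(1) by blast
qed

lemma sobolev_closed:
  assumes [measurable]: "w \<in> borel_measurable borel" "W \<in> borel_measurable borel"
    and fin: "L2sq (leb S) w < \<infinity>" "L2sq (leb S) W < \<infinity>"
    and f: "\<And>m::nat. sobolev S (f m) (f' m)"
    "(\<lambda>m. L2sq (leb S) (\<lambda>x. f m x - w x)) \<longlonglongrightarrow> 0"
    "(\<lambda>m. L2sq (leb S) (\<lambda>x. f' m x - W x)) \<longlonglongrightarrow> 0"
  shows "sobolev S w W"
proof -
  have "\<exists>g g'. C1 g g' \<and> L2sq (leb S) (\<lambda>x. g x - f m x) < ennreal (1/Suc m) \<and>
          L2sq (leb S) (\<lambda>x. g' x - f' m x) < ennreal (1/Suc m)" for m :: nat
  proof -
    have "(0::real) < 1/Suc m" by simp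
    then show ?thesis using f(1)[of m] unfolding sobolev_def by blast
  qed
  then have "\<forall>m. \<exists>g g'. C1 g g' \<and> L2sq (leb S) (\<lambda>x. g x - f m x) < ennreal (1/Suc m) \<and>
          L2sq (leb S) (\<lambda>x. g' x - f' m x) < ennreal (1/Suc m)" by blast
  then obtain g g' where "\<forall>m. C1 (g m) (g' m) \<and> L2sq (leb S) (\<lambda>x. g m x - f m x) < ennreal (1/Suc m) \<and>
          L2sq (leb S) (\<lambda>x. g' m x - f' m x) < ennreal (1/Suc m)" unfolding choice_iff by blast
  then have g: "\<And>m. C1 (g m) (g' m)"
      "\<And>m. L2sq (leb S) (\<lambda>x. g m x - f m x) < ennreal (1/Suc m)"
      "\<And>m. L2sq (leb S) (\<lambda>x. g' m x - f' m x) < ennreal (1/Suc m)"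
    by blast+
  have lim: "(\<lambda>m. ennreal (1/Suc m)) \<longlonglongrightarrow> 0"
    using tendsto_ennrealI[OF LIMSEQ_Suc[OF lim_1_over_n]] by simp
  note [measurable] = C1_measurable[OF g(1)] sobolevD(1,2)[OF f(1)]
  have 1: "(\<lambda>m. L2sq (leb S) (\<lambda>x. g m x - f m x)) \<longlonglongrightarrow> 0"
    by (rule ennreal_squeeze_zero[OF _ lim]) (rule less_imp_le, rule g)
  have 2: "(\<lambda>m. L2sq (leb S) (\<lambda>x. g' m x - f' m x)) \<longlonglongrightarrow> 0"
    by (rule ennreal_squeeze_zero[OF _ lim]) (rule less_imp_le, rule g)
  show ?thesis
  proof (rule sobolevI_seq[OF assms(1,2) fin g(1)])
    show "(\<lambda>m. L2sq (leb S) (\<lambda>x. g m x - w x)) \<longlonglongrightarrow> 0"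
      by (rule tendsto_sandwich[OF _ _ tendsto_const L2_lim_sum_zero[OF 1 f(2), of 2 2]])
         (auto intro!: always_eventually L2sq_add_le')
    show "(\<lambda>m. L2sq (leb S) (\<lambda>x. g' m x - W x)) \<longlonglongrightarrow> 0"
      by (rule tendsto_sandwich[OF _ _ tendsto_const L2_lim_sum_zero[OF 2 f(3), of 2 2]])
         (auto intro!: always_eventually L2sq_add_le')
  qed
qed

lemma L2sq_dominated:
  fixes w :: "'a \<Rightarrow> 'b::euclidean_space"
  assumes [measurable]: "\<And>m. c m \<in> borel_measurable M" "W \<in> borel_measurable M"
    and "\<And>m x. \<bar>c m x\<bar> \<le> L" "AE x in M. (\<lambda>m. c m x) \<longlonglongrightarrow> 0" "L2sq M W < \<infinity>"
  shows "(\<lambda>m. L2sq M (\<lambda>x. c m x *\<^sub>R W x)) \<longlonglongrightarrow> 0"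
proof -
  have "(\<lambda>m. L2sq M (\<lambda>x. c m x *\<^sub>R W x)) \<longlonglongrightarrow> (\<integral>\<^sup>+x. 0 \<partial>M)"
    unfolding L2sq_def
  proof (rule nn_integral_dominated_convergence[where w="\<lambda>x. ennreal (L\<^sup>2) * ennreal ((norm (W x))\<^sup>2)"])
    show "AE x in M. ennreal ((norm (c j x *\<^sub>R W x))\<^sup>2) \<le> ennreal (L\<^sup>2) * ennreal ((norm (W x))\<^sup>2)" for j
    proof (rule AE_I2)
      fix x
      have "(norm (c j x *\<^sub>R W x))\<^sup>2 \<le> L\<^sup>2 * (norm (W x))\<^sup>2"
        unfolding norm_scaleR power_mult_distrib using assms(3)[of j x]
        by (intro mult_right_mono power_mono) auto
      then show "ennreal ((norm (c j x *\<^sub>R W x))\<^sup>2) \<le> ennreal (L\<^sup>2) * ennreal ((norm (W x))\<^sup>2)"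
        by (simp flip: ennreal_mult)
    qed
    show "(\<integral>\<^sup>+ x. ennreal (L\<^sup>2) * ennreal ((norm (W x))\<^sup>2) \<partial>M) < \<infinity>"
      using assms(5) by (subst nn_integral_cmult) (auto simp: L2sq_def ennreal_mult_less_top)
    show "AE x in M. (\<lambda>i. ennreal ((norm (c i x *\<^sub>R W x))\<^sup>2)) \<longlonglongrightarrow> 0"
      using assms(4)
    proof eventually_elim
      case (elim x)
      then have "(\<lambda>i. (norm (c i x *\<^sub>R W x))\<^sup>2) \<longlonglongrightarrow> (norm (0 *\<^sub>R W x))\<^sup>2" by (intro tendsto_intros)
      from tendsto_ennrealI[OF this] show ?case by simp
    qed
  qed measurable
  then show ?thesis by simp
qed

text \<open>Since F' is merely continuous, F' (f m) converges to F' w only pointwise. The difference of the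
  gradients is therefore split into a term controlled by the L2 convergence of the gradients and
  a term to which dominated convergence applies.\<close>

lemma sobolev_chain:
  assumes w: "sobolev S w W" and F: "C1r F F'" "\<And>s. \<bar>F' s\<bar> \<le> L" and S: "bounded S" "S \<in> sets borel"
  shows "sobolev S (\<lambda>x. F (w x)) (\<lambda>x. F' (w x) *\<^sub>R W x)"
proof -
  interpret finite_measure "leb S" using S by (rule finite_measure_leb)
  obtain f f' where f: "\<And>m::nat. C1 (f m) (f' m)"
    "(\<lambda>m. L2sq (leb S) (\<lambda>x. f m x - w x)) \<longlonglongrightarrow> 0"
    "(\<lambda>m. L2sq (leb S) (\<lambda>x. f' m x - W x)) \<longlonglongrightarrow> 0"
    "AE x in leb S. (\<lambda>m. f m x) \<longlonglongrightarrow> w x" using sobolev_seq[OF w] by blast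
  note [measurable] = C1_measurable[OF f(1)] sobolevD(1,2)[OF w] C1r_measurable[OF F(1)]
  have L: "\<bar>F s - F t\<bar> \<le> L * \<bar>s - t\<bar>" for s t by (rule C1r_lipschitz[OF F])
  have "L2sq (leb S) (\<lambda>x. F (w x)) \<le> 2 * L2sq (leb S) (\<lambda>x. F (w x) - F 0) + 2 * L2sq (leb S) (\<lambda>x. F 0)"
    by (rule L2sq_add_le') auto
  also have "\<dots> \<le> 2 * (ennreal (L\<^sup>2) * L2sq (leb S) w) + 2 * L2sq (leb S) (\<lambda>x. F 0)"
    using L[of _ 0] by (intro add_mono mult_left_mono L2sq_le_scale) (auto simp: L2sq_def)
  also have "\<dots> < \<infinity>"
    using sobolevD(3)[OF w] emeasure_finite[of UNIV]
    by (simp add: L2sq_def ennreal_mult_less_top top.not_eq_extremum[symmetric] ennreal_mult_eq_top_iff)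
  finally have fin1: "L2sq (leb S) (\<lambda>x. F (w x)) < \<infinity>" .
  have "L2sq (leb S) (\<lambda>x. F' (w x) *\<^sub>R W x) \<le> ennreal (L\<^sup>2) * L2sq (leb S) W"
    using F(2) by (intro L2sq_le_scale) (auto intro!: mult_right_mono)
  also have "\<dots> < \<infinity>" using sobolevD(4)[OF w] by (auto simp: ennreal_mult_less_top)
  finally have fin2: "L2sq (leb S) (\<lambda>x. F' (w x) *\<^sub>R W x) < \<infinity>" .
  show ?thesis
  proof (rule sobolevI_seq[OF _ _ fin1 fin2 C1_chain[OF f(1) F(1)]])
    show "(\<lambda>m. L2sq (leb S) (\<lambda>x. F (f m x) - F (w x))) \<longlonglongrightarrow> 0"
    proof (rule tendsto_sandwich[OF _ _ tendsto_const L2_lim_sum_zero[OF f(2) f(2), of "ennreal (L\<^sup>2)" 0]])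
      show "\<forall>\<^sub>F m in sequentially. L2sq (leb S) (\<lambda>x. F (f m x) - F (w x))
         \<le> ennreal (L\<^sup>2) * L2sq (leb S) (\<lambda>x. f m x - w x) + 0 * L2sq (leb S) (\<lambda>x. f m x - w x)"
        using L by (auto intro!: always_eventually L2sq_le_scale)
    qed auto
    have cont: "isCont F' s" for s using F(1) by (auto simp: C1r_def continuous_on_eq_continuous_at)
    have 3: "(\<lambda>m. L2sq (leb S) (\<lambda>x. (F' (f m x) - F' (w x)) *\<^sub>R W x)) \<longlonglongrightarrow> 0"
    proof (rule L2sq_dominated[where L="2*L"])
      show "\<bar>F' (f m x) - F' (w x)\<bar> \<le> 2 * L" for m x
        using F(2)[of "f m x"] F(2)[of "w x"] by linarith
      show "AE x in leb S. (\<lambda>m. F' (f m x) - F' (w x)) \<longlonglongrightarrow> 0"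
        using f(4) by eventually_elim (auto intro!: LIM_zero isCont_tendsto_compose[OF cont])
    qed (use sobolevD[OF w] in auto)
    have 4: "(\<lambda>m. L2sq (leb S) (\<lambda>x. F' (f m x) *\<^sub>R (f' m x - W x))) \<longlonglongrightarrow> 0"
    proof (rule tendsto_sandwich[OF _ _ tendsto_const L2_lim_sum_zero[OF f(3) f(3), of "ennreal (L\<^sup>2)" 0]])
      show "\<forall>\<^sub>F m in sequentially. L2sq (leb S) (\<lambda>x. F' (f m x) *\<^sub>R (f' m x - W x))
         \<le> ennreal (L\<^sup>2) * L2sq (leb S) (\<lambda>x. f' m x - W x) + 0 * L2sq (leb S) (\<lambda>x. f' m x - W x)"
        using F(2) by (auto intro!: always_eventually L2sq_le_scale mult_right_mono)
    qed auto
    show "(\<lambda>m. L2sq (leb S) (\<lambda>x. F' (f m x) *\<^sub>R f' m x - F' (w x) *\<^sub>R W x)) \<longlonglongrightarrow> 0"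
      by (rule tendsto_sandwich[OF _ _ tendsto_const L2_lim_sum_zero[OF 3 4, of 2 2]])
         (auto intro!: always_eventually L2sq_add_le' simp: algebra_simps)
  qed auto
qed

lemma L2sq_product_rule_le:
  fixes z :: "real^'n \<Rightarrow> real" and z' :: "real^'n \<Rightarrow> real^'n"
  assumes z: "\<And>x. \<bar>z x\<bar> \<le> B" "\<And>x. norm (z' x) \<le> B"
    and [measurable]: "z \<in> borel_measurable M" "z' \<in> borel_measurable M" "g \<in> borel_measurable M" "G \<in> borel_measurable M"
  shows "L2sq M (\<lambda>x. z x *\<^sub>R G x + g x *\<^sub>R z' x)
     \<le> (2 * ennreal (B\<^sup>2)) * L2sq M G + (2 * ennreal (B\<^sup>2)) * L2sq M g"
proof -
  have "L2sq M (\<lambda>x. z x *\<^sub>R G x + g x *\<^sub>R z' x)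
    \<le> 2 * L2sq M (\<lambda>x. z x *\<^sub>R G x) + 2 * L2sq M (\<lambda>x. g x *\<^sub>R z' x)"
    by (rule L2sq_add_le) auto
  also have "\<dots> \<le> 2 * (ennreal (B\<^sup>2) * L2sq M G) + 2 * (ennreal (B\<^sup>2) * L2sq M g)"
  proof (intro add_mono mult_left_mono)
    show "L2sq M (\<lambda>x. z x *\<^sub>R G x) \<le> ennreal (B\<^sup>2) * L2sq M G"
      using z by (intro L2sq_le_scale) (auto intro!: mult_right_mono)
    show "L2sq M (\<lambda>x. g x *\<^sub>R z' x) \<le> ennreal (B\<^sup>2) * L2sq M g"
      using z by (intro L2sq_le_scale) (auto simp: mult.commute[of B] intro!: mult_left_mono)
  qed auto
  finally show ?thesis by (simp add: mult.assoc)
qed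

lemma L2sq_product_rule_lim:
  fixes z :: "real^'n \<Rightarrow> real" and z' :: "real^'n \<Rightarrow> real^'n"
  assumes z: "\<And>x. \<bar>z x\<bar> \<le> B" "\<And>x. norm (z' x) \<le> B"
    and [measurable]: "z \<in> borel_measurable M" "z' \<in> borel_measurable M" "w \<in> borel_measurable M" "W \<in> borel_measurable M"
    "\<And>m. f m \<in> borel_measurable M" "\<And>m. f' m \<in> borel_measurable M"
    and f: "(\<lambda>m::nat. L2sq M (\<lambda>x. f m x - w x)) \<longlonglongrightarrow> 0" "(\<lambda>m. L2sq M (\<lambda>x. f' m x - W x)) \<longlonglongrightarrow> 0"
  shows "(\<lambda>m. L2sq M (\<lambda>x. z x *\<^sub>R f' m x + f m x *\<^sub>R z' x - (z x *\<^sub>R W x + w x *\<^sub>R z' x))) \<longlonglongrightarrow> 0"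
proof (rule ennreal_squeeze_zero)
  have Bt: "2 * ennreal (B\<^sup>2) < \<infinity>" by (simp add: ennreal_mult_less_top)
  show "(\<lambda>m. 2 * ennreal (B\<^sup>2) * L2sq M (\<lambda>x. f' m x - W x) + 2 * ennreal (B\<^sup>2) * L2sq M (\<lambda>x. f m x - w x)) \<longlonglongrightarrow> 0"
    by (rule L2_lim_sum_zero[OF f(2,1) Bt Bt])
  fix m
  have "(\<lambda>x. z x *\<^sub>R f' m x + f m x *\<^sub>R z' x - (z x *\<^sub>R W x + w x *\<^sub>R z' x))
      = (\<lambda>x. z x *\<^sub>R (f' m x - W x) + (f m x - w x) *\<^sub>R z' x)" by (auto simp: algebra_simps)
  then show "L2sq M (\<lambda>x. z x *\<^sub>R f' m x + f m x *\<^sub>R z' x - (z x *\<^sub>R W x + w x *\<^sub>R z' x))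
    \<le> 2 * ennreal (B\<^sup>2) * L2sq M (\<lambda>x. f' m x - W x) + 2 * ennreal (B\<^sup>2) * L2sq M (\<lambda>x. f m x - w x)"
    using L2sq_product_rule_le[of z B z', OF z, where M=M and g="\<lambda>x. f m x - w x" and G="\<lambda>x. f' m x - W x"] by simp
qed

lemma sobolev_mult:
  assumes w: "sobolev S w W" and z: "C1 z z'" "\<And>x. \<bar>z x\<bar> \<le> B" "\<And>x. norm (z' x) \<le> B"
  shows "sobolev S (\<lambda>x. z x * w x) (\<lambda>x. z x *\<^sub>R W x + w x *\<^sub>R z' x)"
proof -
  obtain f f' where f: "\<And>m::nat. C1 (f m) (f' m)"
    "(\<lambda>m. L2sq (leb S) (\<lambda>x. f m x - w x)) \<longlonglongrightarrow> 0"
    "(\<lambda>m. L2sq (leb S) (\<lambda>x. f' m x - W x)) \<longlonglongrightarrow> 0"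
    "AE x in leb S. (\<lambda>m. f m x) \<longlonglongrightarrow> w x" using sobolev_seq[OF w] by blast
  note [measurable] = C1_measurable[OF f(1)] sobolevD(1,2)[OF w] C1_measurable[OF z(1)]
  have a: "L2sq (leb S) (\<lambda>x. z x * g x) \<le> ennreal (B\<^sup>2) * L2sq (leb S) g"
    if "g \<in> borel_measurable borel" for g
    using z that by (intro L2sq_le_scale) (auto simp: abs_mult intro!: mult_right_mono)
  show ?thesis
  proof (rule sobolevI_seq[OF _ _ _ _ C1_mult[OF z(1) f(1)]])
    show "L2sq (leb S) (\<lambda>x. z x * w x) < \<infinity>"
      using sobolevD[OF w] a[of w] by (auto simp: ennreal_mult_less_top intro: le_less_trans)
    have "2 * ennreal (B\<^sup>2) * L2sq (leb S) W + 2 * ennreal (B\<^sup>2) * L2sq (leb S) w < \<infinity>"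
      using sobolevD[OF w] by (simp add: ennreal_mult_less_top)
    with L2sq_product_rule_le[of z B z', OF z(2,3), where M="leb S" and g=w and G=W]
    show "L2sq (leb S) (\<lambda>x. z x *\<^sub>R W x + w x *\<^sub>R z' x) < \<infinity>"
      by (auto intro: le_less_trans)
    show "(\<lambda>m. L2sq (leb S) (\<lambda>x. z x * f m x - z x * w x)) \<longlonglongrightarrow> 0"
    proof (rule ennreal_squeeze_zero)
      show "L2sq (leb S) (\<lambda>x. z x * f m x - z x * w x) \<le> ennreal (B\<^sup>2) * L2sq (leb S) (\<lambda>x. f m x - w x)" for m
        using a[of "\<lambda>x. f m x - w x"] by (simp add: right_diff_distrib)
      show "(\<lambda>m. ennreal (B\<^sup>2) * L2sq (leb S) (\<lambda>x. f m x - w x)) \<longlonglongrightarrow> 0"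
        using L2_lim_sum_zero[OF f(2) f(2), of "ennreal (B\<^sup>2)" 0] by simp
    qed
    show "(\<lambda>m. L2sq (leb S) (\<lambda>x. z x *\<^sub>R f' m x + f m x *\<^sub>R z' x - (z x *\<^sub>R W x + w x *\<^sub>R z' x))) \<longlonglongrightarrow> 0"
      by (rule L2sq_product_rule_lim[OF z(2,3) _ _ _ _ _ _ f(2,3)]) auto
  qed auto
qed

section \<open>Truncations\<close>

text \<open>The functions inserted into the equation are only given for nonnegative arguments, the values of
  a solution, while the chain rule asks for functions on the whole line. The linear extension
  keeps the derivative continuous and bounded.\<close>

lemma C1r_extend:
  assumes d: "\<And>s. s \<ge> 0 \<Longrightarrow> (F has_real_derivative F' s) (at s)" and c: "continuous_on {0..} F'"
  shows "C1r (\<lambda>s. F (max 0 s) + F' 0 * min 0 s) (\<lambda>s. F' (max 0 s))" (is "C1r ?F _")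
  unfolding C1r_def
proof (intro conjI allI)
  fix s :: real
  consider "s > 0" | "s < 0" | "s = 0" by linarith
  then show "(?F has_real_derivative F' (max 0 s)) (at s)"
  proof cases
    case 1
    have "(F has_real_derivative F' s) (at s)" using 1 d by simp
    then have "(?F has_real_derivative F' s) (at s)"
      by (rule has_field_derivative_transform_within_open[of _ _ _ "{0<..}"]) (use 1 in auto)
    then show ?thesis using 1 by simp
  next
    case 2
    have "((\<lambda>s. F 0 + F' 0 * s) has_real_derivative F' 0) (at s)" by (auto intro!: derivative_eq_intros)
    then have "(?F has_real_derivative F' 0) (at s)"
      by (rule has_field_derivative_transform_within_open[of _ _ _ "{..<0}"]) (use 2 in auto)
    then show ?thesis using 2 by simp
  next
    case 3
    have "(\<lambda>y. (F y - F 0) / (y - 0)) \<midarrow>0\<rightarrow> F' 0"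
      using d[of 0] by (simp add: has_field_derivative_iff)
    then have lim: "(\<lambda>y. \<bar>(F y - F 0) / (y - 0) - F' 0\<bar>) \<midarrow>0\<rightarrow> 0"
      by (intro tendsto_rabs_zero LIM_zero)
    have "(\<lambda>y. (?F y - ?F 0) / (y - 0) - F' 0) \<midarrow>0\<rightarrow> 0"
    proof (rule Lim_null_comparison[OF _ lim])
      show "\<forall>\<^sub>F y in at 0. norm ((?F y - ?F 0) / (y - 0) - F' 0) \<le> \<bar>(F y - F 0) / (y - 0) - F' 0\<bar>"
      proof (rule eventually_at_topological[THEN iffD2], intro exI[of _ UNIV] conjI ballI impI)
        fix y :: real assume "y \<noteq> 0"
        then show "norm ((?F y - ?F 0) / (y - 0) - F' 0) \<le> \<bar>(F y - F 0) / (y - 0) - F' 0\<bar>"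
          by (cases "y > 0") (auto simp: max_def min_def)
      qed auto
    qed
    then show ?thesis unfolding has_field_derivative_iff using 3 by (simp add: LIM_zero_iff)
  qed
next
  show "continuous_on UNIV (\<lambda>s. F' (max 0 s))"
    by (rule continuous_on_compose2[OF c]) (auto intro!: continuous_intros)
qed

lemma C1r_pos_part_sq: "C1r (\<lambda>s. (max 0 s)\<^sup>2) (\<lambda>s. 2 * max 0 s)"
proof -
  have "C1r (\<lambda>s. (max 0 s)\<^sup>2 + 2 * 0 * min 0 s) (\<lambda>s. 2 * max 0 s)"
    by (rule C1r_extend[of "\<lambda>s. s\<^sup>2" "\<lambda>s. 2 * s"])
       (auto intro!: derivative_eq_intros continuous_intros)
  then show ?thesis by simp
qed

text \<open>A C1 regularisation of the positive part of t that tends to it as d tends to 0.\<close>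

definition spos :: "real \<Rightarrow> real \<Rightarrow> real" where
  "spos d t = sqrt ((max 0 t)\<^sup>2 + d\<^sup>2) - d"
definition spos' :: "real \<Rightarrow> real \<Rightarrow> real" where
  "spos' d t = max 0 t / sqrt ((max 0 t)\<^sup>2 + d\<^sup>2)"

lemma C1r_spos:
  assumes "d > 0" shows "C1r (spos d) (spos' d)"
  unfolding C1r_def
proof (intro conjI allI)
  fix s :: real
  have pos: "(max 0 t)\<^sup>2 + d\<^sup>2 > 0" for t using assms by (simp add: add_nonneg_pos)
  have "((\<lambda>s. (max 0 s)\<^sup>2 + d\<^sup>2) has_real_derivative (2 * max 0 s + 0)) (at s)"
    using C1r_pos_part_sq by (intro DERIV_add DERIV_const) (auto simp: C1r_def)
  from DERIV_chain2[OF DERIV_real_sqrt[OF pos] this]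
  have "((\<lambda>s. sqrt ((max 0 s)\<^sup>2 + d\<^sup>2)) has_real_derivative (spos' d s)) (at s)"
    by (simp add: spos'_def field_simps)
  from DERIV_diff[OF this DERIV_const[of d]]
  show "(spos d has_real_derivative spos' d s) (at s)"
    unfolding spos_def[abs_def] by simp
next
  have pos: "sqrt ((max 0 t)\<^sup>2 + d\<^sup>2) \<noteq> 0" for t
    using assms by (simp add: add_nonneg_eq_0_iff)
  show "continuous_on UNIV (spos' d)"
    unfolding spos'_def[abs_def] using pos by (intro continuous_intros) auto
qed

lemma C1r_spos_shift:
  assumes "0 < d" shows "C1r (\<lambda>s. spos d (s - k)) (\<lambda>s. spos' d (s - k))"
proof -
  have "((\<lambda>s. spos d (s - k)) has_real_derivative spos' d (s - k) * 1) (at s)" for s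
    by (rule DERIV_chain2[of "spos d"])
       (use C1r_spos[OF assms] in \<open>auto simp: C1r_def intro!: derivative_eq_intros\<close>)
  moreover have "continuous_on UNIV (\<lambda>s. spos' d (s - k))"
    by (rule continuous_on_compose2[of UNIV "spos' d"])
       (use C1r_spos[OF assms] in \<open>auto simp: C1r_def intro!: continuous_intros\<close>)
  ultimately show ?thesis by (simp add: C1r_def)
qed

text \<open>The last bound is the one on which the energy estimate for superlevel sets rests: it lets the
  mixed term be absorbed although the derivative degenerates at the level.\<close>

lemma spos_bounds:
  assumes "d > 0"
  shows "0 \<le> spos' d t" "spos' d t \<le> 1" "0 \<le> spos d t" "spos d t \<le> max 0 t"
    "max 0 t - d \<le> spos d t" "(spos d t)\<^sup>2 \<le> (max 0 t)\<^sup>2 * spos' d t"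
proof -
  define a where "a = max 0 t"
  define r where "r = sqrt (a\<^sup>2 + d\<^sup>2)"
  have a: "a \<ge> 0" by (simp add: a_def)
  have r: "r \<ge> a" "r \<ge> d" "r \<le> a + d" "r > 0" "r\<^sup>2 = a\<^sup>2 + d\<^sup>2"
  proof -
    show "r \<ge> a" unfolding r_def by (rule real_le_rsqrt) simp
    show d: "r \<ge> d" unfolding r_def by (rule real_le_rsqrt) simp
    then show "r > 0" using assms by linarith
    show "r \<le> a + d" unfolding r_def
      using a assms by (intro real_le_lsqrt) (auto simp: power2_sum)
    show "r\<^sup>2 = a\<^sup>2 + d\<^sup>2" by (simp add: r_def)
  qed
  have s: "spos d t = r - d" "spos' d t = a / r" by (auto simp: spos_def spos'_def r_def a_def)
  show "0 \<le> spos' d t" "spos' d t \<le> 1" "0 \<le> spos d t" "spos d t \<le> max 0 t" "max 0 t - d \<le> spos d t"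
    using r a unfolding s a_def[symmetric] by (auto simp: divide_simps)
  have "(r - d) * (r + d) = a\<^sup>2" using r(5) by (simp add: power2_eq_square algebra_simps)
  have "(r - d) * r \<le> a\<^sup>2"
  proof -
    have "(r - d) * r \<le> (r - d) * (r + d)" using r assms by (intro mult_left_mono) auto
    then show ?thesis using \<open>(r - d) * (r + d) = a\<^sup>2\<close> by simp
  qed
  moreover have "(r - d)\<^sup>2 * r \<le> a * ((r - d) * r)"
    using r assms mult_right_mono[of "r - d" a "(r - d) * r"] by (simp add: power2_eq_square mult.assoc)
  ultimately have "(r - d)\<^sup>2 * r \<le> a * a\<^sup>2" using a by (meson mult_left_mono order_trans)
  then show "(spos d t)\<^sup>2 \<le> (max 0 t)\<^sup>2 * spos' d t"
    unfolding s a_def[symmetric] using r by (simp add: pos_le_divide_eq mult.commute)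
qed

lemma spos'_tendsto: "(\<lambda>m::nat. spos' (1 / Suc m) t) \<longlonglongrightarrow> (if t > 0 then 1 else 0)"
proof (cases "t > 0")
  case True
  have "(\<lambda>m::nat. max 0 t / sqrt ((max 0 t)\<^sup>2 + (1 / Suc m)\<^sup>2)) \<longlonglongrightarrow> max 0 t / sqrt ((max 0 t)\<^sup>2 + 0\<^sup>2)"
    using True by (intro tendsto_intros LIMSEQ_Suc[OF lim_1_over_n]) auto
  then show ?thesis using True by (simp add: spos'_def)
next
  case False
  then show ?thesis by (simp add: spos'_def max_def)
qed

text \<open>The regularisations lie within d of the positive part, and their derivatives converge to the
  indicator of the superlevel set at every point.\<close>

lemma sobolev_pos_part:
  assumes w: "sobolev S w W" and S: "bounded S" "S \<in> sets borel"
  shows "sobolev S (\<lambda>x. max 0 (w x - k)) (\<lambda>x. (if w x > k then 1 else 0) *\<^sub>R W x)"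
proof -
  interpret finite_measure "leb S" using S by (rule finite_measure_leb)
  note [measurable] = sobolevD(1,2)[OF w]
  let ?d = "\<lambda>m::nat. 1 / real (Suc m)"
  have d: "?d m > 0" for m by simp
  note [measurable] = C1r_measurable[OF C1r_spos[OF d]]
  have S1: "sobolev S (\<lambda>x. spos (?d m) (w x - k)) (\<lambda>x. spos' (?d m) (w x - k) *\<^sub>R W x)" for m
  proof (rule sobolev_chain[OF w C1r_spos_shift[OF d] _ S, where L=1])
    show "\<bar>spos' (?d m) (s - k)\<bar> \<le> 1" for s using spos_bounds[OF d[of m]] by simp
  qed
  have UF: "L2sq (leb S) (\<lambda>x. c::real) < \<infinity>" for c
    using emeasure_finite[of UNIV] by (simp add: L2sq_def ennreal_mult_less_top top.not_eq_extremum[symmetric] ennreal_mult_eq_top_iff)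
  show ?thesis
  proof (rule sobolev_closed[OF _ _ _ _ S1])
    have "L2sq (leb S) (\<lambda>x. max 0 (w x - k)) \<le> ennreal (1\<^sup>2) * L2sq (leb S) (\<lambda>x. w x + (- k))"
      by (rule L2sq_le_scale) (auto simp: max_def)
    also have "\<dots> = L2sq (leb S) (\<lambda>x. w x + (- k))" by simp
    also have "\<dots> \<le> 2 * L2sq (leb S) w + 2 * L2sq (leb S) (\<lambda>x. -k)" by (rule L2sq_add_le) auto
    also have "\<dots> < \<infinity>" using UF[of "-k"] sobolevD(3)[OF w] by (simp add: ennreal_mult_less_top)
    finally show "L2sq (leb S) (\<lambda>x. max 0 (w x - k)) < \<infinity>" .
    have "L2sq (leb S) (\<lambda>x. (if w x > k then 1 else 0) *\<^sub>R W x) \<le> ennreal (1\<^sup>2) * L2sq (leb S) W"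
      by (rule L2sq_le_scale) auto
    then show "L2sq (leb S) (\<lambda>x. (if w x > k then 1 else 0) *\<^sub>R W x) < \<infinity>"
      using sobolevD(4)[OF w] by (auto intro: le_less_trans)
    show "(\<lambda>m. L2sq (leb S) (\<lambda>x. spos (?d m) (w x - k) - max 0 (w x - k))) \<longlonglongrightarrow> 0"
    proof (rule ennreal_squeeze_zero)
      show "L2sq (leb S) (\<lambda>x. spos (?d m) (w x - k) - max 0 (w x - k)) \<le> ennreal ((?d m)\<^sup>2) * L2sq (leb S) (\<lambda>x. 1::real)" for m
      proof (rule L2sq_le_scale)
        show "AE x in leb S. norm (spos (?d m) (w x - k) - max 0 (w x - k)) \<le> ?d m * norm (1::real)"
          using spos_bounds(4,5)[OF d[of m]] by (intro AE_I2) (simp add: abs_le_iff algebra_simps)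
      qed auto
      have "(\<lambda>m. ennreal ((?d m)\<^sup>2)) \<longlonglongrightarrow> ennreal (0\<^sup>2)"
        by (intro tendsto_ennrealI tendsto_power LIMSEQ_Suc[OF lim_1_over_n])
      then have "(\<lambda>m. L2sq (leb S) (\<lambda>x. 1::real) * ennreal ((?d m)\<^sup>2)) \<longlonglongrightarrow> L2sq (leb S) (\<lambda>x. 1::real) * ennreal (0\<^sup>2)"
        using UF[of 1] by (intro ennreal_tendsto_cmult) (auto simp: infinity_ennreal_def)
      then show "(\<lambda>m. ennreal ((?d m)\<^sup>2) * L2sq (leb S) (\<lambda>x. 1::real)) \<longlonglongrightarrow> 0" by (simp add: mult.commute)
    qed
    have "(\<lambda>m. L2sq (leb S) (\<lambda>x. (spos' (?d m) (w x - k) - (if w x > k then 1 else 0)) *\<^sub>R W x)) \<longlonglongrightarrow> 0"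
    proof (rule L2sq_dominated[where L=1])
      show "(\<lambda>x. spos' (?d m) (w x - k) - (if w x > k then 1 else 0)) \<in> borel_measurable (leb S)" for m
        by measurable
      show "\<bar>spos' (?d m) (w x - k) - (if w x > k then 1 else 0)\<bar> \<le> 1" for m x
        using spos_bounds(1,2)[OF d[of m], of "w x - k"] by auto
      show "AE x in leb S. (\<lambda>m. spos' (?d m) (w x - k) - (if w x > k then 1 else 0)) \<longlonglongrightarrow> 0"
      proof (rule AE_I2)
        fix x show "(\<lambda>m. spos' (?d m) (w x - k) - (if w x > k then 1 else 0)) \<longlonglongrightarrow> 0"
          using spos'_tendsto[of "w x - k"] by (intro LIM_zero) simp
      qed
    qed (use sobolevD[OF w] in auto)
    then show "(\<lambda>m. L2sq (leb S) (\<lambda>x. spos' (?d m) (w x - k) *\<^sub>R W x - (if w x > k then 1 else 0) *\<^sub>R W x)) \<longlonglongrightarrow> 0"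
      by (simp add: scaleR_left_diff_distrib)
  qed auto
qed

section \<open>Translations of Sobolev functions\<close>

lemma nn_integral_lborel_shift:
  fixes f :: "'a::euclidean_space \<Rightarrow> ennreal"
  assumes [measurable]: "f \<in> borel_measurable borel"
  shows "(\<integral>\<^sup>+x. f (x + a) \<partial>lborel) = (\<integral>\<^sup>+x. f x \<partial>lborel)"
proof -
  have "(\<integral>\<^sup>+x. f x \<partial>lborel) = (\<integral>\<^sup>+x. f x \<partial>distr lborel borel ((+) a))" by (simp only: lborel_distr_plus)
  also have "\<dots> = (\<integral>\<^sup>+x. f (a + x) \<partial>lborel)" by (subst nn_integral_distr) auto
  finally show ?thesis by (simp add: add.commute)
qed

text \<open>The fundamental theorem of calculus on the segment from x to x + h, followed by the
  Cauchy-Schwarz inequality.\<close>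

lemma C1_increment_sq:
  fixes f :: "real^'n \<Rightarrow> real"
  assumes "C1 f f'"
  shows "ennreal ((f (x + h) - f x)\<^sup>2)
    \<le> ennreal ((norm h)\<^sup>2) * (\<integral>\<^sup>+t. indicator {0..1} t * ennreal ((norm (f' (x + t *\<^sub>R h)))\<^sup>2) \<partial>lborel)"
proof -
  define g where "g t = f' (x + t *\<^sub>R h) \<bullet> h" for t :: real
  have cont: "continuous_on UNIV g" unfolding g_def
    using assms by (auto simp: C1_def intro!: continuous_intros continuous_on_compose2[of UNIV f'])
  have [measurable]: "g \<in> borel_measurable borel" using cont by (rule borel_measurable_continuous_onI)
  have der: "((\<lambda>t. f (x + t *\<^sub>R h)) has_vector_derivative g t) (at t within {0..1})" for t
  proof -
    have 1: "((\<lambda>t. x + t *\<^sub>R h) has_derivative (\<lambda>s. s *\<^sub>R h)) (at t)" by (auto intro!: derivative_eq_intros)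
    have 2: "(f has_derivative (\<lambda>v. f' (x + t *\<^sub>R h) \<bullet> v)) (at (x + t *\<^sub>R h))" using assms by (simp add: C1_def)
    from has_derivative_compose[OF 1 2] have "((\<lambda>t. f (x + t *\<^sub>R h)) has_vector_derivative g t) (at t)"
      by (simp add: has_vector_derivative_def g_def)
    then show ?thesis by (rule has_vector_derivative_at_within)
  qed
  have ftc: "(\<integral>t. indicator {0..1} t *\<^sub>R g t \<partial>lborel) = f (x + h) - f x"
    using integral_FTC_atLeastAtMost[of 0 1 "\<lambda>t. f (x + t *\<^sub>R h)" g] der cont
    by (auto intro: continuous_on_subset)
  have int: "integrable lborel (\<lambda>t. indicator {0..1} t *\<^sub>R g t)"
    using borel_integrable_atLeastAtMost'[of 0 1 g] cont by (auto simp: set_integrable_def intro: continuous_on_subset)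
  have "ennreal ((f (x + h) - f x)\<^sup>2) = (ennreal (norm (f (x + h) - f x)))\<^sup>2"
    by (simp add: ennreal_power)
  also have "\<dots> \<le> (\<integral>\<^sup>+t. ennreal (norm (indicator {0..1} t *\<^sub>R g t)) \<partial>lborel)\<^sup>2"
    unfolding ftc[symmetric] using int by (intro power_mono integral_norm_bound_ennreal) auto
  also have "\<dots> = (\<integral>\<^sup>+t. indicator {0..1} t * (indicator {0..1} t * ennreal (norm (g t))) \<partial>lborel)\<^sup>2"
    by (intro arg_cong[where f="\<lambda>z. z\<^sup>2"] nn_integral_cong) (auto simp: indicator_def)
  also have "\<dots> \<le> (\<integral>\<^sup>+t. (indicator {0..1::real} t)\<^sup>2 \<partial>lborel) * (\<integral>\<^sup>+t. (indicator {0..1} t * ennreal (norm (g t)))\<^sup>2 \<partial>lborel)"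
    by (rule Cauchy_Schwarz_nn_integral) measurable
  also have "(\<integral>\<^sup>+t. (indicator {0..1::real} t)\<^sup>2 \<partial>lborel) = (\<integral>\<^sup>+t. indicator {0..1::real} t \<partial>lborel)"
    by (intro nn_integral_cong) (auto simp: indicator_def)
  also have "\<dots> = 1" by simp
  also have "1 * (\<integral>\<^sup>+t. (indicator {0..1} t * ennreal (norm (g t)))\<^sup>2 \<partial>lborel)
      \<le> (\<integral>\<^sup>+t. ennreal ((norm h)\<^sup>2) * (indicator {0..1} t * ennreal ((norm (f' (x + t *\<^sub>R h)))\<^sup>2)) \<partial>lborel)"
    unfolding mult_1
  proof (rule nn_integral_mono)
    fix t :: real
    have "(norm (g t))\<^sup>2 \<le> (norm (f' (x + t *\<^sub>R h)) * norm h)\<^sup>2"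
      unfolding g_def by (intro power_mono) (auto simp: Cauchy_Schwarz_ineq2)
    then have "ennreal ((norm (g t))\<^sup>2) \<le> ennreal ((norm h)\<^sup>2) * ennreal ((norm (f' (x + t *\<^sub>R h)))\<^sup>2)"
      by (simp flip: ennreal_mult add: power_mult_distrib mult.commute)
    then show "(indicator {0..1} t * ennreal (norm (g t)))\<^sup>2 \<le> ennreal ((norm h)\<^sup>2) * (indicator {0..1} t * ennreal ((norm (f' (x + t *\<^sub>R h)))\<^sup>2))"
      by (cases "t \<in> {0..1}") (auto simp: ennreal_power)
  qed
  also have "\<dots> = ennreal ((norm h)\<^sup>2) * (\<integral>\<^sup>+t. indicator {0..1} t * ennreal ((norm (f' (x + t *\<^sub>R h)))\<^sup>2) \<partial>lborel)"
  proof (rule nn_integral_cmult)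
    have [measurable]: "f' \<in> borel_measurable borel" by (rule C1_measurable[OF assms])
    show "(\<lambda>t. indicator {0..1} t * ennreal ((norm (f' (x + t *\<^sub>R h)))\<^sup>2)) \<in> borel_measurable lborel" by measurable
  qed
  finally show ?thesis .
qed

lemma L2sq_leb:
  assumes [measurable]: "S \<in> sets borel" "f \<in> borel_measurable borel"
  shows "L2sq (leb S) f = (\<integral>\<^sup>+x. indicator S x * ennreal ((norm (f x))\<^sup>2) \<partial>lborel)"
  unfolding L2sq_def by (subst nn_integral_leb) (auto simp: mult.commute)

lemma L2sq_leb_le_lborel:
  assumes "S \<in> sets borel" "f \<in> borel_measurable borel"
  shows "L2sq (leb S) f \<le> L2sq lborel f"
  unfolding L2sq_leb[OF assms] unfolding L2sq_def by (intro nn_integral_mono) (auto simp: indicator_def)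

text \<open>Differences are formed only where both ends of the segment lie in S, since the gradient of w is
  known on S alone.\<close>

definition shift_dist :: "(real^'n) set \<Rightarrow> (real^'n \<Rightarrow> real) \<Rightarrow> real^'n \<Rightarrow> ennreal" where
  "shift_dist S w h = (\<integral>\<^sup>+x. indicator S x * indicator S (x + h) * ennreal ((w (x + h) - w x)\<^sup>2) \<partial>lborel)"

text \<open>Convexity keeps the whole segment in S. After integration over x, each point of the segment
  contributes at most the squared norm of the gradient over S, by translation invariance.\<close>

lemma C1_shift_dist:
  fixes f :: "real^'n \<Rightarrow> real"
  assumes f: "C1 f f'" and S: "convex S" and [measurable]: "S \<in> sets borel"
  shows "shift_dist S f h \<le> ennreal ((norm h)\<^sup>2) * L2sq (leb S) f'"
proof -
  note [measurable] = C1_measurable[OF f]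
  let ?G = "\<lambda>y. indicator S y * ennreal ((norm (f' y))\<^sup>2)"
  have "shift_dist S f h \<le> (\<integral>\<^sup>+x. \<integral>\<^sup>+t. ennreal ((norm h)\<^sup>2) * (indicator {0..1} t * ?G (x + t *\<^sub>R h)) \<partial>lborel \<partial>lborel)"
    unfolding shift_dist_def
  proof (rule nn_integral_mono)
    fix x :: "real^'n"
    show "indicator S x * indicator S (x + h) * ennreal ((f (x + h) - f x)\<^sup>2)
      \<le> (\<integral>\<^sup>+t. ennreal ((norm h)\<^sup>2) * (indicator {0..1} t * ?G (x + t *\<^sub>R h)) \<partial>lborel)"
    proof (cases "x \<in> S \<and> x + h \<in> S")
      case True
      have inS: "x + t *\<^sub>R h \<in> S" if "t \<in> {0..1}" for t
      proof -
        have "(1 - t) *\<^sub>R x + t *\<^sub>R (x + h) \<in> S" using True that by (intro convexD[OF S]) auto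
        then show ?thesis by (simp add: algebra_simps)
      qed
      have "ennreal ((f (x + h) - f x)\<^sup>2) \<le> ennreal ((norm h)\<^sup>2) * (\<integral>\<^sup>+t. indicator {0..1} t * ennreal ((norm (f' (x + t *\<^sub>R h)))\<^sup>2) \<partial>lborel)"
        by (rule C1_increment_sq[OF f])
      also have "\<dots> = (\<integral>\<^sup>+t. ennreal ((norm h)\<^sup>2) * (indicator {0..1} t * ennreal ((norm (f' (x + t *\<^sub>R h)))\<^sup>2)) \<partial>lborel)"
        by (rule nn_integral_cmult[symmetric]) measurable
      also have "\<dots> = (\<integral>\<^sup>+t. ennreal ((norm h)\<^sup>2) * (indicator {0..1} t * ?G (x + t *\<^sub>R h)) \<partial>lborel)"
        using inS by (intro nn_integral_cong) (auto simp: indicator_def)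
      finally show ?thesis using True by simp
    qed auto
  qed
  also have "\<dots> = (\<integral>\<^sup>+t. \<integral>\<^sup>+x. ennreal ((norm h)\<^sup>2) * (indicator {0..1} t * ?G (x + t *\<^sub>R h)) \<partial>lborel \<partial>lborel)"
    by (rule lborel_pair.Fubini') measurable
  also have "\<dots> = (\<integral>\<^sup>+t. ennreal ((norm h)\<^sup>2) * (indicator {0..1::real} t * L2sq (leb S) f') \<partial>lborel)"
  proof (rule nn_integral_cong)
    fix t :: real
    have "(\<integral>\<^sup>+x. ennreal ((norm h)\<^sup>2) * (indicator {0..1} t * ?G (x + t *\<^sub>R h)) \<partial>lborel)
      = ennreal ((norm h)\<^sup>2) * (indicator {0..1} t * (\<integral>\<^sup>+x. ?G (x + t *\<^sub>R h) \<partial>lborel))"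
      by (subst nn_integral_cmult, measurable, subst nn_integral_cmult, measurable)
    then show "(\<integral>\<^sup>+x. ennreal ((norm h)\<^sup>2) * (indicator {0..1} t * ?G (x + t *\<^sub>R h)) \<partial>lborel)
      = ennreal ((norm h)\<^sup>2) * (indicator {0..1} t * L2sq (leb S) f')"
      by (subst (asm) nn_integral_lborel_shift) (auto simp: L2sq_leb)
  qed
  also have "\<dots> = ennreal ((norm h)\<^sup>2) * L2sq (leb S) f'"
    by (subst nn_integral_cmult, measurable, subst nn_integral_multc) auto
  finally show ?thesis .
qed

lemma AE_lborel_shift:
  fixes a :: "'a::euclidean_space"
  assumes "AE x in lborel. P x"
  shows "AE x in lborel. P (x + a)"
proof -
  obtain N where N: "N \<in> null_sets lborel" "{x. \<not> P x} \<subseteq> N"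
    using assms by (auto elim!: AE_E simp: null_sets_def)
  then have [measurable]: "N \<in> sets borel" by auto
  have "(\<integral>\<^sup>+x. indicator N (x + a) \<partial>lborel) = (\<integral>\<^sup>+x. indicator N x \<partial>lborel)"
    by (rule nn_integral_lborel_shift) measurable
  also have "\<dots> = 0" using N by auto
  finally have "AE x in lborel. (indicator N (x + a) :: ennreal) = 0"
    by (subst (asm) nn_integral_0_iff_AE) auto
  then show ?thesis by eventually_elim (use N in \<open>auto simp: indicator_def split: if_splits\<close>)
qed

text \<open>The translation estimate is lower semicontinuous in w by Fatou's lemma.\<close>

lemma sobolev_shift_dist:
  assumes w: "sobolev S w W" and S: "convex S" and [measurable]: "S \<in> sets borel"
  shows "shift_dist S w h \<le> ennreal ((norm h)\<^sup>2) * L2sq (leb S) W"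
proof -
  obtain f f' where f: "\<And>m::nat. C1 (f m) (f' m)"
    "(\<lambda>m. L2sq (leb S) (\<lambda>x. f m x - w x)) \<longlonglongrightarrow> 0"
    "(\<lambda>m. L2sq (leb S) (\<lambda>x. f' m x - W x)) \<longlonglongrightarrow> 0"
    "AE x in leb S. (\<lambda>m. f m x) \<longlonglongrightarrow> w x" using sobolev_seq[OF w] by blast
  note [measurable] = C1_measurable[OF f(1)] sobolevD(1,2)[OF w]
  let ?I = "\<lambda>g x. indicator S x * indicator S (x + h) * ennreal ((g (x + h) - g x)\<^sup>2)"
  have ae: "AE x in lborel. x \<in> S \<longrightarrow> (\<lambda>m. f m x) \<longlonglongrightarrow> w x" using f(4) by (simp add: AE_leb)
  have lim: "AE x in lborel. (\<lambda>m. ?I (f m) x) \<longlonglongrightarrow> ?I w x"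
    using ae AE_lborel_shift[OF ae, of h]
  proof eventually_elim
    case (elim x)
    show ?case
    proof (cases "x \<in> S \<and> x + h \<in> S")
      case True
      then have "(\<lambda>m. (f m (x + h) - f m x)\<^sup>2) \<longlonglongrightarrow> (w (x + h) - w x)\<^sup>2"
        using elim by (intro tendsto_intros) auto
      from tendsto_ennrealI[OF this] True show ?thesis by simp
    qed auto
  qed
  \<comment> \<open>The norms of the approximating gradients are compared with that of W by Young's inequality,
    with a constant 1 + s that is sent to 1 in the end.\<close>
  have bound: "shift_dist S w h \<le> ennreal ((norm h)\<^sup>2) * (ennreal (1 + s) * L2sq (leb S) W)" if s: "s > 0" for s
  proof -
    have young: "(norm (a + b))\<^sup>2 \<le> (1 + s) * (norm a)\<^sup>2 + (1 + 1/s) * (norm b)\<^sup>2" for a b :: "real^'n"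
    proof -
      have "(norm (a + b))\<^sup>2 \<le> (norm a + norm b)\<^sup>2" by (intro power_mono norm_triangle_ineq) auto
      also have "\<dots> = (norm a)\<^sup>2 + (norm b)\<^sup>2 + 2 * norm a * norm b" by (simp add: power2_sum)
      also have "2 * norm a * norm b \<le> s * (norm a)\<^sup>2 + (1/s) * (norm b)\<^sup>2"
      proof -
        have "0 \<le> (1/s) * (s * norm a - norm b)\<^sup>2" using s by simp
        also have "\<dots> = s * (norm a)\<^sup>2 + (1/s) * (norm b)\<^sup>2 - 2 * norm a * norm b"
          using s by (simp add: power2_diff field_simps power2_eq_square)
        finally show ?thesis by simp
      qed
      finally show ?thesis by (simp add: algebra_simps)
    qed
    let ?A = "ennreal (1 + s) * L2sq (leb S) W"
    have f'_le: "L2sq (leb S) (f' m) \<le> ?A + ennreal (1 + 1/s) * L2sq (leb S) (\<lambda>x. f' m x - W x)" for m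
    proof -
      have "L2sq (leb S) (f' m) \<le> (\<integral>\<^sup>+x. ennreal (1 + s) * ennreal ((norm (W x))\<^sup>2) + ennreal (1 + 1/s) * ennreal ((norm (f' m x - W x))\<^sup>2) \<partial>leb S)"
        unfolding L2sq_def
      proof (rule nn_integral_mono)
        fix x
        have "ennreal ((norm (f' m x))\<^sup>2) \<le> ennreal ((1 + s) * (norm (W x))\<^sup>2 + (1 + 1/s) * (norm (f' m x - W x))\<^sup>2)"
          using young[of "W x" "f' m x - W x"] by (intro ennreal_leI) simp
        then show "ennreal ((norm (f' m x))\<^sup>2) \<le> ennreal (1 + s) * ennreal ((norm (W x))\<^sup>2) + ennreal (1 + 1/s) * ennreal ((norm (f' m x - W x))\<^sup>2)"
          using s by (simp add: ennreal_mult)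
      qed
      also have "\<dots> = ?A + ennreal (1 + 1/s) * L2sq (leb S) (\<lambda>x. f' m x - W x)"
        unfolding L2sq_def by (subst nn_integral_add) (auto simp: nn_integral_cmult)
      finally show ?thesis .
    qed
    have "(\<lambda>m. ennreal (1 + 1/s) * L2sq (leb S) (\<lambda>x. f' m x - W x)) \<longlonglongrightarrow> ennreal (1 + 1/s) * 0"
      using f(3) by (intro ennreal_tendsto_cmult) auto
    then have "(\<lambda>m. ?A + ennreal (1 + 1/s) * L2sq (leb S) (\<lambda>x. f' m x - W x)) \<longlonglongrightarrow> ?A + ennreal (1 + 1/s) * 0"
      by (intro tendsto_add tendsto_const)
    then have L: "(\<lambda>m. ennreal ((norm h)\<^sup>2) * (?A + ennreal (1 + 1/s) * L2sq (leb S) (\<lambda>x. f' m x - W x))) \<longlonglongrightarrow> ennreal ((norm h)\<^sup>2) * ?A"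
      using ennreal_tendsto_cmult[of "ennreal ((norm h)\<^sup>2)"] by fastforce
    have "shift_dist S w h = (\<integral>\<^sup>+x. liminf (\<lambda>m. ?I (f m) x) \<partial>lborel)"
      unfolding shift_dist_def
    proof (rule nn_integral_cong_AE)
      show "AE x in lborel. ?I w x = liminf (\<lambda>m. ?I (f m) x)"
        using lim by eventually_elim (rule sym, rule lim_imp_Liminf, auto)
    qed
    also have "\<dots> \<le> liminf (\<lambda>m. shift_dist S (f m) h)"
      unfolding shift_dist_def by (rule nn_integral_liminf) measurable
    also have "\<dots> \<le> liminf (\<lambda>m. ennreal ((norm h)\<^sup>2) * (?A + ennreal (1 + 1/s) * L2sq (leb S) (\<lambda>x. f' m x - W x)))"
    proof (intro Liminf_mono always_eventually allI)
      fix m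
      have "shift_dist S (f m) h \<le> ennreal ((norm h)\<^sup>2) * L2sq (leb S) (f' m)"
        by (rule C1_shift_dist[OF f(1) S]) measurable
      also have "\<dots> \<le> ennreal ((norm h)\<^sup>2) * (?A + ennreal (1 + 1/s) * L2sq (leb S) (\<lambda>x. f' m x - W x))"
        by (intro mult_left_mono f'_le) simp
      finally show "shift_dist S (f m) h \<le> ennreal ((norm h)\<^sup>2) * (?A + ennreal (1 + 1/s) * L2sq (leb S) (\<lambda>x. f' m x - W x))" .
    qed
    also have "\<dots> = ennreal ((norm h)\<^sup>2) * ?A"
      by (rule lim_imp_Liminf[OF _ L]) simp
    finally show ?thesis .
  qed
  have "(\<lambda>m::nat. ennreal (1 + 1 / Suc m)) \<longlonglongrightarrow> ennreal (1 + 0)"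
    by (intro tendsto_ennrealI tendsto_intros LIMSEQ_Suc[OF lim_1_over_n])
  then have "(\<lambda>m::nat. (ennreal ((norm h)\<^sup>2) * L2sq (leb S) W) * ennreal (1 + 1 / Suc m)) \<longlonglongrightarrow> (ennreal ((norm h)\<^sup>2) * L2sq (leb S) W) * ennreal (1 + 0)"
    using sobolevD(4)[OF w] by (intro ennreal_tendsto_cmult) (auto simp: ennreal_mult_less_top)
  then have "(\<lambda>m::nat. ennreal ((norm h)\<^sup>2) * (ennreal (1 + 1 / Suc m) * L2sq (leb S) W)) \<longlonglongrightarrow> ennreal ((norm h)\<^sup>2) * L2sq (leb S) W"
    by (simp add: mult_ac)
  then show ?thesis
    by (rule LIMSEQ_le_const) (intro exI[of _ "0::nat"] allI impI bound, simp)
qed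

section \<open>Faber-Krahn and Poincare inequalities on cubes\<close>

lemma cube_eq_box: "cube x0 r = box (x0 - vec (r/2)) (x0 + vec (r/2))"
proof -
  have *: "\<bar>a - b\<bar> < r / 2 \<longleftrightarrow> b - r/2 < a \<and> a < b + r/2" for a b :: real by linarith
  show ?thesis unfolding cube_def * by (simp add: mem_box_cart set_eq_iff)
qed

lemma cube_facts[simp]:
  shows open_cube: "open (cube x0 r)" and convex_cube: "convex (cube x0 r)"
    and bounded_cube: "bounded (cube x0 r)" and sets_cube[measurable]: "cube x0 r \<in> sets borel"
  unfolding cube_eq_box by auto

lemma emeasure_cube:
  fixes x0 :: "real^'n"
  assumes "0 \<le> r" shows "emeasure lborel (cube x0 r) = ennreal (r ^ CARD('n))"
proof -
  have *: "(x0 + vec (r/2) - (x0 - vec (r/2))) \<bullet> b = r" if "b \<in> Basis" for b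
    using that by (auto simp: Basis_vec_def inner_axis algebra_simps)
  have "emeasure lborel (cube x0 r) = (\<Prod>b\<in>(Basis::(real^'n) set). (x0 + vec (r/2) - (x0 - vec (r/2))) \<bullet> b)"
    unfolding cube_eq_box
    by (rule emeasure_lborel_box) (use assms in \<open>auto simp: Basis_vec_def inner_axis\<close>)
  also have "(\<Prod>b\<in>(Basis::(real^'n) set). (x0 + vec (r/2) - (x0 - vec (r/2))) \<bullet> b) = (\<Prod>b\<in>(Basis::(real^'n) set). r)"
    by (rule prod.cong[OF refl *])
  finally show ?thesis by simp
qed

lemma cube_add:
  assumes "x \<in> cube y r" "h \<in> cube 0 s" shows "x + h \<in> cube y (r + s)"
  unfolding cube_def
proof safe
  fix i
  have "\<bar>x $ i - y $ i\<bar> < r / 2" "\<bar>h $ i\<bar> < s / 2" using assms by (auto simp: cube_def)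
  then show "\<bar>(x + h) $ i - y $ i\<bar> < (r + s) / 2"
    unfolding vector_add_component abs_less_iff by (simp add: add_divide_distrib)
qed

lemma cube_mono: "r \<le> s \<Longrightarrow> cube y r \<subseteq> cube y s"
proof
  fix x assume "r \<le> s" "x \<in> cube y r"
  then have "\<bar>x $ i - y $ i\<bar> < r / 2" "r / 2 \<le> s / 2" for i by (auto simp: cube_def)
  then show "x \<in> cube y s" unfolding cube_def using less_le_trans by blast
qed

lemma norm_sq_cube:
  fixes h :: "real^'n"
  assumes "h \<in> cube 0 r" shows "(norm h)\<^sup>2 \<le> real CARD('n) * r\<^sup>2 / 4"
proof -
  have "(norm h)\<^sup>2 = (\<Sum>i\<in>UNIV. (h $ i)\<^sup>2)"
    unfolding power2_norm_eq_inner inner_vec_def by (simp add: power2_eq_square)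
  also have "\<dots> \<le> (\<Sum>i\<in>(UNIV::'n set). (r / 2)\<^sup>2)"
  proof (rule sum_mono)
    fix i
    have "\<bar>h $ i\<bar> \<le> r / 2" using assms by (auto simp: cube_def intro: less_imp_le)
    then have "\<bar>h $ i\<bar>\<^sup>2 \<le> (r/2)\<^sup>2" by (intro power_mono) auto
    then show "(h $ i)\<^sup>2 \<le> (r/2)\<^sup>2" by simp
  qed
  finally show ?thesis by (simp add: power_divide)
qed

lemma L2sq_leb_mono:
  assumes "S \<subseteq> T" and [measurable]: "S \<in> sets borel" "T \<in> sets borel" "f \<in> borel_measurable borel" "g \<in> borel_measurable borel"
    and "\<And>x. x \<in> S \<Longrightarrow> norm (f x) \<le> norm (g x)"
  shows "L2sq (leb S) f \<le> L2sq (leb T) g"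
proof -
  have "indicator S x * ennreal ((norm (f x))\<^sup>2) \<le> indicator T x * ennreal ((norm (g x))\<^sup>2)" for x
    using assms(1) assms(6)[of x] by (auto simp: indicator_def intro!: ennreal_leI power_mono)
  then show ?thesis by (simp add: L2sq_leb nn_integral_mono)
qed

lemma sobolev_subset:
  assumes w: "sobolev S w W" and "T \<subseteq> S" and [measurable]: "S \<in> sets borel" "T \<in> sets borel"
  shows "sobolev T w W"
proof -
  obtain f f' where f: "\<And>m::nat. C1 (f m) (f' m)"
    "(\<lambda>m. L2sq (leb S) (\<lambda>x. f m x - w x)) \<longlonglongrightarrow> 0"
    "(\<lambda>m. L2sq (leb S) (\<lambda>x. f' m x - W x)) \<longlonglongrightarrow> 0"
    "AE x in leb S. (\<lambda>m. f m x) \<longlonglongrightarrow> w x" using sobolev_seq[OF w] by blast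
  note [measurable] = C1_measurable[OF f(1)] sobolevD(1,2)[OF w]
  have m: "L2sq (leb T) g \<le> L2sq (leb S) g" if "g \<in> borel_measurable borel" for g :: "_ \<Rightarrow> 'b::euclidean_space"
    using that assms(2) by (intro L2sq_leb_mono) auto
  show ?thesis
  proof (rule sobolevI_seq[OF _ _ _ _ f(1)])
    show "L2sq (leb T) w < \<infinity>" "L2sq (leb T) W < \<infinity>"
      using m[of w] m[of W] sobolevD[OF w] by (auto intro: le_less_trans)
    show "(\<lambda>m. L2sq (leb T) (\<lambda>x. f m x - w x)) \<longlonglongrightarrow> 0"
      by (rule ennreal_squeeze_zero[OF m f(2)]) measurable
    show "(\<lambda>m. L2sq (leb T) (\<lambda>x. f' m x - W x)) \<longlonglongrightarrow> 0"
      by (rule ennreal_squeeze_zero[OF m f(3)]) measurable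
  qed auto
qed

text \<open>For x in A at least half of the points x + h, with h in the cube of side \<rho>, lie outside A,
  because the cube has at least twice the measure of A. There w vanishes, so that w(x)^2 is at
  most twice the average of (w(x + h) - w(x))^2 over h. Integration over x and the translation
  estimate give the claim. The cube of side 3r contains all these translates.\<close>

lemma sobolev_faber_krahn:
  fixes w :: "real^'n \<Rightarrow> real"
  assumes w: "sobolev S w W" and S: "convex S" and [measurable]: "S \<in> sets borel" "A \<in> sets borel"
    and A: "A \<subseteq> cube y r" "cube y (3 * r) \<subseteq> S" "\<And>x. x \<in> S \<Longrightarrow> x \<notin> A \<Longrightarrow> w x = 0"
    and meas: "emeasure lborel A \<le> ennreal (\<rho> ^ CARD('n) / 2)" and \<rho>: "0 < \<rho>" "\<rho> \<le> 2 * r"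
  shows "L2sq (leb S) w \<le> ennreal (real CARD('n) * \<rho>\<^sup>2 / 2) * L2sq (leb S) W"
proof -
  note [measurable] = sobolevD(1,2)[OF w]
  let ?n = "CARD('n)" and ?H = "cube 0 \<rho> :: (real^'n) set"
  let ?J = "\<lambda>x h. indicator ?H h * (indicator S x * indicator S (x + h) * ennreal ((w (x + h) - w x)\<^sup>2))"
  have step1: "ennreal (\<rho> ^ ?n / 2) * (indicator S x * ennreal ((norm (w x))\<^sup>2)) \<le> (\<integral>\<^sup>+h. ?J x h \<partial>lborel)" for x
  proof (cases "x \<in> S \<and> x \<in> A")
    case False
    then show ?thesis using A(3)[of x] by (cases "x \<in> S") auto
  next
    case True
    define B where "B = {h \<in> ?H. x + h \<notin> A}"
    have Bm[measurable]: "B \<in> sets borel" unfolding B_def by measurable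
    have shiftA: "emeasure lborel {h. x + h \<in> A} = emeasure lborel A"
    proof -
      have "emeasure lborel {h. x + h \<in> A} = (\<integral>\<^sup>+h. indicator {h. x + h \<in> A} h \<partial>lborel)"
        by (rule nn_integral_indicator[symmetric]) measurable
      also have "\<dots> = (\<integral>\<^sup>+h. indicator A (h + x) \<partial>lborel)"
        by (intro nn_integral_cong) (auto simp: indicator_def add.commute)
      also have "\<dots> = emeasure lborel A" by (subst nn_integral_lborel_shift) auto
      finally show ?thesis .
    qed
    have "emeasure lborel ?H \<le> emeasure lborel (B \<union> {h. x + h \<in> A})"
      by (rule emeasure_mono) (auto simp: B_def)
    also have "\<dots> \<le> emeasure lborel B + emeasure lborel {h. x + h \<in> A}"
      by (rule emeasure_subadditive) measurable
    also have "\<dots> \<le> emeasure lborel B + ennreal (\<rho> ^ ?n / 2)" unfolding shiftA by (intro add_left_mono meas)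
    finally have "ennreal (\<rho> ^ ?n / 2) + ennreal (\<rho> ^ ?n / 2) \<le> ennreal (\<rho> ^ ?n / 2) + emeasure lborel B"
      using \<rho> by (simp add: emeasure_cube add.commute flip: ennreal_plus)
    then have B: "ennreal (\<rho> ^ ?n / 2) \<le> emeasure lborel B" by (simp add: ennreal_add_left_cancel_le)
    have "ennreal (\<rho> ^ ?n / 2) * (indicator S x * ennreal ((norm (w x))\<^sup>2)) \<le> emeasure lborel B * ennreal ((w x)\<^sup>2)"
      using True B by (auto intro: mult_right_mono)
    also have "\<dots> = (\<integral>\<^sup>+h. indicator B h * ennreal ((w x)\<^sup>2) \<partial>lborel)"
      by (subst nn_integral_multc) auto
    also have "\<dots> \<le> (\<integral>\<^sup>+h. ?J x h \<partial>lborel)"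
    proof (rule nn_integral_mono)
      fix h
      show "indicator B h * ennreal ((w x)\<^sup>2) \<le> ?J x h"
      proof (cases "h \<in> B")
        case hB: True
        then have h: "h \<in> ?H" "x + h \<notin> A" by (auto simp: B_def)
        have "x + h \<in> cube y (r + \<rho>)" using True A(1) h by (intro cube_add) auto
        then have "x + h \<in> S" using cube_mono[of "r + \<rho>" "3 * r" y] A(2) \<rho> by auto
        then show ?thesis using A(3)[of "x + h"] h True hB by simp
      qed auto
    qed
    finally show ?thesis .
  qed
  have "ennreal (\<rho> ^ ?n / 2) * L2sq (leb S) w = (\<integral>\<^sup>+x. ennreal (\<rho> ^ ?n / 2) * (indicator S x * ennreal ((norm (w x))\<^sup>2)) \<partial>lborel)"
    by (subst L2sq_leb, measurable, subst nn_integral_cmult) auto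
  also have "\<dots> \<le> (\<integral>\<^sup>+x. \<integral>\<^sup>+h. ?J x h \<partial>lborel \<partial>lborel)" by (intro nn_integral_mono step1)
  also have "\<dots> = (\<integral>\<^sup>+h. \<integral>\<^sup>+x. ?J x h \<partial>lborel \<partial>lborel)" by (rule lborel_pair.Fubini') measurable
  also have "\<dots> = (\<integral>\<^sup>+h. indicator ?H h * shift_dist S w h \<partial>lborel)"
    unfolding shift_dist_def by (intro nn_integral_cong nn_integral_cmult) measurable
  also have "\<dots> \<le> (\<integral>\<^sup>+h. indicator ?H h * (ennreal (real ?n * \<rho>\<^sup>2 / 4) * L2sq (leb S) W) \<partial>lborel)"
  proof (rule nn_integral_mono)
    fix h :: "real^'n"
    show "indicator ?H h * shift_dist S w h \<le> indicator ?H h * (ennreal (real ?n * \<rho>\<^sup>2 / 4) * L2sq (leb S) W)"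
    proof (cases "h \<in> ?H")
      case True
      have "shift_dist S w h \<le> ennreal ((norm h)\<^sup>2) * L2sq (leb S) W"
        by (rule sobolev_shift_dist[OF w S]) measurable
      also have "\<dots> \<le> ennreal (real ?n * \<rho>\<^sup>2 / 4) * L2sq (leb S) W"
        by (intro mult_right_mono ennreal_leI norm_sq_cube[OF True]) simp
      finally show ?thesis by (intro mult_left_mono) auto
    qed auto
  qed
  also have "\<dots> = ennreal (\<rho> ^ ?n) * (ennreal (real ?n * \<rho>\<^sup>2 / 4) * L2sq (leb S) W)"
    using \<rho> by (subst nn_integral_multc) (auto simp: emeasure_cube)
  finally have "ennreal (2 / \<rho> ^ ?n) * (ennreal (\<rho> ^ ?n / 2) * L2sq (leb S) w)
    \<le> ennreal (2 / \<rho> ^ ?n) * (ennreal (\<rho> ^ ?n) * (ennreal (real ?n * \<rho>\<^sup>2 / 4) * L2sq (leb S) W))"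
    by (intro mult_left_mono) auto
  then have "(ennreal (2 / \<rho> ^ ?n) * ennreal (\<rho> ^ ?n / 2)) * L2sq (leb S) w
    \<le> (ennreal (2 / \<rho> ^ ?n) * ennreal (\<rho> ^ ?n) * ennreal (real ?n * \<rho>\<^sup>2 / 4)) * L2sq (leb S) W"
    by (simp only: mult.assoc)
  moreover have "ennreal (2 / \<rho> ^ ?n) * ennreal (\<rho> ^ ?n / 2) = 1"
    using \<rho> by (subst ennreal_mult[symmetric]) auto
  moreover have "ennreal (2 / \<rho> ^ ?n) * ennreal (\<rho> ^ ?n) * ennreal (real ?n * \<rho>\<^sup>2 / 4) = ennreal (real ?n * \<rho>\<^sup>2 / 2)"
    using \<rho> by (subst ennreal_mult[symmetric], simp, simp, subst ennreal_mult[symmetric]) auto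
  ultimately show ?thesis by simp
qed

text \<open>The integral of (w(x) - w(z))^2 over all pairs of points of the cube is the integral of the
  translation distances over all h = x - z, which lie in the cube of twice the side. The
  constant is the value of w at a point z whose share of this double integral does not exceed
  the average.\<close>

lemma sobolev_poincare:
  fixes w :: "real^'n \<Rightarrow> real"
  assumes w: "sobolev (cube y R) w W" and R: "R > 0"
  shows "\<exists>c. L2sq (leb (cube y R)) (\<lambda>x. w x - c) \<le> ennreal (2 ^ CARD('n) * (real CARD('n) * R\<^sup>2)) * L2sq (leb (cube y R)) W"
proof -
  note [measurable] = sobolevD(1,2)[OF w]
  let ?n = "CARD('n)" and ?Q = "cube y R" and ?H = "cube 0 (2*R) :: (real^'n) set"
  define K where "K = ennreal (2 ^ ?n * (real ?n * R\<^sup>2)) * L2sq (leb ?Q) W"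
  have K: "K < \<infinity>" using sobolevD(4)[OF w] by (simp add: K_def ennreal_mult_less_top)
  define L where "L z = L2sq (leb ?Q) (\<lambda>x. w x - w z)" for z
  have L: "L z = (\<integral>\<^sup>+x. indicator ?Q x * ennreal ((w x - w z)\<^sup>2) \<partial>lborel)" for z
    unfolding L_def by (subst L2sq_leb) auto
  have [measurable]: "L \<in> borel_measurable borel" unfolding L[abs_def] by measurable
  have "(\<integral>\<^sup>+z. indicator ?Q z * L z \<partial>lborel) = (\<integral>\<^sup>+z. \<integral>\<^sup>+h. indicator ?Q z * indicator ?Q (z + h) * ennreal ((w (z + h) - w z)\<^sup>2) \<partial>lborel \<partial>lborel)"
  proof (rule nn_integral_cong)
    fix z
    have "indicator ?Q z * L z = (\<integral>\<^sup>+x. indicator ?Q z * (indicator ?Q x * ennreal ((w x - w z)\<^sup>2)) \<partial>lborel)"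
      unfolding L by (rule nn_integral_cmult[symmetric]) measurable
    also have "\<dots> = (\<integral>\<^sup>+x. indicator ?Q z * (indicator ?Q (x + z) * ennreal ((w (x + z) - w z)\<^sup>2)) \<partial>lborel)"
      by (rule nn_integral_lborel_shift[symmetric]) measurable
    finally show "indicator ?Q z * L z = (\<integral>\<^sup>+h. indicator ?Q z * indicator ?Q (z + h) * ennreal ((w (z + h) - w z)\<^sup>2) \<partial>lborel)"
      by (simp add: add.commute mult.assoc)
  qed
  also have "\<dots> = (\<integral>\<^sup>+h. shift_dist ?Q w h \<partial>lborel)"
    unfolding shift_dist_def by (rule lborel_pair.Fubini') measurable
  also have "\<dots> \<le> (\<integral>\<^sup>+h. indicator ?H h * (ennreal (real ?n * R\<^sup>2) * L2sq (leb ?Q) W) \<partial>lborel)"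
  proof (rule nn_integral_mono)
    fix h :: "real^'n"
    show "shift_dist ?Q w h \<le> indicator ?H h * (ennreal (real ?n * R\<^sup>2) * L2sq (leb ?Q) W)"
    proof (cases "h \<in> ?H")
      case True
      have "shift_dist ?Q w h \<le> ennreal ((norm h)\<^sup>2) * L2sq (leb ?Q) W"
        by (rule sobolev_shift_dist[OF w]) auto
      also have "\<dots> \<le> ennreal (real ?n * R\<^sup>2) * L2sq (leb ?Q) W"
        using norm_sq_cube[OF True] by (intro mult_right_mono ennreal_leI) auto
      finally show ?thesis using True by simp
    next
      case False
      have "\<not> (x \<in> ?Q \<and> x + h \<in> ?Q)" for x
      proof
        assume *: "x \<in> ?Q \<and> x + h \<in> ?Q"
        have "\<bar>h $ i\<bar> < R" for i
        proof -
          have "\<bar>x $ i - y $ i\<bar> < R / 2" "\<bar>(x + h) $ i - y $ i\<bar> < R / 2" using * by (auto simp: cube_def)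
          then show ?thesis unfolding vector_add_component by linarith
        qed
        with False show False by (simp add: cube_def)
      qed
      then have "indicator ?Q x * indicator ?Q (x + h) * ennreal ((w (x + h) - w x)\<^sup>2) = 0" for x
        by (auto simp: indicator_def)
      then show ?thesis unfolding shift_dist_def by (simp only: nn_integral_const) simp
    qed
  qed
  also have "\<dots> = ennreal ((2 * R) ^ ?n) * (ennreal (real ?n * R\<^sup>2) * L2sq (leb ?Q) W)"
    using R by (subst nn_integral_multc) (auto simp: emeasure_cube)
  also have "\<dots> = ennreal (R ^ ?n) * K"
  proof -
    have "ennreal ((2 * R) ^ ?n) * ennreal (real ?n * R\<^sup>2) = ennreal ((2 * R) ^ ?n * (real ?n * R\<^sup>2))"
      using R by (intro ennreal_mult[symmetric]) auto
    also have "\<dots> = ennreal (R ^ ?n * (2 ^ ?n * (real ?n * R\<^sup>2)))" by (simp only: power_mult_distrib mult_ac)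
    also have "\<dots> = ennreal (R ^ ?n) * ennreal (2 ^ ?n * (real ?n * R\<^sup>2))"
      using R by (intro ennreal_mult) auto
    finally show ?thesis unfolding K_def mult.assoc[symmetric] by simp
  qed
  also have "\<dots> = (\<integral>\<^sup>+z. indicator ?Q z * K \<partial>lborel)"
    using R by (subst nn_integral_multc) (auto simp: emeasure_cube)
  finally have le: "(\<integral>\<^sup>+z. indicator ?Q z * L z \<partial>lborel) \<le> (\<integral>\<^sup>+z. indicator ?Q z * K \<partial>lborel)" .
  \<comment> \<open>K is finite and the average of L over the cube does not exceed it.\<close>
  have "\<exists>z. L z \<le> K"
  proof (rule ccontr)
    assume "\<not> (\<exists>z. L z \<le> K)"
    then have gt: "\<And>z. K < L z" by (auto simp: not_le)
    have "(\<integral>\<^sup>+z. indicator ?Q z * K \<partial>lborel) < (\<integral>\<^sup>+z. indicator ?Q z * L z \<partial>lborel)"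
    proof (rule nn_integral_less)
      have "(\<integral>\<^sup>+z. indicator ?Q z * K \<partial>lborel) = ennreal (R ^ ?n) * K"
        using R by (subst nn_integral_multc) (auto simp: emeasure_cube)
      then show "(\<integral>\<^sup>+z. indicator ?Q z * K \<partial>lborel) \<noteq> \<infinity>" using K by (simp add: ennreal_mult_eq_top_iff)
      show "AE z in lborel. indicator ?Q z * K \<le> indicator ?Q z * L z"
        using gt by (intro AE_I2 mult_left_mono) (auto intro: less_imp_le)
      show "\<not> (AE z in lborel. indicator ?Q z * L z \<le> indicator ?Q z * K)"
      proof
        assume "AE z in lborel. indicator ?Q z * L z \<le> indicator ?Q z * K"
        then have "AE z in lborel. z \<notin> ?Q"
        proof eventually_elim
          case (elim z)
          then show ?case using gt[of z] by (cases "z \<in> ?Q") (auto dest: leD)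
        qed
        then have "emeasure lborel ?Q = 0"
          by (subst (asm) AE_iff_measurable[of ?Q]) auto
        then show False using R by (simp add: emeasure_cube)
      qed
    qed measurable
    then show False using le by simp
  qed
  then show ?thesis unfolding L_def K_def by blast
qed

section \<open>Cut-off functions\<close>

text \<open>A C1 transition from 0 on the negative half-line to 1 beyond 1, built from the C1 function (max
  0 t)^2.\<close>

definition smoothstep :: "real \<Rightarrow> real" where
  "smoothstep t = 1 - (max 0 (1 - (max 0 t)\<^sup>2))\<^sup>2"
definition smoothstep' :: "real \<Rightarrow> real" where
  "smoothstep' t = 2 * max 0 (1 - (max 0 t)\<^sup>2) * (2 * max 0 t)"

lemma smoothstep_deriv: "(smoothstep has_real_derivative smoothstep' t) (at t)"
proof -
  let ?p = "\<lambda>s::real. (max 0 s)\<^sup>2"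
  have p: "\<And>s. (?p has_real_derivative 2 * max 0 s) (at s)" using C1r_pos_part_sq by (simp add: C1r_def)
  have 1: "((\<lambda>t. 1 - ?p t) has_real_derivative (0 - 2 * max 0 t)) (at t)"
    by (intro DERIV_diff DERIV_const p)
  have "((\<lambda>t. ?p (1 - ?p t)) has_real_derivative (2 * max 0 (1 - ?p t)) * (0 - 2 * max 0 t)) (at t)"
    by (rule DERIV_chain2[OF p 1])
  from DERIV_diff[OF DERIV_const this, of 1] show ?thesis
    unfolding smoothstep_def[abs_def] smoothstep'_def by (simp add: algebra_simps)
qed

lemma C1r_smoothstep: "C1r smoothstep smoothstep'"
  unfolding C1r_def using smoothstep_deriv
  by (auto simp: smoothstep'_def[abs_def] intro!: continuous_intros)

lemma smoothstep_facts:
  "t \<le> 0 \<Longrightarrow> smoothstep t = 0" "t \<le> 0 \<Longrightarrow> smoothstep' t = 0" "t \<ge> 1 \<Longrightarrow> smoothstep t = 1"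
  "0 \<le> smoothstep t" "smoothstep t \<le> 1" "\<bar>smoothstep' t\<bar> \<le> 4"
proof -
  have m: "0 \<le> max 0 (1 - (max 0 t)\<^sup>2)" "max 0 (1 - (max 0 t)\<^sup>2) \<le> 1" by auto
  have "(max 0 (1 - (max 0 t)\<^sup>2))\<^sup>2 \<le> 1" using power_mono[OF m(2,1), of 2] by simp
  then show "0 \<le> smoothstep t" "smoothstep t \<le> 1" by (auto simp: smoothstep_def)
  show "t \<le> 0 \<Longrightarrow> smoothstep t = 0" "t \<le> 0 \<Longrightarrow> smoothstep' t = 0" by (auto simp: smoothstep_def smoothstep'_def)
  have t1: "max 0 (1 - (max 0 t)\<^sup>2) = 0" if "t \<ge> 1"
  proof -
    have "1 \<le> t\<^sup>2" using that by (rule one_le_power)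
    then have "1 - (max 0 t)\<^sup>2 \<le> 0" using that by simp
    then show ?thesis by (rule max_absorb1)
  qed
  then show "t \<ge> 1 \<Longrightarrow> smoothstep t = 1" by (simp add: smoothstep_def)
  show "\<bar>smoothstep' t\<bar> \<le> 4"
  proof (cases "t \<ge> 1")
    case True then show ?thesis using t1 by (simp add: smoothstep'_def)
  next
    case False
    then have "max 0 (1 - (max 0 t)\<^sup>2) * max 0 t \<le> 1 * 1" by (intro mult_mono m) auto
    then show ?thesis using m by (simp add: smoothstep'_def abs_mult)
  qed
qed

text \<open>A product of one-dimensional cut-offs. Each one is a function of the square of the coordinate,
  which avoids the kink of the absolute value.\<close>

lemma cube_cutoff:
  fixes y :: "real^'n"
  assumes s: "0 \<le> s" "s < r"
  obtains \<eta> \<eta>' where "C1 \<eta> \<eta>'" "\<And>x. 0 \<le> \<eta> x" "\<And>x. \<eta> x \<le> 1" "\<And>x. x \<in> cube y s \<Longrightarrow> \<eta> x = 1"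
    "\<And>x. x \<notin> cube y r \<Longrightarrow> \<eta> x = 0" "\<And>x. x \<notin> cube y r \<Longrightarrow> \<eta>' x = 0"
    "\<And>x. norm (\<eta>' x) \<le> 16 * real CARD('n) / (r - s)"
proof -
  have rs: "0 < r\<^sup>2 - s\<^sup>2" using s by (simp add: power_strict_mono)
  define a where "a t = (r\<^sup>2 - 4 * t\<^sup>2) / (r\<^sup>2 - s\<^sup>2)" for t
  define \<theta> where "\<theta> t = smoothstep (a t)" for t
  define \<theta>' where "\<theta>' t = smoothstep' (a t) * (- 8 * t / (r\<^sup>2 - s\<^sup>2))" for t
  have der: "(\<theta> has_real_derivative \<theta>' t) (at t)" for t
    unfolding \<theta>_def \<theta>'_def a_def using rs
    by (intro DERIV_chain2[OF smoothstep_deriv]) (auto intro!: derivative_eq_intros)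
  have cont': "continuous_on UNIV \<theta>'"
    unfolding \<theta>'_def a_def using rs C1r_smoothstep
    by (auto simp: C1r_def intro!: continuous_intros continuous_on_compose2[of UNIV smoothstep'])
  have cont: "continuous_on UNIV \<theta>"
    using der by (meson DERIV_continuous continuous_at_imp_continuous_on)
  have out: "\<theta> t = 0" "\<theta>' t = 0" if "\<bar>t\<bar> \<ge> r / 2" for t
  proof -
    have "(r/2)\<^sup>2 \<le> \<bar>t\<bar>\<^sup>2" using that s by (intro power_mono) auto
    then have "a t \<le> 0" unfolding a_def using rs by (intro divide_nonpos_pos) (auto simp: power_divide)
    then show "\<theta> t = 0" "\<theta>' t = 0" by (auto simp: \<theta>_def \<theta>'_def smoothstep_facts)
  qed
  have inn: "\<theta> t = 1" if "\<bar>t\<bar> \<le> s / 2" for t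
  proof -
    have "\<bar>t\<bar>\<^sup>2 \<le> (s/2)\<^sup>2" using that by (intro power_mono) auto
    then have "a t \<ge> 1" unfolding a_def using rs by (simp add: power_divide)
    then show ?thesis by (auto simp: \<theta>_def smoothstep_facts)
  qed
  have range: "0 \<le> \<theta> t" "\<theta> t \<le> 1" for t by (auto simp: \<theta>_def smoothstep_facts)
  have bd: "\<bar>\<theta>' t\<bar> \<le> 16 / (r - s)" for t
  proof (cases "\<bar>t\<bar> \<ge> r / 2")
    case True then show ?thesis using out s by simp
  next
    case False
    have "\<bar>- 8 * t / (r\<^sup>2 - s\<^sup>2)\<bar> \<le> 4 * r / (r\<^sup>2 - s\<^sup>2)"
      using False rs by (simp add: abs_mult divide_right_mono)
    also have "\<dots> \<le> 4 / (r - s)"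
    proof -
      have e1: "r\<^sup>2 - s\<^sup>2 = (r - s) * (r + s)" by (simp add: power2_eq_square algebra_simps)
      have "r / (r + s) \<le> 1" using s by simp
      then have "4 * (r / (r + s)) \<le> 4" by linarith
      then have e2: "4 * (r / (r + s)) / (r - s) \<le> 4 / (r - s)" by (rule divide_right_mono) (use s in simp)
      have e3: "4 * (r / (r + s)) / (r - s) = 4 * r / ((r - s) * (r + s))" by simp
      show ?thesis unfolding e1 using e2 unfolding e3 .
    qed
    finally have "\<bar>\<theta>' t\<bar> \<le> 4 * (4 / (r - s))"
      unfolding \<theta>'_def abs_mult by (intro mult_mono smoothstep_facts) auto
    then show ?thesis by simp
  qed
  define \<eta> where "\<eta> x = (\<Prod>i\<in>UNIV. \<theta> (x $ i - y $ i))" for x :: "real^'n"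
  define \<eta>' where "\<eta>' x = (\<chi> i. \<theta>' (x $ i - y $ i) * (\<Prod>j\<in>UNIV - {i}. \<theta> (x $ j - y $ j)))" for x :: "real^'n"
  show ?thesis
  proof
    show "C1 \<eta> \<eta>'" unfolding C1_def
    proof (intro conjI allI)
      fix x
      have "((\<lambda>x. \<theta> (x $ i - y $ i)) has_derivative (\<lambda>h. h $ i * \<theta>' (x $ i - y $ i))) (at x)" for i
      proof -
        have 1: "((\<lambda>x. x $ i - y $ i) has_derivative (\<lambda>h. h $ i)) (at x)"
          by (auto intro!: derivative_eq_intros bounded_linear.has_derivative[OF bounded_linear_vec_nth])
        have 2: "(\<theta> has_derivative (\<lambda>h. h * \<theta>' (x $ i - y $ i))) (at (x $ i - y $ i))"
          using der by (simp add: has_field_derivative_def mult_commute_abs)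
        show ?thesis using has_derivative_compose[OF 1 2] by simp
      qed
      then have "(\<eta> has_derivative (\<lambda>h. \<Sum>i\<in>UNIV. h $ i * \<theta>' (x $ i - y $ i) * (\<Prod>j\<in>UNIV - {i}. \<theta> (x $ j - y $ j)))) (at x)"
        unfolding \<eta>_def[abs_def] by (intro has_derivative_prod) auto
      then show "(\<eta> has_derivative (\<lambda>h. \<eta>' x \<bullet> h)) (at x)"
        by (simp add: \<eta>'_def inner_vec_def mult_ac)
    next
      have "continuous_on UNIV (\<lambda>x. \<theta>' (x $ i - y $ i) * (\<Prod>j\<in>UNIV - {i}. \<theta> (x $ j - y $ j)))" for i
        by (intro continuous_intros continuous_on_compose2[OF cont'] continuous_on_compose2[OF cont]) auto
      then show "continuous_on UNIV \<eta>'" unfolding \<eta>'_def by (intro continuous_on_vec_lambda)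
    qed
    show "0 \<le> \<eta> x" "\<eta> x \<le> 1" for x unfolding \<eta>_def by (auto intro!: prod_nonneg prod_le_1 range)
    show "\<eta> x = 1" if "x \<in> cube y s" for x
      using that inn by (auto simp: \<eta>_def cube_def intro!: prod.neutral less_imp_le)
    show "\<eta> x = 0" if x: "x \<notin> cube y r" for x
    proof -
      obtain i where "\<bar>x $ i - y $ i\<bar> \<ge> r / 2" using x by (auto simp: cube_def not_less)
      then have "\<theta> (x $ i - y $ i) = 0" using out by blast
      then show ?thesis unfolding \<eta>_def by (intro prod_zero) auto
    qed
    show "\<eta>' x = 0" if x: "x \<notin> cube y r" for x
    proof -
      obtain i where i: "\<bar>x $ i - y $ i\<bar> \<ge> r / 2" using x by (auto simp: cube_def not_less)
      have "\<theta>' (x $ j - y $ j) * (\<Prod>j\<in>UNIV - {j}. \<theta> (x $ j - y $ j)) = 0" for j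
      proof (cases "j = i")
        case True then show ?thesis using out i by simp
      next
        case False
        then have "(\<Prod>j\<in>UNIV - {j}. \<theta> (x $ j - y $ j)) = 0"
          using out(1)[OF i] by (intro prod_zero) auto
        then show ?thesis by simp
      qed
      then show ?thesis by (simp add: \<eta>'_def vec_eq_iff)
    qed
    show "norm (\<eta>' x) \<le> 16 * real CARD('n) / (r - s)" for x
    proof -
      have "norm (\<eta>' x) \<le> (\<Sum>i\<in>UNIV. \<bar>\<eta>' x $ i\<bar>)" by (rule norm_le_l1_cart)
      also have "\<dots> \<le> (\<Sum>i\<in>(UNIV::'n set). 16 / (r - s))"
      proof (rule sum_mono)
        fix i
        have "\<bar>\<Prod>j\<in>UNIV - {i}. \<theta> (x $ j - y $ j)\<bar> \<le> 1"
          using range by (subst abs_of_nonneg) (auto intro!: prod_nonneg prod_le_1)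
        then have "\<bar>\<theta>' (x $ i - y $ i)\<bar> * \<bar>\<Prod>j\<in>UNIV - {i}. \<theta> (x $ j - y $ j)\<bar> \<le> 16 / (r - s) * 1"
          using s by (intro mult_mono bd) auto
        then show "\<bar>\<eta>' x $ i\<bar> \<le> 16 / (r - s)" by (simp add: \<eta>'_def abs_mult)
      qed
      finally show ?thesis by (simp add: mult.commute)
    qed
  qed
qed

section \<open>De Giorgi's iteration\<close>

text \<open>The energy estimate on the superlevel sets of v, with constant K. It defines De Giorgi's class
  and is all that the iteration knows about v.\<close>

definition caccioppoli :: "(real^'n) set \<Rightarrow> real \<Rightarrow> (real^'n \<Rightarrow> real) \<Rightarrow> (real^'n \<Rightarrow> real^'n) \<Rightarrow> bool" where
  "caccioppoli S K v V \<longleftrightarrow> (\<forall>k \<eta> \<eta>' B. C1 \<eta> \<eta>' \<longrightarrow> (\<forall>x. x \<notin> S \<longrightarrow> \<eta> x = 0) \<longrightarrow>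
     (\<forall>x. 0 \<le> \<eta> x \<and> \<eta> x \<le> 1) \<longrightarrow> (\<forall>x. norm (\<eta>' x) \<le> B) \<longrightarrow>
     L2sq (leb S) (\<lambda>x. \<eta> x *\<^sub>R ((if v x > k then 1 else 0) *\<^sub>R V x))
       \<le> ennreal K * L2sq (leb S) (\<lambda>x. max 0 (v x - k) *\<^sub>R \<eta>' x))"

text \<open>The Faber-Krahn inequality for the truncation at level l, cut off between the cubes of sides s
  and r. Both terms in the gradient of the product are bounded by the truncation times the
  gradient of the cut-off function, the first one by the energy estimate.\<close>

lemma de_giorgi_step:
  fixes v :: "real^'n \<Rightarrow> real"
  assumes v: "sobolev S v V" and c: "caccioppoli S K v V" and K: "0 < K"
    and S: "convex S" "bounded S" and [measurable]: "S \<in> sets borel"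
    and r: "0 < s" "s < r" "cube y (3 * r) \<subseteq> S" and kl: "k \<le> l"
    and meas: "emeasure lborel {x \<in> cube y r. v x > l} \<le> ennreal (\<rho> ^ CARD('n) / 2)" and \<rho>: "0 < \<rho>" "\<rho> \<le> 2 * r"
  shows "L2sq (leb (cube y s)) (\<lambda>x. max 0 (v x - l))
    \<le> ennreal (256 * (real CARD('n))^3 * (K + 1) * (\<rho> / (r - s))\<^sup>2) * L2sq (leb (cube y r)) (\<lambda>x. max 0 (v x - k))"
proof -
  note [measurable] = sobolevD(1,2)[OF v]
  obtain \<eta> \<eta>' where \<eta>: "C1 \<eta> \<eta>'" "\<And>x. 0 \<le> \<eta> x" "\<And>x. \<eta> x \<le> 1" "\<And>x. x \<in> cube y s \<Longrightarrow> \<eta> x = 1"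
    "\<And>x. x \<notin> cube y r \<Longrightarrow> \<eta> x = 0" "\<And>x. x \<notin> cube y r \<Longrightarrow> \<eta>' x = 0"
    "\<And>x. norm (\<eta>' x) \<le> 16 * real CARD('n) / (r - s)"
    using cube_cutoff[of s r y] r by (metis less_imp_le)
  note [measurable] = C1_measurable[OF \<eta>(1)]
  define n where "n = real CARD('n)"
  define M where "M = 16 * n / (r - s)"
  have n1: "n \<ge> 1" unfolding n_def by (simp add: Suc_leI)
  have M: "norm (\<eta>' x) \<le> M" for x using \<eta>(7) by (simp add: M_def n_def)
  have M0: "0 \<le> M" using r n1 by (simp add: M_def)
  have rS: "cube y r \<subseteq> S" "cube y s \<subseteq> S" using r(3) cube_mono[of r "3*r" y] cube_mono[of s "3*r" y] r by auto
  let ?A = "{x \<in> cube y r. v x > l}"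
  let ?p = "\<lambda>x. max 0 (v x - l)" and ?P = "\<lambda>x. (if v x > l then 1 else 0) *\<^sub>R V x"
  define f where "f x = \<eta> x * ?p x" for x
  define F where "F x = \<eta> x *\<^sub>R ?P x + ?p x *\<^sub>R \<eta>' x" for x
  have sf: "sobolev S f F" unfolding f_def[abs_def] F_def[abs_def]
  proof (rule sobolev_mult[OF sobolev_pos_part[OF v S(2)] \<eta>(1), where B="max 1 M"])
    show "\<bar>\<eta> x\<bar> \<le> max 1 M" for x using \<eta>(2,3)[of x] by simp
    show "norm (\<eta>' x) \<le> max 1 M" for x using M[of x] by simp
  qed measurable
  have "L2sq (leb (cube y s)) ?p \<le> L2sq (leb S) f"
    using rS \<eta>(4) sobolevD(1)[OF sf] by (intro L2sq_leb_mono) (auto simp: f_def)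
  also have "\<dots> \<le> ennreal (n * \<rho>\<^sup>2 / 2) * L2sq (leb S) F"
    unfolding n_def
  proof (rule sobolev_faber_krahn[OF sf S(1) _ _ _ r(3) _ meas \<rho>])
    show "f x = 0" if "x \<in> S" "x \<notin> ?A" for x
      using that \<eta>(5)[of x] by (auto simp: f_def max_def)
  qed auto
  also have "L2sq (leb S) F \<le> ennreal (2 * (K + 1)) * L2sq (leb S) (\<lambda>x. ?p x *\<^sub>R \<eta>' x)"
  proof -
    have "L2sq (leb S) F \<le> 2 * L2sq (leb S) (\<lambda>x. \<eta> x *\<^sub>R ?P x) + 2 * L2sq (leb S) (\<lambda>x. ?p x *\<^sub>R \<eta>' x)"
      unfolding F_def[abs_def] by (rule L2sq_add_le) auto
    also have "\<dots> \<le> 2 * (ennreal K * L2sq (leb S) (\<lambda>x. ?p x *\<^sub>R \<eta>' x)) + 2 * L2sq (leb S) (\<lambda>x. ?p x *\<^sub>R \<eta>' x)"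
    proof (intro add_right_mono mult_left_mono)
      show "L2sq (leb S) (\<lambda>x. \<eta> x *\<^sub>R ?P x) \<le> ennreal K * L2sq (leb S) (\<lambda>x. ?p x *\<^sub>R \<eta>' x)"
        using c \<eta> rS M unfolding caccioppoli_def by blast
    qed auto
    also have "\<dots> = (2 * ennreal K + 2) * L2sq (leb S) (\<lambda>x. ?p x *\<^sub>R \<eta>' x)"
      by (simp add: distrib_right mult.assoc)
    also have "2 * ennreal K + 2 = ennreal (2 * (K + 1))"
    proof -
      have "ennreal (2 * (K + 1)) = ennreal (2 * K) + ennreal 2"
        using K by (subst ennreal_plus[symmetric]) (auto simp: algebra_simps)
      then show ?thesis using K by (simp add: ennreal_mult)
    qed
    finally show ?thesis .
  qed
  also have "L2sq (leb S) (\<lambda>x. ?p x *\<^sub>R \<eta>' x) \<le> ennreal (M\<^sup>2) * L2sq (leb (cube y r)) (\<lambda>x. max 0 (v x - k))"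
  proof -
    have "L2sq (leb S) (\<lambda>x. ?p x *\<^sub>R \<eta>' x) = L2sq (leb (cube y r)) (\<lambda>x. ?p x *\<^sub>R \<eta>' x)"
      using rS \<eta>(6) by (subst (1 2) L2sq_leb) (auto simp: indicator_def intro!: nn_integral_cong)
    also have "\<dots> \<le> ennreal (M\<^sup>2) * L2sq (leb (cube y r)) (\<lambda>x. max 0 (v x - k))"
    proof (rule L2sq_le_scale)
      have "?p x * norm (\<eta>' x) \<le> max 0 (v x - k) * M" for x
        using M kl by (intro mult_mono) auto
      then show "AE x in leb (cube y r). norm (?p x *\<^sub>R \<eta>' x) \<le> M * norm (max 0 (v x - k))"
        by (intro AE_I2) (simp add: mult.commute)
    qed auto
    finally show ?thesis .
  qed
  finally have "L2sq (leb (cube y s)) ?p \<le> ennreal (n * \<rho>\<^sup>2 / 2) * (ennreal (2 * (K + 1)) * (ennreal (M\<^sup>2) * L2sq (leb (cube y r)) (\<lambda>x. max 0 (v x - k))))"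
    by (simp add: mult_left_mono)
  also have "\<dots> = ennreal (n * \<rho>\<^sup>2 / 2 * (2 * (K + 1)) * M\<^sup>2) * L2sq (leb (cube y r)) (\<lambda>x. max 0 (v x - k))"
  proof -
    have "ennreal (n * \<rho>\<^sup>2 / 2 * (2 * (K + 1)) * M\<^sup>2) = ennreal (n * \<rho>\<^sup>2 / 2 * (2 * (K + 1))) * ennreal (M\<^sup>2)"
      using n1 K by (intro ennreal_mult) auto
    also have "ennreal (n * \<rho>\<^sup>2 / 2 * (2 * (K + 1))) = ennreal (n * \<rho>\<^sup>2 / 2) * ennreal (2 * (K + 1))"
      using n1 K by (intro ennreal_mult) auto
    finally show ?thesis by (simp only: mult.assoc)
  qed
  also have "n * \<rho>\<^sup>2 / 2 * (2 * (K + 1)) * M\<^sup>2 = 256 * n^3 * (K + 1) * (\<rho> / (r - s))\<^sup>2"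
  proof -
    define w where "w = r - s"
    show ?thesis unfolding M_def w_def[symmetric]
      by (simp add: power_divide power_mult_distrib power3_eq_cube power2_eq_square)
  qed
  finally show ?thesis by (simp add: n_def)
qed

lemma L2sq_chebyshev:
  fixes v :: "'a::euclidean_space \<Rightarrow> real"
  assumes [measurable]: "Q \<in> sets borel" "v \<in> borel_measurable borel" and t: "0 < t"
    and b: "L2sq (leb Q) (\<lambda>x. max 0 (v x - k)) \<le> ennreal b" "0 \<le> b"
  shows "emeasure lborel {x \<in> Q. v x > k + t} \<le> ennreal (b / t\<^sup>2)"
proof -
  let ?A = "{x \<in> Q. v x > k + t}"
  have [measurable]: "?A \<in> sets borel" by measurable
  have "ennreal (t\<^sup>2) * emeasure lborel ?A = (\<integral>\<^sup>+x. ennreal (t\<^sup>2) * indicator ?A x \<partial>lborel)"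
    by (simp add: nn_integral_cmult)
  also have "\<dots> \<le> (\<integral>\<^sup>+x. indicator Q x * ennreal ((norm (max 0 (v x - k)))\<^sup>2) \<partial>lborel)"
  proof (rule nn_integral_mono)
    fix x
    show "ennreal (t\<^sup>2) * indicator ?A x \<le> indicator Q x * ennreal ((norm (max 0 (v x - k)))\<^sup>2)"
    proof (cases "x \<in> ?A")
      case True
      then have "t\<^sup>2 \<le> (norm (max 0 (v x - k)))\<^sup>2" using t by (intro power_mono) auto
      then show ?thesis using True by (simp add: ennreal_leI)
    qed auto
  qed
  also have "\<dots> = L2sq (leb Q) (\<lambda>x. max 0 (v x - k))" by (rule L2sq_leb[symmetric]) measurable
  also note b(1)
  finally have "ennreal (1 / t\<^sup>2) * (ennreal (t\<^sup>2) * emeasure lborel ?A) \<le> ennreal (1 / t\<^sup>2) * ennreal b"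
    by (rule mult_left_mono) simp
  moreover have "ennreal (1 / t\<^sup>2) * ennreal (t\<^sup>2) = 1" using t by (subst ennreal_mult[symmetric]) auto
  moreover have "ennreal (1 / t\<^sup>2) * ennreal b = ennreal (b / t\<^sup>2)" using t b(2) by (subst ennreal_mult[symmetric]) auto
  ultimately show ?thesis by (simp add: mult.assoc[symmetric])
qed

text \<open>The conclusion of the iteration. The factor d^2 r^n makes it invariant under multiplication of v
  and under dilations of the space, and the cube of side 3r provides the room required in the
  Faber-Krahn inequality.\<close>

definition locally_bounded_above :: "(real^'n) set \<Rightarrow> real \<Rightarrow> real \<Rightarrow> bool" where
  "locally_bounded_above S K \<delta> \<longleftrightarrow> (\<forall>v V r d k y. sobolev S v V \<longrightarrow> caccioppoli S K v V \<longrightarrow>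
     0 < r \<longrightarrow> 0 < d \<longrightarrow> cube y (3 * r) \<subseteq> S \<longrightarrow>
     L2sq (leb (cube y r)) (\<lambda>x. max 0 (v x - k)) \<le> ennreal (\<delta> * d\<^sup>2 * r ^ CARD('n)) \<longrightarrow>
     (AE x in lborel. x \<in> cube y (r/2) \<longrightarrow> v x \<le> k + d))"

lemma locally_bounded_aboveD:
  fixes y :: "real^'n"
  assumes "locally_bounded_above S K \<delta>" "sobolev S v V" "caccioppoli S K v V" "0 < r" "0 < d" "cube y (3 * r) \<subseteq> S"
    "L2sq (leb (cube y r)) (\<lambda>x. max 0 (v x - k)) \<le> ennreal (\<delta> * d\<^sup>2 * r ^ CARD('n))"
  shows "AE x in lborel. x \<in> cube y (r/2) \<longrightarrow> v x \<le> k + d"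
  using assms unfolding locally_bounded_above_def by blast

text \<open>The levels increase to k + d and the cubes shrink from side r to side r/2. The squared norms Y j
  of the excess over the j-th level on the j-th cube decay geometrically: a bound on Y j bounds
  the measure of the next superlevel set by Chebyshev's inequality, and the smallness of this
  measure gains a factor in the Faber-Krahn inequality.\<close>

theorem de_giorgi:
  assumes K: "0 < (K::real)"
  obtains \<delta> :: real where "0 < \<delta>"
    "\<And>S :: (real^'n) set. convex S \<Longrightarrow> bounded S \<Longrightarrow> S \<in> sets borel \<Longrightarrow> locally_bounded_above S K \<delta>"
proof -
  let ?n = "CARD('n)"
  define n where "n = real ?n"
  have n1: "n \<ge> 1" unfolding n_def by (simp add: Suc_leI)
  \<comment> \<open>The decay rate q is chosen such that 4^j q^j = 2^(-n j). Then the superlevel sets admit the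
    radii \<rho> = r \<sigma> 2^(-j) in the Faber-Krahn inequality, and their decay cancels the factor 2^j in
    the gradients of the cut-off functions. The size of \<sigma> makes the remaining factor equal to q.\<close>
  define q where "q = (1/2::real) ^ (?n + 2)"
  have q: "0 < q" "q < 1"
    using power_decreasing[of 1 "?n + 2" "1/2::real"] unfolding q_def by simp_all
  define D where "D = 256 * n^3 * (K + 1) * 16"
  have D: "D \<ge> 1"
  proof -
    have "1 \<le> n^3" using n1 by simp
    then have "1 * 1 \<le> n^3 * (K + 1)" using K n1 by (intro mult_mono) auto
    then show ?thesis by (simp add: D_def)
  qed
  define \<sigma> where "\<sigma> = sqrt (q / D)"
  have \<sigma>2: "D * \<sigma>\<^sup>2 = q" using q D by (simp add: \<sigma>_def)
  have \<sigma>: "0 < \<sigma>" "\<sigma> \<le> 1" using q D by (auto simp: \<sigma>_def)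
  define \<delta> where "\<delta> = \<sigma> ^ ?n / 8"
  have \<delta>: "0 < \<delta>" using \<sigma> by (simp add: \<delta>_def)
  show ?thesis
  proof (rule that[OF \<delta>])
    fix S :: "(real^'n) set"
    assume S: "convex S" "bounded S" and Sm[measurable]: "S \<in> sets borel"
    show "locally_bounded_above S K \<delta>"
      unfolding locally_bounded_above_def
    proof (intro allI impI)
      fix v V r d k and y :: "real^'n"
      assume v: "sobolev S v V" and c: "caccioppoli S K v V"
        and r: "0 < r" and d: "0 < d" and cS: "cube y (3 * r) \<subseteq> S"
        and start: "L2sq (leb (cube y r)) (\<lambda>x. max 0 (v x - k)) \<le> ennreal (\<delta> * d\<^sup>2 * r ^ ?n)"
      note [measurable] = sobolevD(1,2)[OF v]
      define rj where "rj j = r * (1/2 + (1/2)^(j+1))" for j :: nat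
      define kj where "kj j = k + d * (1 - (1/2)^j)" for j :: nat
      define Y where "Y j = L2sq (leb (cube y (rj j))) (\<lambda>x. max 0 (v x - kj j))" for j :: nat
      have rj: "0 < rj j" "rj j \<le> r" "r/2 \<le> rj j" "rj j - rj (Suc j) = r * (1/2)^(j+2)" for j
      proof -
        have "(1/2::real)^(j+1) \<le> 1/2" using power_decreasing[of 1 "j+1" "1/2::real"] by simp
        then have "r * (1/2 + (1/2)^(j+1)) \<le> r * 1" using r by (intro mult_left_mono) auto
        then show "rj j \<le> r" by (simp add: rj_def)
        have "r * (1/2) \<le> r * (1/2 + (1/2)^(j+1))" using r by (intro mult_left_mono) auto
        then show "r/2 \<le> rj j" by (simp add: rj_def)
        then show "0 < rj j" using r by linarith
        show "rj j - rj (Suc j) = r * (1/2)^(j+2)" by (simp add: rj_def algebra_simps)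
      qed
      have Y: "Y j \<le> ennreal (\<delta> * d\<^sup>2 * r ^ ?n * q ^ j)" for j
      proof (induction j)
        case 0
        then show ?case using start by (simp add: Y_def rj_def kj_def)
      next
        case (Suc j)
        define \<rho> where "\<rho> = r * \<sigma> * (1/2)^j"
        have \<rho>0: "0 < \<rho>" using r \<sigma> by (simp add: \<rho>_def)
        have "\<sigma> * (1/2)^j \<le> 1 * 1" using \<sigma> by (intro mult_mono) (auto simp: power_le_one)
        then have "r * (\<sigma> * (1/2)^j) \<le> r * 1" using r by (intro mult_left_mono) auto
        then have \<rho>1: "\<rho> \<le> 2 * rj j" using rj(3)[of j] by (simp add: \<rho>_def mult.assoc)
        have lt: "rj (Suc j) < rj j" 
        proof -
          have "0 < rj j - rj (Suc j)" unfolding rj(4) using r by simp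
          then show ?thesis by simp
        qed
        have kk: "kj (Suc j) = kj j + d * (1/2)^(j+1)" by (simp add: kj_def algebra_simps)
        have kle: "kj j \<le> kj (Suc j)" using d unfolding kk by simp
        have dj: "0 < d * (1/2)^(j+1)" using d by simp
        have cS': "cube y (3 * rj j) \<subseteq> S" using cS cube_mono[of "3 * rj j" "3 * r" y] rj(2)[of j] by auto
        have "emeasure lborel {x \<in> cube y (rj j). v x > kj j + d * (1/2)^(j+1)}
            \<le> ennreal (\<delta> * d\<^sup>2 * r ^ ?n * q ^ j / (d * (1/2)^(j+1))\<^sup>2)"
          using Suc dj \<delta> r q unfolding Y_def by (intro L2sq_chebyshev) auto
        also have "\<delta> * d\<^sup>2 * r ^ ?n * q ^ j / (d * (1/2)^(j+1))\<^sup>2 = \<rho> ^ ?n / 2"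
        proof -
          define a b where "a = ((1/2::real)^j)^?n" and "b = ((1/2::real)^j)\<^sup>2"
          have e1: "(d * (1/2)^(j+1))\<^sup>2 = d\<^sup>2 * (1/4) * b" by (simp add: b_def power_mult_distrib power_divide)
          have e2: "q ^ j = a * b"
            unfolding q_def a_def b_def power_mult[symmetric] power_add[symmetric]
            by (rule arg_cong[where f="\<lambda>m. (1/2::real) ^ m"]) (simp add: algebra_simps)
          have e3: "\<rho> ^ ?n = r ^ ?n * \<sigma> ^ ?n * a" by (simp add: \<rho>_def a_def power_mult_distrib)
          have "b \<noteq> 0" by (simp add: b_def)
          then show ?thesis unfolding e1 e2 e3 \<delta>_def using d by (simp add: field_simps)
        qed
        finally have meas: "emeasure lborel {x \<in> cube y (rj j). v x > kj (Suc j)} \<le> ennreal (\<rho> ^ ?n / 2)"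
          by (simp only: kk)
        have "Y (Suc j) \<le> ennreal (256 * (real ?n)^3 * (K + 1) * (\<rho> / (rj j - rj (Suc j)))\<^sup>2) * Y j"
          unfolding Y_def by (rule de_giorgi_step[OF v c K S Sm rj(1) lt cS' kle meas \<rho>0 \<rho>1])
        also have "256 * (real ?n)^3 * (K + 1) * (\<rho> / (rj j - rj (Suc j)))\<^sup>2 = q"
        proof -
          have "\<rho> / (rj j - rj (Suc j)) = 4 * \<sigma>" using r by (simp add: rj(4) \<rho>_def field_simps)
          then show ?thesis using \<sigma>2 by (simp add: D_def n_def power_mult_distrib mult_ac)
        qed
        also have "ennreal q * Y j \<le> ennreal q * ennreal (\<delta> * d\<^sup>2 * r ^ ?n * q ^ j)"
          by (intro mult_left_mono Suc) simp
        also have "\<dots> = ennreal (\<delta> * d\<^sup>2 * r ^ ?n * q ^ Suc j)"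
          using q \<delta> r by (subst ennreal_mult[symmetric]) (auto simp: mult_ac)
        finally show ?case .
      qed
      let ?w = "\<lambda>x. max 0 (v x - (k + d))"
      have le: "L2sq (leb (cube y (r/2))) ?w \<le> ennreal (\<delta> * d\<^sup>2 * r ^ ?n * q ^ j)" for j
      proof -
        have "L2sq (leb (cube y (r/2))) ?w \<le> Y j" unfolding Y_def
        proof (rule L2sq_leb_mono)
          have "kj j \<le> k + d" using d by (simp add: kj_def algebra_simps)
          then show "norm (?w x) \<le> norm (max 0 (v x - kj j))" for x by auto
          show "cube y (r/2) \<subseteq> cube y (rj j)" by (rule cube_mono) (rule rj(3))
        qed auto
        then show ?thesis using Y[of j] by (rule order_trans)
      qed
      have "(\<lambda>j. \<delta> * d\<^sup>2 * r ^ ?n * q ^ j) \<longlonglongrightarrow> \<delta> * d\<^sup>2 * r ^ ?n * 0"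
        using q by (intro tendsto_mult tendsto_const LIMSEQ_power_zero) auto
      from tendsto_ennrealI[OF this] have "(\<lambda>j. ennreal (\<delta> * d\<^sup>2 * r ^ ?n * q ^ j)) \<longlonglongrightarrow> 0" by simp
      then have "L2sq (leb (cube y (r/2))) ?w \<le> 0"
        by (rule LIMSEQ_le_const) (intro exI[of _ "0::nat"] allI impI le)
      then have "L2sq (leb (cube y (r/2))) ?w = 0" by simp
      then have "AE x in leb (cube y (r/2)). ennreal ((norm (?w x))\<^sup>2) = 0"
        unfolding L2sq_def by (subst (asm) nn_integral_0_iff_AE) auto
      then have "AE x in lborel. x \<in> cube y (r/2) \<longrightarrow> ennreal ((norm (?w x))\<^sup>2) = 0"
        by (simp add: AE_leb)
      then show "AE x in lborel. x \<in> cube y (r/2) \<longrightarrow> v x \<le> k + d"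
        by eventually_elim (auto simp: ennreal_eq_0_iff max_def split: if_splits)
    qed
  qed
qed

section \<open>Energy estimates for solutions\<close>

lemma integrable_of_L2sq:
  fixes A G :: "'a \<Rightarrow> 'b::euclidean_space"
  assumes [measurable]: "A \<in> borel_measurable M" "G \<in> borel_measurable M"
    and fin: "L2sq M A < \<infinity>" "L2sq M G < \<infinity>"
  shows "integrable M (\<lambda>x. A x \<bullet> G x)"
proof -
  have sq: "integrable M (\<lambda>x. (norm (H x))\<^sup>2)" if "H \<in> borel_measurable M" "L2sq M H < \<infinity>" for H :: "'a \<Rightarrow> 'b"
    using that unfolding L2sq_def by (intro integrableI_nonneg) auto
  show ?thesis
  proof (rule Bochner_Integration.integrable_bound[OF Bochner_Integration.integrable_add[OF sq[OF assms(1) fin(1)] sq[OF assms(2) fin(2)]]])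
    show "AE x in M. norm (A x \<bullet> G x) \<le> norm ((norm (A x))\<^sup>2 + (norm (G x))\<^sup>2)"
    proof (rule AE_I2)
      fix x
      have "\<bar>A x \<bullet> G x\<bar> \<le> norm (A x) * norm (G x)" by (rule Cauchy_Schwarz_ineq2)
      also have "\<dots> \<le> (norm (A x))\<^sup>2 + (norm (G x))\<^sup>2"
      proof -
        have "0 \<le> norm (A x) * norm (G x)" by simp
        moreover have "2 * (norm (A x) * norm (G x)) \<le> (norm (A x))\<^sup>2 + (norm (G x))\<^sup>2"
          using sum_squares_bound[of "norm (A x)" "norm (G x)"] by (simp add: mult.assoc)
        ultimately show ?thesis by linarith
      qed
      finally show "norm (A x \<bullet> G x) \<le> norm ((norm (A x))\<^sup>2 + (norm (G x))\<^sup>2)" by simp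
    qed
  qed measurable
qed

lemma L2sq_inner_le:
  fixes A G :: "'a \<Rightarrow> 'b::euclidean_space"
  assumes [measurable]: "A \<in> borel_measurable M" "G \<in> borel_measurable M"
    and fin: "L2sq M A < \<infinity>" "L2sq M G < \<infinity>"
  shows "ennreal ((\<integral>x. A x \<bullet> G x \<partial>M)\<^sup>2) \<le> L2sq M A * L2sq M G"
proof -
  have "ennreal ((\<integral>x. A x \<bullet> G x \<partial>M)\<^sup>2) = (ennreal (norm (\<integral>x. A x \<bullet> G x \<partial>M)))\<^sup>2"
    by (simp add: ennreal_power)
  also have "\<dots> \<le> (\<integral>\<^sup>+x. ennreal (norm (A x \<bullet> G x)) \<partial>M)\<^sup>2"
    by (intro power_mono integral_norm_bound_ennreal integrable_of_L2sq assms) simp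
  also have "\<dots> \<le> (\<integral>\<^sup>+x. ennreal (norm (A x)) * ennreal (norm (G x)) \<partial>M)\<^sup>2"
    by (intro power_mono nn_integral_mono) (simp_all add: Cauchy_Schwarz_ineq2 flip: ennreal_mult)
  also have "\<dots> \<le> (\<integral>\<^sup>+x. (ennreal (norm (A x)))\<^sup>2 \<partial>M) * (\<integral>\<^sup>+x. (ennreal (norm (G x)))\<^sup>2 \<partial>M)"
    by (rule Cauchy_Schwarz_nn_integral) measurable
  finally show ?thesis by (simp add: L2sq_def ennreal_power)
qed

text \<open>The equation enters only through the flux A, whose component j is the sum of a(i,j) U(i) over i:
  it is comparable with the gradient U of u and free of divergence against C1 functions that
  vanish outside S.\<close>

locale elliptic_solution =
  fixes S :: "(real^'n) set" and lam L :: real and u :: "real^'n \<Rightarrow> real" and U A :: "real^'n \<Rightarrow> real^'n"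
  assumes S: "convex S" "bounded S" and S_borel[measurable]: "S \<in> sets borel"
    and lam: "0 < lam" and L: "0 < L"
    and u: "sobolev S u U" and u_nonneg: "\<And>x. 0 \<le> u x"
    and A_borel[measurable]: "A \<in> borel_measurable borel" and A_L2: "L2sq (leb S) A < \<infinity>"
    and elliptic: "AE x in leb S. lam * (norm (U x))\<^sup>2 \<le> A x \<bullet> U x"
    and flux_bound: "AE x in leb S. norm (A x) \<le> L * norm (U x)"
    and test: "\<And>z z'. C1 z z' \<Longrightarrow> (\<And>x. x \<notin> S \<Longrightarrow> z x = 0) \<Longrightarrow> (\<integral>x. A x \<bullet> z' x \<partial>leb S) = 0"
begin

lemma u_borel[measurable]: "u \<in> borel_measurable borel" "U \<in> borel_measurable borel"
  using sobolevD[OF u] by auto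

text \<open>The products of the cut-off function with C1 approximations of w are admissible in the equation,
  and their gradients converge in L2.\<close>

lemma test_product:
  assumes w: "sobolev S w W" and z: "C1 z z'" "\<And>x. \<bar>z x\<bar> \<le> B" "\<And>x. norm (z' x) \<le> B" "\<And>x. x \<notin> S \<Longrightarrow> z x = 0"
  shows "integrable (leb S) (\<lambda>x. A x \<bullet> (z x *\<^sub>R W x + w x *\<^sub>R z' x))"
    "(\<integral>x. A x \<bullet> (z x *\<^sub>R W x + w x *\<^sub>R z' x) \<partial>leb S) = 0"
proof -
  obtain f f' where f: "\<And>m::nat. C1 (f m) (f' m)"
    "(\<lambda>m. L2sq (leb S) (\<lambda>x. f m x - w x)) \<longlonglongrightarrow> 0"
    "(\<lambda>m. L2sq (leb S) (\<lambda>x. f' m x - W x)) \<longlonglongrightarrow> 0"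
    "AE x in leb S. (\<lambda>m. f m x) \<longlonglongrightarrow> w x" using sobolev_seq[OF w] by blast
  note [measurable] = C1_measurable[OF f(1)] sobolevD(1,2)[OF w] C1_measurable[OF z(1)]
  let ?G = "\<lambda>x. z x *\<^sub>R W x + w x *\<^sub>R z' x" and ?Gm = "\<lambda>m x. z x *\<^sub>R f' m x + f m x *\<^sub>R z' x"
  have lim: "(\<lambda>m. L2sq (leb S) (\<lambda>x. ?Gm m x - ?G x)) \<longlonglongrightarrow> 0"
    by (rule L2sq_product_rule_lim[OF z(2,3) _ _ _ _ _ _ f(2,3)]) auto
  have fin: "L2sq (leb S) ?G < \<infinity>" using sobolevD(4)[OF sobolev_mult[OF w z(1-3)]] .
  show int: "integrable (leb S) (\<lambda>x. A x \<bullet> ?G x)"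
    by (rule integrable_of_L2sq[OF _ _ A_L2 fin]) auto
  have "\<forall>\<^sub>F m in sequentially. ennreal ((\<integral>x. A x \<bullet> ?G x \<partial>leb S)\<^sup>2) \<le> L2sq (leb S) A * L2sq (leb S) (\<lambda>x. ?Gm m x - ?G x)"
    using order_tendstoD(2)[OF lim zero_less_one]
  proof eventually_elim
    case (elim m)
    have fin': "L2sq (leb S) (\<lambda>x. ?Gm m x - ?G x) < \<infinity>" by (rule less_trans[OF elim]) simp
    have int': "integrable (leb S) (\<lambda>x. A x \<bullet> (?Gm m x - ?G x))"
      by (rule integrable_of_L2sq[OF _ _ A_L2 fin']) auto
    have "(\<integral>x. A x \<bullet> ?Gm m x \<partial>leb S) = 0"
      using test[OF C1_mult[OF z(1) f(1)[of m]]] z(4) by simp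
    moreover have "(\<integral>x. A x \<bullet> ?Gm m x \<partial>leb S) = (\<integral>x. A x \<bullet> (?Gm m x - ?G x) + A x \<bullet> ?G x \<partial>leb S)"
      by (simp add: inner_diff_right)
    moreover have "\<dots> = (\<integral>x. A x \<bullet> (?Gm m x - ?G x) \<partial>leb S) + (\<integral>x. A x \<bullet> ?G x \<partial>leb S)"
      by (rule Bochner_Integration.integral_add[OF int' int])
    ultimately have "(\<integral>x. A x \<bullet> ?G x \<partial>leb S) = - (\<integral>x. A x \<bullet> (?Gm m x - ?G x) \<partial>leb S)" by linarith
    then have "(\<integral>x. A x \<bullet> ?G x \<partial>leb S)\<^sup>2 = (\<integral>x. A x \<bullet> (?Gm m x - ?G x) \<partial>leb S)\<^sup>2" by simp
    then show ?case using L2sq_inner_le[OF _ _ A_L2 fin'] by simp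
  qed
  moreover have "(\<lambda>m. L2sq (leb S) A * L2sq (leb S) (\<lambda>x. ?Gm m x - ?G x)) \<longlonglongrightarrow> 0"
    using L2_lim_sum_zero[OF lim lim A_L2, of 0] by simp
  ultimately have "ennreal ((\<integral>x. A x \<bullet> ?G x \<partial>leb S)\<^sup>2) \<le> 0"
    using tendsto_lowerbound[of _ 0 sequentially] by force
  then show "(\<integral>x. A x \<bullet> ?G x \<partial>leb S) = 0" by (simp add: ennreal_eq_0_iff)
qed

definition energy_const :: real where "energy_const = 4 * L\<^sup>2 / lam\<^sup>2"

lemma energy_const_pos: "0 < energy_const"
  using lam L by (simp add: energy_const_def)

text \<open>The test function is \<eta>^2 F(u). Its gradient contains \<eta>^2 F'(u) U, which ellipticity
  turns into the left hand side, and 2 \<eta> F(u) \<eta>'. The hypothesis F^2 \<le> P F' is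
  what permits half of the left hand side to absorb this mixed term.\<close>

lemma energy:
  assumes F: "C1r F F'" "\<And>s. \<bar>F' s\<bar> \<le> B" "\<And>s. 0 \<le> s \<Longrightarrow> 0 \<le> F' s"
    and P: "\<And>s. 0 \<le> P s" "\<And>s. 0 \<le> s \<Longrightarrow> (F s)\<^sup>2 \<le> P s * F' s" and [measurable]: "P \<in> borel_measurable borel"
    and \<eta>: "C1 \<eta> \<eta>'" "\<And>x. x \<notin> S \<Longrightarrow> \<eta> x = 0" "\<And>x. 0 \<le> \<eta> x \<and> \<eta> x \<le> 1" "\<And>x. norm (\<eta>' x) \<le> B'"
  shows "(\<integral>\<^sup>+x. ennreal ((\<eta> x)\<^sup>2 * F' (u x) * (norm (U x))\<^sup>2) \<partial>leb S)
    \<le> ennreal energy_const * (\<integral>\<^sup>+x. ennreal (P (u x) * (norm (\<eta>' x))\<^sup>2) \<partial>leb S)"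
proof -
  note [measurable] = C1r_measurable[OF F(1)] C1_measurable[OF \<eta>(1)]
  define E where "E x = (\<eta> x)\<^sup>2 * F' (u x) * (norm (U x))\<^sup>2" for x
  define R where "R x = 2 * L\<^sup>2 / lam * (P (u x) * (norm (\<eta>' x))\<^sup>2)" for x
  define G where "G x = (\<eta> x * \<eta> x) *\<^sub>R (F' (u x) *\<^sub>R U x) + F (u x) *\<^sub>R (\<eta> x *\<^sub>R \<eta>' x + \<eta> x *\<^sub>R \<eta>' x)" for x
  have [measurable]: "E \<in> borel_measurable borel" "R \<in> borel_measurable borel" "G \<in> borel_measurable borel"
    unfolding E_def[abs_def] R_def[abs_def] G_def[abs_def] by measurable
  have E0: "0 \<le> E x" for x using F(3)[OF u_nonneg] by (simp add: E_def)
  have R0: "0 \<le> R x" for x using P(1) lam by (simp add: R_def)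
  have B'0: "0 \<le> B'" using \<eta>(4) norm_ge_zero order_trans by blast
  have GI: "integrable (leb S) (\<lambda>x. A x \<bullet> G x)" "(\<integral>x. A x \<bullet> G x \<partial>leb S) = 0"
  proof -
    have 1: "\<bar>\<eta> x * \<eta> x\<bar> \<le> max 1 (2 * B')" for x
    proof -
      have "\<eta> x * \<eta> x \<le> 1 * 1" using \<eta>(3)[of x] by (intro mult_mono) auto
      then show ?thesis by simp
    qed
    have 2: "norm (\<eta> x *\<^sub>R \<eta>' x + \<eta> x *\<^sub>R \<eta>' x) \<le> max 1 (2 * B')" for x
    proof -
      have "norm (\<eta> x *\<^sub>R \<eta>' x) \<le> 1 * B'" unfolding norm_scaleR using \<eta>(3,4)[of x] by (intro mult_mono) auto
      then show ?thesis using norm_triangle_ineq[of "\<eta> x *\<^sub>R \<eta>' x" "\<eta> x *\<^sub>R \<eta>' x"] by linarith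
    qed
    have 3: "x \<notin> S \<Longrightarrow> \<eta> x * \<eta> x = 0" for x using \<eta>(2) by simp
    note * = test_product[OF sobolev_chain[OF u F(1,2) S(2) S_borel] C1_mult[OF \<eta>(1) \<eta>(1)] 1 2 3]
    show "integrable (leb S) (\<lambda>x. A x \<bullet> G x)" "(\<integral>x. A x \<bullet> G x \<partial>leb S) = 0"
      using * by (simp_all add: G_def)
  qed
  have pw: "AE x in leb S. lam / 2 * E x \<le> A x \<bullet> G x + R x"
    using elliptic flux_bound
  proof eventually_elim
    case (elim x)
    have AG: "A x \<bullet> G x = (\<eta> x)\<^sup>2 * F' (u x) * (A x \<bullet> U x) + 2 * \<eta> x * F (u x) * (A x \<bullet> \<eta>' x)"
      unfolding G_def inner_add_right inner_scaleR_right power2_eq_square by (simp add: algebra_simps)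
    have 1: "lam * E x \<le> (\<eta> x)\<^sup>2 * F' (u x) * (A x \<bullet> U x)"
      using mult_left_mono[OF elim(1), of "(\<eta> x)\<^sup>2 * F' (u x)"] F(3)[OF u_nonneg[of x]]
      by (simp add: E_def mult_ac)
    have "(2 * \<eta> x * F (u x) * (A x \<bullet> \<eta>' x))\<^sup>2 \<le> 4 * (lam / 2 * E x) * R x"
    proof -
      have "\<bar>A x \<bullet> \<eta>' x\<bar> \<le> norm (A x) * norm (\<eta>' x)" by (rule Cauchy_Schwarz_ineq2)
      also have "\<dots> \<le> (L * norm (U x)) * norm (\<eta>' x)" by (intro mult_right_mono elim) simp
      finally have "\<bar>A x \<bullet> \<eta>' x\<bar>\<^sup>2 \<le> ((L * norm (U x)) * norm (\<eta>' x))\<^sup>2" by (rule power_mono) simp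
      then have "(F (u x))\<^sup>2 * (A x \<bullet> \<eta>' x)\<^sup>2 \<le> (P (u x) * F' (u x)) * ((L * norm (U x)) * norm (\<eta>' x))\<^sup>2"
        using P F(3)[OF u_nonneg[of x]] u_nonneg[of x] by (intro mult_mono) auto
      then have e1: "4 * (\<eta> x)\<^sup>2 * ((F (u x))\<^sup>2 * (A x \<bullet> \<eta>' x)\<^sup>2) \<le> 4 * (\<eta> x)\<^sup>2 * ((P (u x) * F' (u x)) * ((L * norm (U x)) * norm (\<eta>' x))\<^sup>2)"
        by (rule mult_left_mono) simp
      have e2: "(2 * \<eta> x * F (u x) * (A x \<bullet> \<eta>' x))\<^sup>2 = 4 * (\<eta> x)\<^sup>2 * ((F (u x))\<^sup>2 * (A x \<bullet> \<eta>' x)\<^sup>2)"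
        by (simp add: power_mult_distrib)
      have e3: "4 * (lam / 2 * E x) * R x = 4 * (\<eta> x)\<^sup>2 * ((P (u x) * F' (u x)) * ((L * norm (U x)) * norm (\<eta>' x))\<^sup>2)"
        using lam by (simp add: E_def R_def power_mult_distrib)
      show ?thesis unfolding e2 e3 by (rule e1)
    qed
    also have "\<dots> \<le> (lam / 2 * E x + R x)\<^sup>2"
      using sum_squares_bound[of "lam / 2 * E x" "R x"] by (simp add: power2_sum)
    finally have "\<bar>2 * \<eta> x * F (u x) * (A x \<bullet> \<eta>' x)\<bar> \<le> \<bar>lam / 2 * E x + R x\<bar>"
      by (simp only: abs_le_square_iff)
    moreover have "0 \<le> lam / 2 * E x + R x" using E0[of x] R0[of x] lam by simp
    ultimately have "\<bar>2 * \<eta> x * F (u x) * (A x \<bullet> \<eta>' x)\<bar> \<le> lam / 2 * E x + R x" by simp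
    then show ?case using 1 unfolding AG by linarith
  qed
  have RR: "(\<integral>\<^sup>+x. ennreal (R x) \<partial>leb S) = ennreal (2 * L\<^sup>2 / lam) * (\<integral>\<^sup>+x. ennreal (P (u x) * (norm (\<eta>' x))\<^sup>2) \<partial>leb S)"
  proof -
    have "ennreal (R x) = ennreal (2 * L\<^sup>2 / lam) * ennreal (P (u x) * (norm (\<eta>' x))\<^sup>2)" for x
      unfolding R_def using lam P(1) by (intro ennreal_mult) auto
    then show ?thesis by (simp only:) (rule nn_integral_cmult, measurable)
  qed
  have "ennreal (lam / 2) * (\<integral>\<^sup>+x. ennreal (E x) \<partial>leb S) \<le> (\<integral>\<^sup>+x. ennreal (R x) \<partial>leb S)"
  proof (cases "(\<integral>\<^sup>+x. ennreal (R x) \<partial>leb S) < \<infinity>")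
    case True
    then have RI: "integrable (leb S) R" by (intro integrableI_nonneg) (auto simp: R0)
    have EI: "integrable (leb S) (\<lambda>x. lam / 2 * E x)"
    proof (rule Bochner_Integration.integrable_bound[OF Bochner_Integration.integrable_add[OF GI(1) RI]])
      show "AE x in leb S. norm (lam / 2 * E x) \<le> norm (A x \<bullet> G x + R x)"
        using pw
      proof eventually_elim
        case (elim x)
        have "norm (lam / 2 * E x) = lam / 2 * E x" using E0[of x] lam by simp
        also have "\<dots> \<le> norm (A x \<bullet> G x + R x)" unfolding real_norm_def using elim by linarith
        finally show ?case .
      qed
    qed measurable
    have "(\<integral>x. lam / 2 * E x \<partial>leb S) \<le> (\<integral>x. A x \<bullet> G x + R x \<partial>leb S)"
      by (rule integral_mono_AE[OF EI Bochner_Integration.integrable_add[OF GI(1) RI] pw])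
    also have "\<dots> = (\<integral>x. R x \<partial>leb S)"
      by (subst Bochner_Integration.integral_add[OF GI(1) RI]) (simp add: GI)
    finally have "ennreal (\<integral>x. lam / 2 * E x \<partial>leb S) \<le> ennreal (\<integral>x. R x \<partial>leb S)" by (rule ennreal_leI)
    then have "(\<integral>\<^sup>+x. ennreal (lam / 2 * E x) \<partial>leb S) \<le> (\<integral>\<^sup>+x. ennreal (R x) \<partial>leb S)"
    proof -
      have "(\<integral>\<^sup>+x. ennreal (lam / 2 * E x) \<partial>leb S) = ennreal (\<integral>x. lam / 2 * E x \<partial>leb S)"
        by (rule nn_integral_eq_integral[OF EI]) (use E0 lam in simp)
      moreover have "(\<integral>\<^sup>+x. ennreal (R x) \<partial>leb S) = ennreal (\<integral>x. R x \<partial>leb S)"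
        by (rule nn_integral_eq_integral[OF RI]) (use R0 in simp)
      ultimately show ?thesis
        using \<open>ennreal (\<integral>x. lam / 2 * E x \<partial>leb S) \<le> ennreal (\<integral>x. R x \<partial>leb S)\<close> by (simp only:)
    qed
    moreover have "(\<integral>\<^sup>+x. ennreal (lam / 2 * E x) \<partial>leb S) = ennreal (lam / 2) * (\<integral>\<^sup>+x. ennreal (E x) \<partial>leb S)"
    proof -
      have "ennreal (lam / 2 * E x) = ennreal (lam / 2) * ennreal (E x)" for x
        using lam E0 by (intro ennreal_mult) auto
      then show ?thesis by (simp only:) (rule nn_integral_cmult, measurable)
    qed
    ultimately show ?thesis by (simp only:)
  qed (auto simp: not_less top_unique)
  then have "ennreal (2 / lam) * (ennreal (lam / 2) * (\<integral>\<^sup>+x. ennreal (E x) \<partial>leb S)) \<le> ennreal (2 / lam) * (\<integral>\<^sup>+x. ennreal (R x) \<partial>leb S)"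
    by (rule mult_left_mono) simp
  moreover have "ennreal (2 / lam) * ennreal (lam / 2) = 1" using lam by (subst ennreal_mult[symmetric]) auto
  moreover have "ennreal (2 / lam) * ennreal (2 * L\<^sup>2 / lam) = ennreal energy_const"
    using lam by (subst ennreal_mult[symmetric]) (auto simp: energy_const_def power2_eq_square)
  ultimately show ?thesis unfolding RR E_def by (simp add: mult.assoc[symmetric])
qed

end

text \<open>It suffices to establish the energy estimate with the indicator of the superlevel set replaced
  by the derivatives of the regularised positive parts: these converge pointwise, and Fatou's
  lemma applies.\<close>

lemma caccioppoliI:
  assumes [measurable]: "v \<in> borel_measurable borel" "V \<in> borel_measurable borel"
    and *: "\<And>k \<eta> \<eta>' B d. 0 < d \<Longrightarrow> C1 \<eta> \<eta>' \<Longrightarrow> (\<And>x. x \<notin> S \<Longrightarrow> \<eta> x = 0) \<Longrightarrow> (\<And>x. 0 \<le> \<eta> x \<and> \<eta> x \<le> 1) \<Longrightarrow>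
      (\<And>x. norm (\<eta>' x) \<le> B) \<Longrightarrow>
      (\<integral>\<^sup>+x. ennreal ((\<eta> x)\<^sup>2 * spos' d (v x - k) * (norm (V x))\<^sup>2) \<partial>leb S)
        \<le> ennreal K * (\<integral>\<^sup>+x. ennreal ((max 0 (v x - k))\<^sup>2 * (norm (\<eta>' x))\<^sup>2) \<partial>leb S)"
  shows "caccioppoli S K v V"
  unfolding caccioppoli_def
proof (intro allI impI)
  fix k \<eta> \<eta>' B
  assume \<eta>: "C1 \<eta> \<eta>'" "\<forall>x. x \<notin> S \<longrightarrow> \<eta> x = 0" "\<forall>x. 0 \<le> \<eta> x \<and> \<eta> x \<le> 1" "\<forall>x. norm (\<eta>' x) \<le> B"
  note [measurable] = C1_measurable[OF \<eta>(1)]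
  let ?d = "\<lambda>m::nat. 1 / real (Suc m)"
  have d: "?d m > 0" for m by simp
  note [measurable] = C1r_measurable[OF C1r_spos[OF d]]
  let ?f = "\<lambda>m x. ennreal ((\<eta> x)\<^sup>2 * spos' (?d m) (v x - k) * (norm (V x))\<^sup>2)"
  let ?R = "ennreal K * L2sq (leb S) (\<lambda>x. max 0 (v x - k) *\<^sub>R \<eta>' x)"
  have R: "?R = ennreal K * (\<integral>\<^sup>+x. ennreal ((max 0 (v x - k))\<^sup>2 * (norm (\<eta>' x))\<^sup>2) \<partial>leb S)"
    by (simp add: L2sq_def power_mult_distrib)
  have "L2sq (leb S) (\<lambda>x. \<eta> x *\<^sub>R ((if v x > k then 1 else 0) *\<^sub>R V x)) = (\<integral>\<^sup>+x. liminf (\<lambda>m. ?f m x) \<partial>leb S)"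
    unfolding L2sq_def
  proof (rule nn_integral_cong)
    fix x
    have "(\<lambda>m. (\<eta> x)\<^sup>2 * spos' (?d m) (v x - k) * (norm (V x))\<^sup>2) \<longlonglongrightarrow> (\<eta> x)\<^sup>2 * (if v x - k > 0 then 1 else 0) * (norm (V x))\<^sup>2"
      by (intro tendsto_intros spos'_tendsto)
    from tendsto_ennrealI[OF this]
    have "liminf (\<lambda>m. ?f m x) = ennreal ((\<eta> x)\<^sup>2 * (if v x - k > 0 then 1 else 0) * (norm (V x))\<^sup>2)"
      by (rule lim_imp_Liminf[rotated]) simp
    then show "ennreal ((norm (\<eta> x *\<^sub>R ((if v x > k then 1 else 0) *\<^sub>R V x)))\<^sup>2) = liminf (\<lambda>m. ?f m x)"
      by (simp add: power_mult_distrib)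
  qed
  also have "\<dots> \<le> liminf (\<lambda>m. \<integral>\<^sup>+x. ?f m x \<partial>leb S)"
    by (rule nn_integral_liminf) measurable
  also have "\<dots> \<le> liminf (\<lambda>m. ?R)"
    using \<eta> unfolding R by (intro Liminf_mono always_eventually allI *[where B=B] d) auto
  also have "\<dots> = ?R" by (simp add: Liminf_const)
  finally show "L2sq (leb S) (\<lambda>x. \<eta> x *\<^sub>R ((if v x > k then 1 else 0) *\<^sub>R V x)) \<le> ?R" .
qed

context elliptic_solution
begin

text \<open>Here F is the regularised positive part of u - k.\<close>

lemma caccioppoli_u: "caccioppoli S energy_const u U"
proof (rule caccioppoliI)
  fix k \<eta> \<eta>' B and d :: real
  assume d: "0 < d" and \<eta>: "C1 \<eta> \<eta>'" "\<And>x. x \<notin> S \<Longrightarrow> \<eta> x = 0" "\<And>x. 0 \<le> \<eta> x \<and> \<eta> x \<le> 1" "\<And>x. norm (\<eta>' x) \<le> B"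
  show "(\<integral>\<^sup>+x. ennreal ((\<eta> x)\<^sup>2 * spos' d (u x - k) * (norm (U x))\<^sup>2) \<partial>leb S)
        \<le> ennreal energy_const * (\<integral>\<^sup>+x. ennreal ((max 0 (u x - k))\<^sup>2 * (norm (\<eta>' x))\<^sup>2) \<partial>leb S)"
    by (rule energy[OF C1r_spos_shift[OF d], where B=1, OF _ _ _ _ _ \<eta>]) (use spos_bounds[OF d] in auto)
qed measurable

text \<open>The shift by \<epsilon> makes the logarithm a Lipschitz function of u, which may vanish.\<close>

definition mlog :: "real \<Rightarrow> real^'n \<Rightarrow> real" where "mlog \<epsilon> x = - ln (u x + \<epsilon>)"
definition mlog' :: "real \<Rightarrow> real^'n \<Rightarrow> real^'n" where "mlog' \<epsilon> x = (- (1 / (u x + \<epsilon>))) *\<^sub>R U x"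

lemma mlog_borel[measurable]: "mlog \<epsilon> \<in> borel_measurable borel" "mlog' \<epsilon> \<in> borel_measurable borel"
  unfolding mlog_def[abs_def] mlog'_def[abs_def] by measurable

lemma sobolev_mlog:
  assumes \<epsilon>: "0 < \<epsilon>" shows "sobolev S (mlog \<epsilon>) (mlog' \<epsilon>)"
proof -
  have "C1r (\<lambda>s. (- ln (max 0 s + \<epsilon>)) + (- (1 / (0 + \<epsilon>))) * min 0 s) (\<lambda>s. - (1 / (max 0 s + \<epsilon>)))"
    by (rule C1r_extend[of "\<lambda>s. - ln (s + \<epsilon>)" "\<lambda>s. - (1 / (s + \<epsilon>))"])
       (use \<epsilon> in \<open>auto intro!: derivative_eq_intros continuous_intros\<close>)
  moreover have "\<bar>- (1 / (max 0 s + \<epsilon>))\<bar> \<le> 1 / \<epsilon>" for s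
    using \<epsilon> by (simp add: frac_le abs_of_nonneg)
  ultimately have "sobolev S (\<lambda>x. (- ln (max 0 (u x) + \<epsilon>)) + (- (1 / (0 + \<epsilon>))) * min 0 (u x)) (\<lambda>x. (- (1 / (max 0 (u x) + \<epsilon>))) *\<^sub>R U x)"
    by (rule sobolev_chain[OF u _ _ S(2) S_borel])
  then show ?thesis by (simp add: mlog_def[abs_def] mlog'_def[abs_def] u_nonneg max_absorb2 min_absorb1)
qed

text \<open>Here F(s) = - 1/(s + \<epsilon>), so that F' = F^2 and P = 1: the right hand side does not
  contain u any more.\<close>

lemma log_gradient:
  assumes \<epsilon>: "0 < \<epsilon>"
    and \<eta>: "C1 \<eta> \<eta>'" "\<And>x. x \<notin> S \<Longrightarrow> \<eta> x = 0" "\<And>x. 0 \<le> \<eta> x \<and> \<eta> x \<le> 1" "\<And>x. norm (\<eta>' x) \<le> B"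
  shows "L2sq (leb S) (\<lambda>x. \<eta> x *\<^sub>R mlog' \<epsilon> x) \<le> ennreal energy_const * L2sq (leb S) \<eta>'"
proof -
  have C: "C1r (\<lambda>s. (- (1 / (max 0 s + \<epsilon>))) + (1 / (0 + \<epsilon>)\<^sup>2) * min 0 s) (\<lambda>s. 1 / (max 0 s + \<epsilon>)\<^sup>2)"
    by (rule C1r_extend[of "\<lambda>s. - (1 / (s + \<epsilon>))" "\<lambda>s. 1 / (s + \<epsilon>)\<^sup>2"])
       (use \<epsilon> in \<open>auto intro!: derivative_eq_intros continuous_intros simp: power2_eq_square\<close>)
  have "(\<integral>\<^sup>+x. ennreal ((\<eta> x)\<^sup>2 * (1 / (max 0 (u x) + \<epsilon>)\<^sup>2) * (norm (U x))\<^sup>2) \<partial>leb S)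
    \<le> ennreal energy_const * (\<integral>\<^sup>+x. ennreal (1 * (norm (\<eta>' x))\<^sup>2) \<partial>leb S)"
  proof (rule energy[OF C, where B="1/\<epsilon>\<^sup>2" and P="\<lambda>_. 1", OF _ _ _ _ _ \<eta>])
    show "\<bar>1 / (max 0 s + \<epsilon>)\<^sup>2\<bar> \<le> 1 / \<epsilon>\<^sup>2" for s
      using \<epsilon> by (auto intro!: divide_left_mono power_mono)
    show "(- (1 / (max 0 s + \<epsilon>)) + 1 / (0 + \<epsilon>)\<^sup>2 * min 0 s)\<^sup>2 \<le> 1 * (1 / (max 0 s + \<epsilon>)\<^sup>2)" if "0 \<le> s" for s
      using that by (simp add: max_absorb2 min_absorb1 power_divide)
  qed auto
  then show ?thesis
    by (simp add: L2sq_def mlog'_def power_mult_distrib power_divide max_absorb2 u_nonneg)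
qed

text \<open>With g(s) = - ln (s + \<epsilon>) the choice is F = g' h(g - k), where h is the regularised
  positive part. Then F' = g'' h + g'^2 h', and the first term has the good sign because g is
  convex; the second one is the integrand of the energy of the truncation of g(u).\<close>

lemma caccioppoli_mlog:
  assumes \<epsilon>: "0 < \<epsilon>" shows "caccioppoli S energy_const (mlog \<epsilon>) (mlog' \<epsilon>)"
proof (rule caccioppoliI)
  fix k \<eta> \<eta>' B and d :: real
  assume d: "0 < d" and \<eta>: "C1 \<eta> \<eta>'" "\<And>x. x \<notin> S \<Longrightarrow> \<eta> x = 0" "\<And>x. 0 \<le> \<eta> x \<and> \<eta> x \<le> 1" "\<And>x. norm (\<eta>' x) \<le> B"
  define h where "h s = spos d (- ln (s + \<epsilon>) - k)" for s
  define h' where "h' s = spos' d (- ln (s + \<epsilon>) - k)" for s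
  define F where "F s = - (1 / (s + \<epsilon>)) * h s" for s
  define F' where "F' s = 1 / (s + \<epsilon>)\<^sup>2 * (h s + h' s)" for s
  have h: "0 \<le> h s" "h s \<le> max 0 (- ln (s + \<epsilon>) - k)" "0 \<le> h' s" "h' s \<le> 1"
      "(h s)\<^sup>2 \<le> (max 0 (- ln (s + \<epsilon>) - k))\<^sup>2 * h' s" for s
    using spos_bounds[OF d] by (auto simp: h_def h'_def)
  have der: "(F has_real_derivative F' s) (at s)" if "0 \<le> s" for s
  proof -
    have dl: "((\<lambda>s. - ln (s + \<epsilon>) - k) has_real_derivative - (1 / (s + \<epsilon>))) (at s)"
      using that \<epsilon> by (auto intro!: derivative_eq_intros)
    have ds: "\<And>t. (spos d has_real_derivative spos' d t) (at t)" using C1r_spos[OF d] by (simp add: C1r_def)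
    have dh: "(h has_real_derivative h' s * - (1 / (s + \<epsilon>))) (at s)"
      unfolding h_def[abs_def] h'_def by (rule DERIV_chain2[OF ds dl])
    have di: "((\<lambda>s. - (1 / (s + \<epsilon>))) has_real_derivative 1 / (s + \<epsilon>)\<^sup>2) (at s)"
      using that \<epsilon> by (auto intro!: derivative_eq_intros simp: power2_eq_square)
    have "(F has_real_derivative (1 / (s + \<epsilon>)\<^sup>2 * h s + (h' s * - (1 / (s + \<epsilon>))) * - (1 / (s + \<epsilon>)))) (at s)"
      unfolding F_def[abs_def] by (rule DERIV_mult[OF di dh])
    moreover have "1 / (s + \<epsilon>)\<^sup>2 * h s + (h' s * - (1 / (s + \<epsilon>))) * - (1 / (s + \<epsilon>)) = F' s"
      by (simp add: F'_def power2_eq_square distrib_left)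
    ultimately show ?thesis by simp
  qed
  have lc: "continuous_on {0..} (\<lambda>s. - ln (s + \<epsilon>) - k)" using \<epsilon> by (auto intro!: continuous_intros)
  have "continuous_on {0..} h" unfolding h_def
    by (rule continuous_on_compose2[OF C1r_continuous[OF C1r_spos[OF d]] lc]) auto
  moreover have "continuous_on {0..} h'" unfolding h'_def
    by (rule continuous_on_compose2[of UNIV "spos' d", OF _ lc]) (use C1r_spos[OF d] in \<open>auto simp: C1r_def\<close>)
  ultimately have cF': "continuous_on {0..} F'" unfolding F'_def
    using \<epsilon> by (auto intro!: continuous_intros)
  have C: "C1r (\<lambda>s. F (max 0 s) + F' 0 * min 0 s) (\<lambda>s. F' (max 0 s))"
    by (rule C1r_extend[OF _ cF']) (rule der)
  define B2 where "B2 = 1 / \<epsilon>\<^sup>2 * (max 0 (- ln \<epsilon> - k) + 1)"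
  have F'b: "\<bar>F' s\<bar> \<le> B2" "0 \<le> F' s" if "0 \<le> s" for s
  proof -
    show "0 \<le> F' s" using h[of s] by (simp add: F'_def)
    have "ln \<epsilon> \<le> ln (s + \<epsilon>)" using that \<epsilon> by simp
    then have "h s \<le> max 0 (- ln \<epsilon> - k)" using h(2)[of s] by linarith
    then have "h s + h' s \<le> max 0 (- ln \<epsilon> - k) + 1" using h(4)[of s] by linarith
    moreover have "1 / (s + \<epsilon>)\<^sup>2 \<le> 1 / \<epsilon>\<^sup>2" using that \<epsilon> by (auto intro!: divide_left_mono power_mono)
    ultimately have "F' s \<le> B2" unfolding F'_def B2_def using h[of s] by (intro mult_mono) auto
    then show "\<bar>F' s\<bar> \<le> B2" using \<open>0 \<le> F' s\<close> by simp
  qed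
  have "(\<integral>\<^sup>+x. ennreal ((\<eta> x)\<^sup>2 * F' (max 0 (u x)) * (norm (U x))\<^sup>2) \<partial>leb S)
    \<le> ennreal energy_const * (\<integral>\<^sup>+x. ennreal ((max 0 (- ln (u x + \<epsilon>) - k))\<^sup>2 * (norm (\<eta>' x))\<^sup>2) \<partial>leb S)"
  proof (rule energy[OF C, where B=B2 and P="\<lambda>s. (max 0 (- ln (s + \<epsilon>) - k))\<^sup>2", OF _ _ _ _ _ \<eta>])
    show "(F (max 0 s) + F' 0 * min 0 s)\<^sup>2 \<le> (max 0 (- ln (s + \<epsilon>) - k))\<^sup>2 * F' (max 0 s)" if "0 \<le> s" for s
    proof -
      have "(F (max 0 s) + F' 0 * min 0 s)\<^sup>2 = 1 / (s + \<epsilon>)\<^sup>2 * (h s)\<^sup>2"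
        using that by (simp add: F_def power_mult_distrib power_divide max_absorb2 min_absorb1)
      also have "\<dots> \<le> 1 / (s + \<epsilon>)\<^sup>2 * ((max 0 (- ln (s + \<epsilon>) - k))\<^sup>2 * (h s + h' s))"
        using h(5)[of s] mult_left_mono[of "h' s" "h s + h' s" "(max 0 (- ln (s + \<epsilon>) - k))\<^sup>2"] h(1)[of s]
        by (intro mult_left_mono) auto
      finally show ?thesis using that by (simp add: F'_def max_absorb2 mult_ac)
    qed
  qed (use F'b in auto)
  moreover have "(\<integral>\<^sup>+x. ennreal ((\<eta> x)\<^sup>2 * spos' d (mlog \<epsilon> x - k) * (norm (mlog' \<epsilon> x))\<^sup>2) \<partial>leb S)
      \<le> (\<integral>\<^sup>+x. ennreal ((\<eta> x)\<^sup>2 * F' (max 0 (u x)) * (norm (U x))\<^sup>2) \<partial>leb S)"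
  proof (intro nn_integral_mono ennreal_leI)
    fix x
    have "(\<eta> x)\<^sup>2 * spos' d (mlog \<epsilon> x - k) * (norm (mlog' \<epsilon> x))\<^sup>2 = (\<eta> x)\<^sup>2 * (1 / (u x + \<epsilon>)\<^sup>2 * h' (u x)) * (norm (U x))\<^sup>2"
      by (simp add: mlog_def mlog'_def h'_def power_mult_distrib power_divide)
    also have "\<dots> \<le> (\<eta> x)\<^sup>2 * F' (u x) * (norm (U x))\<^sup>2"
      unfolding F'_def using h(1)[of "u x"] by (intro mult_right_mono mult_left_mono) auto
    finally show "(\<eta> x)\<^sup>2 * spos' d (mlog \<epsilon> x - k) * (norm (mlog' \<epsilon> x))\<^sup>2 \<le> (\<eta> x)\<^sup>2 * F' (max 0 (u x)) * (norm (U x))\<^sup>2"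
      by (simp add: u_nonneg max_absorb2)
  qed
  ultimately show "(\<integral>\<^sup>+x. ennreal ((\<eta> x)\<^sup>2 * spos' d (mlog \<epsilon> x - k) * (norm (mlog' \<epsilon> x))\<^sup>2) \<partial>leb S)
        \<le> ennreal energy_const * (\<integral>\<^sup>+x. ennreal ((max 0 (mlog \<epsilon> x - k))\<^sup>2 * (norm (\<eta>' x))\<^sup>2) \<partial>leb S)"
    unfolding mlog_def[of \<epsilon>] by (rule order_trans[rotated])
qed measurable

lemma log_gradient_cube:
  assumes \<epsilon>: "0 < \<epsilon>" and r: "0 < r" "cube y (2 * r) \<subseteq> S"
  shows "L2sq (leb (cube y r)) (mlog' \<epsilon>) \<le> ennreal (energy_const * (16 * real CARD('n) / r)\<^sup>2 * (2 * r) ^ CARD('n))"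
proof -
  obtain \<eta> \<eta>' where \<eta>: "C1 \<eta> \<eta>'" "\<And>x. 0 \<le> \<eta> x" "\<And>x. \<eta> x \<le> 1" "\<And>x. x \<in> cube y r \<Longrightarrow> \<eta> x = 1"
    "\<And>x. x \<notin> cube y (2 * r) \<Longrightarrow> \<eta> x = 0" "\<And>x. x \<notin> cube y (2 * r) \<Longrightarrow> \<eta>' x = 0"
    "\<And>x. norm (\<eta>' x) \<le> 16 * real CARD('n) / (2 * r - r)"
    using cube_cutoff[of r "2 * r" y] r by auto
  note [measurable] = C1_measurable[OF \<eta>(1)]
  have rS: "cube y r \<subseteq> S" using r cube_mono[of r "2 * r" y] by auto
  have "L2sq (leb (cube y r)) (mlog' \<epsilon>) \<le> L2sq (leb S) (\<lambda>x. \<eta> x *\<^sub>R mlog' \<epsilon> x)"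
    using rS \<eta>(4) by (intro L2sq_leb_mono) auto
  also have "\<dots> \<le> ennreal energy_const * L2sq (leb S) \<eta>'"
  proof (rule log_gradient[OF \<epsilon> \<eta>(1) _ _ \<eta>(7)])
    show "\<eta> x = 0" if "x \<notin> S" for x using that r(2) by (intro \<eta>(5)) auto
  qed (use \<eta>(2,3) in auto)
  also have "L2sq (leb S) \<eta>' \<le> (\<integral>\<^sup>+x. ennreal ((16 * real CARD('n) / r)\<^sup>2) * indicator (cube y (2 * r)) x \<partial>lborel)"
    unfolding L2sq_leb[OF S_borel C1_measurable(2)[OF \<eta>(1)]]
  proof (rule nn_integral_mono)
    fix x
    have "(norm (\<eta>' x))\<^sup>2 \<le> (16 * real CARD('n) / r)\<^sup>2" using \<eta>(7)[of x] by (intro power_mono) auto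
    then show "indicator S x * ennreal ((norm (\<eta>' x))\<^sup>2) \<le> ennreal ((16 * real CARD('n) / r)\<^sup>2) * indicator (cube y (2 * r)) x"
      using \<eta>(6)[of x] by (auto simp: indicator_def intro!: ennreal_leI)
  qed
  also have "\<dots> = ennreal ((16 * real CARD('n) / r)\<^sup>2) * ennreal ((2 * r) ^ CARD('n))"
    using r by (simp add: nn_integral_cmult emeasure_cube)
  finally show ?thesis
    using energy_const_pos r by (simp add: ennreal_mult mult_left_mono mult.assoc)
qed

end

section \<open>Oscillation of the logarithm\<close>

lemma center_in_cube: "0 < r \<Longrightarrow> y \<in> cube y r"
  by (simp add: cube_def)

lemma cube_subset:
  assumes y: "y \<in> cube 0 a" and r: "a + r \<le> s" shows "cube y r \<subseteq> cube 0 s"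
proof
  fix x assume x: "x \<in> cube y r"
  have "\<bar>x $ i\<bar> < s / 2" for i
  proof -
    have "\<bar>x $ i - y $ i\<bar> < r / 2" "\<bar>y $ i\<bar> < a / 2" using x y by (simp_all add: cube_def)
    moreover have "\<bar>x $ i\<bar> \<le> \<bar>x $ i - y $ i\<bar> + \<bar>y $ i\<bar>"
      using abs_triangle_ineq[of "x $ i - y $ i" "y $ i"] by simp
    ultimately show ?thesis using r by linarith
  qed
  then show "x \<in> cube 0 s" by (simp add: cube_def)
qed

text \<open>By Lindelof's theorem countably many of the cubes already cover the set.\<close>

lemma AE_cube_local:
  fixes T :: "(real^'n) set"
  assumes "\<And>y. y \<in> T \<Longrightarrow> \<exists>\<rho>>0. AE x in lborel. x \<in> cube y \<rho> \<longrightarrow> P x"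
  shows "AE x in lborel. x \<in> T \<longrightarrow> P x"
proof -
  define Q where "Q y \<rho> \<longleftrightarrow> \<rho> > 0 \<and> (AE x in lborel. x \<in> cube y \<rho> \<longrightarrow> P x)" for y \<rho>
  have "\<forall>y\<in>T. \<exists>\<rho>. Q y \<rho>" using assms unfolding Q_def by blast
  from bchoice[OF this] obtain \<rho> where "\<forall>y\<in>T. Q y (\<rho> y)" by blast
  then have \<rho>: "\<And>y. y \<in> T \<Longrightarrow> \<rho> y > 0" "\<And>y. y \<in> T \<Longrightarrow> AE x in lborel. x \<in> cube y (\<rho> y) \<longrightarrow> P x"
    unfolding Q_def by blast+
  have op: "\<And>Q. Q \<in> (\<lambda>y. cube y (\<rho> y)) ` T \<Longrightarrow> open Q" by auto
  obtain F where F: "F \<subseteq> (\<lambda>y. cube y (\<rho> y)) ` T" "countable F" "\<Union>F = \<Union>((\<lambda>y. cube y (\<rho> y)) ` T)"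
    by (rule Lindelof[of "(\<lambda>y. cube y (\<rho> y)) ` T", OF op]) (assumption, rule that)
  have "AE x in lborel. \<forall>Q\<in>F. x \<in> Q \<longrightarrow> P x"
  proof (subst AE_ball_countable[OF F(2)], rule ballI)
    fix Q assume "Q \<in> F"
    then obtain y where "y \<in> T" "Q = cube y (\<rho> y)" using F(1) by blast
    then show "AE x in lborel. x \<in> Q \<longrightarrow> P x" using \<rho>(2) by simp
  qed
  then show ?thesis
  proof eventually_elim
    case (elim x)
    show ?case
    proof
      assume x: "x \<in> T"
      then have "x \<in> cube x (\<rho> x)" using \<rho>(1) by (simp add: center_in_cube)
      then have "x \<in> \<Union>F" using x F(3) by blast
      then show "P x" using elim by blast
    qed
  qed
qed

text \<open>The constant of the Poincare inequality times the constant of the gradient estimate for the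
  logarithm. The powers of r cancel except for the volume of the cube.\<close>

definition log_osc_const :: "real \<Rightarrow> nat \<Rightarrow> real" where
  "log_osc_const K n = 2 ^ n * real n * (K * (16 * real n)\<^sup>2 * 2 ^ n)"

context elliptic_solution
begin

text \<open>A substitute for the average over the cube: the Poincare inequality provides such a constant for
  each cube, and those of nested cubes can be compared.\<close>

definition log_center :: "real \<Rightarrow> real \<Rightarrow> real^'n \<Rightarrow> real \<Rightarrow> bool" where
  "log_center \<epsilon> c y r \<longleftrightarrow> L2sq (leb (cube y r)) (\<lambda>x. mlog \<epsilon> x - c) \<le> ennreal (log_osc_const energy_const CARD('n) * r ^ CARD('n))"

lemma log_osc_const_pos: "0 < log_osc_const energy_const CARD('n)"
  using energy_const_pos by (simp add: log_osc_const_def)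

lemma log_center_exists:
  assumes \<epsilon>: "0 < \<epsilon>" and r: "0 < r" "cube y (2 * r) \<subseteq> S"
  shows "\<exists>c. log_center \<epsilon> c y r"
proof -
  let ?n = "CARD('n)"
  have "cube y r \<subseteq> S" using r cube_mono[of r "2 * r" y] by auto
  then have "sobolev (cube y r) (mlog \<epsilon>) (mlog' \<epsilon>)"
    using sobolev_subset[OF sobolev_mlog[OF \<epsilon>]] by simp
  from sobolev_poincare[OF this r(1)] obtain c where
    c: "L2sq (leb (cube y r)) (\<lambda>x. mlog \<epsilon> x - c) \<le> ennreal (2 ^ ?n * (real ?n * r\<^sup>2)) * L2sq (leb (cube y r)) (mlog' \<epsilon>)"
    by blast
  also have "\<dots> \<le> ennreal (2 ^ ?n * (real ?n * r\<^sup>2)) * ennreal (energy_const * (16 * real ?n / r)\<^sup>2 * (2 * r) ^ ?n)"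
    by (intro mult_left_mono log_gradient_cube[OF \<epsilon> r]) simp
  also have "\<dots> = ennreal (2 ^ ?n * (real ?n * r\<^sup>2) * (energy_const * (16 * real ?n / r)\<^sup>2 * (2 * r) ^ ?n))"
    using energy_const_pos r by (intro ennreal_mult[symmetric]) auto
  also have "2 ^ ?n * (real ?n * r\<^sup>2) * (energy_const * (16 * real ?n / r)\<^sup>2 * (2 * r) ^ ?n) = log_osc_const energy_const ?n * r ^ ?n"
    using r by (simp add: log_osc_const_def power_mult_distrib power_divide field_simps)
  finally show ?thesis unfolding log_center_def by blast
qed

text \<open>On the smaller cube the logarithm is close in L2 to both centres.\<close>

lemma log_center_diff:
  assumes c: "log_center \<epsilon> c y r" and c': "log_center \<epsilon> c' y' r'" and sub: "cube y' r' \<subseteq> cube y r"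
    and r: "0 < r'" "0 \<le> r" "r \<le> t * r'"
  shows "(c - c')\<^sup>2 \<le> 2 * log_osc_const energy_const CARD('n) * (t ^ CARD('n) + 1)"
proof -
  let ?n = "CARD('n)" and ?B = "log_osc_const energy_const CARD('n)"
  have B: "0 < ?B" by (rule log_osc_const_pos)
  have rt: "r ^ ?n \<le> t ^ ?n * r' ^ ?n" using power_mono[OF r(3,2), of ?n] by (simp add: power_mult_distrib)
  have "ennreal (r' ^ ?n * (c - c')\<^sup>2) = L2sq (leb (cube y' r')) (\<lambda>x. c - c')"
    using r by (simp add: L2sq_def emeasure_leb emeasure_cube ennreal_mult mult.commute)
  also have "\<dots> \<le> 2 * L2sq (leb (cube y' r')) (\<lambda>x. mlog \<epsilon> x - c') + 2 * L2sq (leb (cube y' r')) (\<lambda>x. c - mlog \<epsilon> x)"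
    by (rule L2sq_add_le') auto
  also have "\<dots> \<le> 2 * ennreal (?B * r' ^ ?n) + 2 * ennreal (?B * r ^ ?n)"
  proof (intro add_mono mult_left_mono)
    show "L2sq (leb (cube y' r')) (\<lambda>x. mlog \<epsilon> x - c') \<le> ennreal (?B * r' ^ ?n)" using c' by (simp add: log_center_def)
    have "L2sq (leb (cube y' r')) (\<lambda>x. c - mlog \<epsilon> x) \<le> L2sq (leb (cube y r)) (\<lambda>x. mlog \<epsilon> x - c)"
      by (rule L2sq_leb_mono[OF sub]) auto
    then show "L2sq (leb (cube y' r')) (\<lambda>x. c - mlog \<epsilon> x) \<le> ennreal (?B * r ^ ?n)"
      using c by (simp add: log_center_def)
  qed auto
  also have "\<dots> = ennreal (2 * (?B * r' ^ ?n) + 2 * (?B * r ^ ?n))"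
    using B r by (subst ennreal_plus) (auto simp: ennreal_mult)
  finally have "r' ^ ?n * (c - c')\<^sup>2 \<le> 2 * (?B * r' ^ ?n) + 2 * (?B * r ^ ?n)"
    using B r by (subst (asm) ennreal_le_iff) auto
  also have "\<dots> \<le> 2 * (?B * r' ^ ?n) + 2 * (?B * (t ^ ?n * r' ^ ?n))"
    using B rt by (intro add_mono mult_left_mono) auto
  also have "\<dots> = r' ^ ?n * (2 * ?B * (t ^ ?n + 1))" by (simp add: algebra_simps)
  finally show ?thesis using r by (simp add: mult_le_cancel_left_pos)
qed

text \<open>A bound for the distance of the centres of two nested cubes whose sides differ by a factor of at
  most 5, the ratio of the sides 5/2 and 1/2 of the first two cubes in the chain below.\<close>

definition log_step :: real where
  "log_step = sqrt (2 * log_osc_const energy_const CARD('n) * (5 ^ CARD('n) + 1))"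

lemma log_step_pos: "0 < log_step"
  using log_osc_const_pos by (simp add: log_step_def add_pos_pos)

lemma log_center_step:
  assumes c: "log_center \<epsilon> c y r" and c': "log_center \<epsilon> c' y' r'" and sub: "cube y' r' \<subseteq> cube y r"
    and r: "0 < r'" "0 \<le> r" "r \<le> 5 * r'"
  shows "c - log_step \<le> c'"
proof -
  have "(c - c')\<^sup>2 \<le> log_step\<^sup>2"
    using log_center_diff[OF c c' sub r] log_osc_const_pos by (simp add: log_step_def)
  then have "\<bar>c - c'\<bar> \<le> log_step" using log_step_pos by (simp add: abs_le_square_iff[symmetric])
  then show ?thesis by linarith
qed

text \<open>The cubes of sides 1/2, 1/4, ... around y, all below the cube of side 5/2 around the origin,
  form a chain in which the centre moves by at most one step at a time.\<close>

lemma log_center_chain: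
  assumes \<epsilon>: "0 < \<epsilon>" and S5: "S = cube 0 5" and c0: "log_center \<epsilon> c0 0 (5/2)" and y: "y \<in> cube 0 2"
  shows "\<exists>c. log_center \<epsilon> c y ((1/2)^(j+1)) \<and> c0 - log_step * real (j+1) \<le> c"
proof (induction j)
  case 0
  have s: "cube y (2 * (1/2)) \<subseteq> S" "cube y (1/2) \<subseteq> cube 0 (5/2)"
    unfolding S5 by (rule cube_subset[OF y], simp)+
  obtain c where c: "log_center \<epsilon> c y (1/2)" using log_center_exists[OF \<epsilon> _ s(1)] by auto
  have "c0 - log_step \<le> c" by (rule log_center_step[OF c0 c s(2)]) auto
  then show ?case using c by auto
next
  case (Suc j)
  then obtain c where c: "log_center \<epsilon> c y ((1/2)^(j+1))" "c0 - log_step * real (j+1) \<le> c" by blast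
  have p: "(1/2::real)^(j+1) \<le> 1" "(1/2::real)^(Suc j+1) = (1/2)^(j+1) / 2"
    by (rule power_le_one) simp_all
  have s: "cube y (2 * (1/2)^(Suc j + 1)) \<subseteq> S"
    unfolding S5 by (rule cube_subset[OF y]) (use p in simp)
  have pos: "(0::real) < (1/2)^(Suc j+1)" by simp
  obtain c' where c': "log_center \<epsilon> c' y ((1/2)^(Suc j+1))"
    using log_center_exists[OF \<epsilon> pos s] by blast
  have "c - log_step \<le> c'"
    by (rule log_center_step[OF c(1) c' cube_mono]) (use p in auto)
  then show ?case using c' c(2) by (intro exI[of _ c']) (simp add: algebra_simps)
qed

section \<open>Harnack inequality for solutions with C1 test functions\<close>

text \<open>The logarithm - ln (u + \<epsilon>) satisfies the energy estimate itself, so its excess over the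
  centre c0 is bounded by its oscillation.\<close>

lemma log_lower_bound:
  assumes \<epsilon>: "0 < \<epsilon>" and S5: "S = cube 0 5" and c0: "log_center \<epsilon> c0 0 (5/2)"
    and \<delta>: "0 < \<delta>" and dg: "locally_bounded_above S energy_const \<delta>"
    and d: "0 < d" "log_osc_const energy_const CARD('n) * (5/2) ^ CARD('n) \<le> \<delta> * d\<^sup>2"
  shows "AE x in lborel. x \<in> cube 0 1 \<longrightarrow> mlog \<epsilon> x \<le> c0 + d"
proof (rule AE_cube_local)
  fix y :: "real^'n" assume y: "y \<in> cube 0 1"
  have s: "cube y (3 * 1) \<subseteq> S" unfolding S5 by (rule cube_subset[OF y]) simp
  have s': "cube y 1 \<subseteq> cube 0 (5/2)" by (rule cube_subset[OF y]) simp
  have "L2sq (leb (cube y 1)) (\<lambda>x. max 0 (mlog \<epsilon> x - c0)) \<le> L2sq (leb (cube 0 (5/2))) (\<lambda>x. mlog \<epsilon> x - c0)"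
    by (rule L2sq_leb_mono[OF s']) auto
  also have "\<dots> \<le> ennreal (log_osc_const energy_const CARD('n) * (5/2) ^ CARD('n))"
    using c0 by (simp add: log_center_def)
  also have "\<dots> \<le> ennreal (\<delta> * d\<^sup>2 * 1 ^ CARD('n))" using d by (intro ennreal_leI) simp
  finally have "AE x in lborel. x \<in> cube y (1/2) \<longrightarrow> mlog \<epsilon> x \<le> c0 + d"
    by (intro locally_bounded_aboveD[OF dg sobolev_mlog[OF \<epsilon>] caccioppoli_mlog[OF \<epsilon>] _ d(1) s]) auto
  then show "\<exists>\<rho>>0. AE x in lborel. x \<in> cube y \<rho> \<longrightarrow> mlog \<epsilon> x \<le> c0 + d"
    by (intro exI[of _ "1/2"]) simp
qed

text \<open>Where u + \<epsilon> > M/2, the logarithm - ln (u + \<epsilon>) deviates from its centre by at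
  least t, which happens only on a small part of the cube by Chebyshev's inequality. If u +
  \<epsilon> were bounded by N M, then the excess of u + \<epsilon> over M/2 would be small in
  L2, and the iteration for u with k = M/2 - \<epsilon> and d = M/2 would give the bound M on
  the cube of half the side.\<close>

lemma growth:
  assumes \<epsilon>: "0 < \<epsilon>"
    and dg: "locally_bounded_above S energy_const \<delta>"
    and r: "0 < r" "cube y (3 * r) \<subseteq> S" and c: "log_center \<epsilon> c y r"
    and M: "0 < M" "- c + ln 2 + t \<le> ln M" and t: "0 < t" "N\<^sup>2 * 4 * log_osc_const energy_const CARD('n) \<le> \<delta> * t\<^sup>2" and N: "0 < N"
    and le: "AE x in lborel. x \<in> cube y r \<longrightarrow> u x + \<epsilon> \<le> N * M"
  shows "AE x in lborel. x \<in> cube y (r/2) \<longrightarrow> u x + \<epsilon> \<le> M"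
proof -
  let ?n = "CARD('n)" and ?B = "log_osc_const energy_const CARD('n)"
  let ?A = "{x \<in> cube y r. - mlog \<epsilon> x > - c + t}"
  have Bp: "0 < ?B" by (rule log_osc_const_pos)
  have "emeasure lborel ?A \<le> ennreal (?B * r ^ ?n / t\<^sup>2)"
  proof (rule L2sq_chebyshev[OF _ _ t(1)])
    have "L2sq (leb (cube y r)) (\<lambda>x. max 0 (- mlog \<epsilon> x - - c)) \<le> L2sq (leb (cube y r)) (\<lambda>x. mlog \<epsilon> x - c)"
      by (rule L2sq_leb_mono) auto
    then show "L2sq (leb (cube y r)) (\<lambda>x. max 0 (- mlog \<epsilon> x - - c)) \<le> ennreal (?B * r ^ ?n)"
      using c by (simp add: log_center_def)
  qed (use Bp r in auto)
  then have meas: "ennreal ((N * M)\<^sup>2) * emeasure lborel ?A \<le> ennreal ((N * M)\<^sup>2) * ennreal (?B * r ^ ?n / t\<^sup>2)"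
    by (rule mult_left_mono) simp
  have [measurable]: "?A \<in> sets borel" by measurable
  have "L2sq (leb (cube y r)) (\<lambda>x. max 0 (u x - (M / 2 - \<epsilon>))) = (\<integral>\<^sup>+x. indicator (cube y r) x * ennreal ((norm (max 0 (u x - (M / 2 - \<epsilon>))))\<^sup>2) \<partial>lborel)"
    by (rule L2sq_leb) auto
  also have "\<dots> \<le> (\<integral>\<^sup>+x. ennreal ((N * M)\<^sup>2) * indicator ?A x \<partial>lborel)"
  proof (rule nn_integral_mono_AE)
    show "AE x in lborel. indicator (cube y r) x * ennreal ((norm (max 0 (u x - (M / 2 - \<epsilon>))))\<^sup>2) \<le> ennreal ((N * M)\<^sup>2) * indicator ?A x"
      using le
    proof eventually_elim
      case (elim x)
      show ?case
      proof (cases "x \<in> cube y r \<and> u x + \<epsilon> > M / 2")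
        case True
        have "ln (M / 2) < ln (u x + \<epsilon>)" using True M(1) by (subst ln_less_cancel_iff) auto
        moreover have "ln (M / 2) = ln M - ln 2" using M(1) by (simp add: ln_div)
        ultimately have "- mlog \<epsilon> x > - c + t" using M(2) by (simp add: mlog_def)
        then have "x \<in> ?A" using True by simp
        moreover have "(norm (max 0 (u x - (M / 2 - \<epsilon>))))\<^sup>2 \<le> (N * M)\<^sup>2"
          using True elim M(1) N by (intro power_mono) auto
        ultimately show ?thesis using True by (simp add: ennreal_leI)
      next
        case False
        then have "x \<notin> cube y r \<or> max 0 (u x - (M / 2 - \<epsilon>)) = 0" by (auto simp: max_def)
        then show ?thesis
        proof
          assume 0: "max 0 (u x - (M / 2 - \<epsilon>)) = 0"
          show ?thesis unfolding 0 by simp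
        qed simp
      qed
    qed
  qed
  also have "\<dots> = ennreal ((N * M)\<^sup>2) * emeasure lborel ?A" by (simp add: nn_integral_cmult)
  also note meas
  also have "ennreal ((N * M)\<^sup>2) * ennreal (?B * r ^ ?n / t\<^sup>2) = ennreal ((N * M)\<^sup>2 * (?B * r ^ ?n / t\<^sup>2))"
    using Bp r by (intro ennreal_mult[symmetric]) auto
  also have "\<dots> \<le> ennreal (\<delta> * (M / 2)\<^sup>2 * r ^ ?n)"
  proof (rule ennreal_leI)
    have "N\<^sup>2 * 4 * ?B * (M\<^sup>2 * r ^ ?n) \<le> \<delta> * t\<^sup>2 * (M\<^sup>2 * r ^ ?n)"
      using t(2) r by (intro mult_right_mono) auto
    then show "(N * M)\<^sup>2 * (?B * r ^ ?n / t\<^sup>2) \<le> \<delta> * (M / 2)\<^sup>2 * r ^ ?n"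
      using t(1) by (simp add: power_mult_distrib power_divide field_simps)
  qed
  finally have "AE x in lborel. x \<in> cube y (r/2) \<longrightarrow> u x \<le> (M / 2 - \<epsilon>) + M / 2"
    using M(1) by (intro locally_bounded_aboveD[OF dg u caccioppoli_u r(1) _ r(2)]) auto
  then show ?thesis by eventually_elim auto
qed

text \<open>Otherwise the growth lemma, applied over and over, produces points y at which u essentially
  exceeds M j. In step j the cube has side 2^(-(j+1)), its centre has drifted by at most j + 1
  steps, and this is compensated by the j + 1 steps contained in ln (M j). The points move by at
  most half the side of each cube and stay in the cube of side 2, on which u is essentially
  bounded.\<close>

lemma log_upper_bound:
  assumes \<epsilon>: "0 < \<epsilon>" and S5: "S = cube 0 5" and c0: "log_center \<epsilon> c0 0 (5/2)"
    and \<delta>: "0 < \<delta>" and dg: "locally_bounded_above S energy_const \<delta>"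
    and t: "0 < t" "(exp log_step)\<^sup>2 * 4 * log_osc_const energy_const CARD('n) \<le> \<delta> * t\<^sup>2"
  shows "AE x in lborel. x \<in> cube 0 1 \<longrightarrow> u x + \<epsilon> \<le> exp (- c0 + log_step + ln 2 + t)"
proof (rule ccontr)
  define N where "N = exp log_step"
  define M where "M j = exp (- c0 + log_step + ln 2 + t) * N ^ j" for j :: nat
  \<comment> \<open>This is the statement that u + \<epsilon> exceeds m at y, in a form that makes sense almost everywhere.\<close>
  define big where "big m y \<longleftrightarrow> (\<forall>\<rho>>0. \<not> (AE x in lborel. x \<in> cube y \<rho> \<longrightarrow> u x + \<epsilon> \<le> m))" for m y
  have big: "\<exists>y\<in>T. big m y" if "\<not> (AE x in lborel. x \<in> T \<longrightarrow> u x + \<epsilon> \<le> m)" for T m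
    using that AE_cube_local[of T "\<lambda>x. u x + \<epsilon> \<le> m"] unfolding big_def by blast
  have N: "0 < N" "1 < N" using log_step_pos by (auto simp: N_def)
  have Mpos: "0 < M j" for j using N by (simp add: M_def)
  have lnM: "ln (M j) = - c0 + ln 2 + t + log_step * real (j + 1)" for j
  proof -
    have "M j = exp (- c0 + log_step + ln 2 + t + real j * log_step)"
      by (simp only: M_def N_def exp_add exp_of_nat_mult)
    then have "ln (M j) = - c0 + log_step + ln 2 + t + real j * log_step" by simp
    also have "\<dots> = - c0 + ln 2 + t + log_step * real (j + 1)" by (simp add: algebra_simps)
    finally show ?thesis .
  qed
  assume "\<not> (AE x in lborel. x \<in> cube 0 1 \<longrightarrow> u x + \<epsilon> \<le> exp (- c0 + log_step + ln 2 + t))"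
  then have "\<not> (AE x in lborel. x \<in> cube 0 1 \<longrightarrow> u x + \<epsilon> \<le> M 0)" by (simp add: M_def)
  from big[OF this] obtain y0 where y0: "y0 \<in> cube 0 1" "big (M 0) y0" by blast
  have seq: "\<exists>y. (\<forall>i. \<bar>y $ i\<bar> < 1 - (1/2)^(j+1)) \<and> big (M j) y" for j
  proof (induction j)
    case 0
    show ?case using y0 by (intro exI[of _ y0]) (simp add: cube_def)
  next
    case (Suc j)
    then obtain y where y: "\<And>i. \<bar>y $ i\<bar> < 1 - (1/2)^(j+1)" "big (M j) y" by blast
    let ?r = "(1/2::real)^(j+1)"
    have r: "0 < ?r" "?r \<le> 1/2" using power_decreasing[of 1 "j+1" "1/2::real"] by simp_all
    have y2: "y \<in> cube 0 2" unfolding cube_def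
    proof safe
      fix i
      have "1 - ?r < 1" using r(1) by linarith
      then show "\<bar>y $ i - 0 $ i\<bar> < 2 / 2" using less_trans[OF y(1)[of i]] by simp
    qed
    have s: "cube y (3 * ?r) \<subseteq> S" unfolding S5 by (rule cube_subset[OF y2]) (use r in linarith)
    obtain c where c: "log_center \<epsilon> c y ?r" "c0 - log_step * real (j+1) \<le> c"
      using log_center_chain[OF \<epsilon> S5 c0 y2] by blast
    have "\<not> (AE x in lborel. x \<in> cube y (?r/2) \<longrightarrow> u x + \<epsilon> \<le> M j)"
      using y(2) r unfolding big_def by (auto simp del: power_Suc)
    then have "\<not> (AE x in lborel. x \<in> cube y ?r \<longrightarrow> u x + \<epsilon> \<le> N * M j)"
      using growth[OF \<epsilon> dg r(1) s c(1) Mpos[of j] _ t(1) t(2)[folded N_def] N(1)] c(2) lnM[of j]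
      by (auto simp del: power_Suc)
    moreover have "N * M j = M (Suc j)" by (simp add: M_def)
    ultimately obtain y' where y': "y' \<in> cube y ?r" "big (M (Suc j)) y'" using big by metis
    have "\<bar>y' $ i\<bar> < 1 - (1/2)^(Suc j+1)" for i
    proof -
      have "\<bar>y' $ i - y $ i\<bar> < ?r / 2" using y'(1) by (simp add: cube_def)
      moreover have "(1/2::real)^(Suc j+1) = ?r / 2" by simp
      ultimately show ?thesis using y(1)[of i] by linarith
    qed
    then show ?case using y'(2) by blast
  qed
  obtain b where b: "0 \<le> b" "L2sq (leb S) u = ennreal b"
    using sobolevD(3)[OF u] by (cases "L2sq (leb S) u") auto
  define d where "d = sqrt (b / \<delta>) + 1"
  have d: "0 < d" using b \<delta> by (simp add: d_def add_nonneg_pos)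
  have "(sqrt (b / \<delta>))\<^sup>2 \<le> d\<^sup>2" unfolding d_def using b \<delta> by (intro power_mono) auto
  then have bd: "b \<le> \<delta> * d\<^sup>2" using b \<delta> by (simp add: field_simps)
  have bounded: "AE x in lborel. x \<in> cube y (1/2) \<longrightarrow> u x \<le> 0 + d" if y: "y \<in> cube 0 2" for y
  proof (rule locally_bounded_aboveD[OF dg u caccioppoli_u _ d, of 1])
    show s: "cube y (3 * 1) \<subseteq> S" unfolding S5 by (rule cube_subset[OF y]) simp
    have "cube y 1 \<subseteq> S" using s cube_mono[of 1 "3 * 1" y] by auto
    then have "L2sq (leb (cube y 1)) (\<lambda>x. max 0 (u x - 0)) \<le> L2sq (leb S) u"
      by (intro L2sq_leb_mono) auto
    then show "L2sq (leb (cube y 1)) (\<lambda>x. max 0 (u x - 0)) \<le> ennreal (\<delta> * d\<^sup>2 * 1 ^ CARD('n))"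
      using b bd by (auto intro: order_trans ennreal_leI)
  qed simp
  obtain j where j: "(d + \<epsilon>) / M 0 < N ^ j" using real_arch_pow[OF N(2)] by blast
  then have "d + \<epsilon> \<le> M j" using Mpos[of 0] by (simp add: M_def pos_divide_less_eq mult.commute less_imp_le)
  obtain y where y: "\<And>i. \<bar>y $ i\<bar> < 1 - (1/2)^(j+1)" "big (M j) y" using seq by blast
  have "y \<in> cube 0 2" unfolding cube_def
  proof safe
    fix i
    have "(0::real) < (1/2)^(j+1)" by simp
    then have "1 - (1/2::real)^(j+1) < 1" by linarith
    then show "\<bar>y $ i - 0 $ i\<bar> < 2 / 2" using less_trans[OF y(1)[of i]] by simp
  qed
  from bounded[OF this] have "AE x in lborel. x \<in> cube y (1/2) \<longrightarrow> u x + \<epsilon> \<le> M j"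
    by eventually_elim (use \<open>d + \<epsilon> \<le> M j\<close> in auto)
  moreover have "\<not> (AE x in lborel. x \<in> cube y (1/2) \<longrightarrow> u x + \<epsilon> \<le> M j)"
    using y(2) unfolding big_def by simp
  ultimately show False by blast
qed

end

text \<open>The constants depend on the ellipticity constants and the dimension only: the iteration constant
  \<delta> is fixed before u and \<epsilon>. The number m is exp(- c0 - d), the lower bound for
  u + \<epsilon>.\<close>

theorem harnack_elliptic_solution:
  assumes "0 < lam" "0 < L"
  obtains H :: real where "0 < H"
    "\<And>u U A \<epsilon>. elliptic_solution (cube 0 5 :: (real^'n) set) lam L u U A \<Longrightarrow> 0 < \<epsilon> \<Longrightarrow>
      \<exists>m>0. AE x in lborel. x \<in> cube 0 1 \<longrightarrow> m \<le> u x + \<epsilon> \<and> u x + \<epsilon> \<le> H * m"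
proof -
  let ?n = "CARD('n)"
  define K where "K = 4 * L\<^sup>2 / lam\<^sup>2"
  have K: "0 < K" using assms by (simp add: K_def)
  obtain \<delta> where \<delta>: "0 < \<delta>"
    "\<And>S :: (real^'n) set. convex S \<Longrightarrow> bounded S \<Longrightarrow> S \<in> sets borel \<Longrightarrow> locally_bounded_above S K \<delta>"
    using de_giorgi[OF K] by blast
  define B where "B = log_osc_const K ?n"
  have B: "0 < B" using K by (simp add: B_def log_osc_const_def)
  define s where "s = sqrt (2 * B * (5 ^ ?n + 1))"
  define d where "d = sqrt (B * (5/2) ^ ?n / \<delta>)"
  define t where "t = sqrt ((exp s)\<^sup>2 * 4 * B / \<delta>)"
  have d: "0 < d" "B * (5/2) ^ ?n \<le> \<delta> * d\<^sup>2" using B \<delta>(1) by (auto simp: d_def)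
  have t: "0 < t" "(exp s)\<^sup>2 * 4 * B \<le> \<delta> * t\<^sup>2" using B \<delta>(1) by (auto simp: t_def)
  define H where "H = exp (s + ln 2 + t + d)"
  show ?thesis
  proof (rule that[of H])
    fix u U A and \<epsilon> :: real
    assume e: "elliptic_solution (cube 0 5 :: (real^'n) set) lam L u U A" and \<epsilon>: "0 < \<epsilon>"
    interpret elliptic_solution "cube 0 5 :: (real^'n) set" lam L u U A by (rule e)
    have EK: "energy_const = K" by (simp add: energy_const_def K_def)
    have LB: "log_osc_const energy_const CARD('n) = B" by (simp add: EK B_def)
    have LS: "log_step = s" by (simp add: log_step_def LB s_def)
    have "cube (0::real^'n) (2 * (5/2)) \<subseteq> cube 0 5" by simp
    then obtain c0 where c0: "log_center \<epsilon> c0 0 (5/2)" using log_center_exists[OF \<epsilon>, of "5/2"] by auto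
    have dg: "locally_bounded_above (cube 0 5 :: (real^'n) set) energy_const \<delta>"
      unfolding EK by (rule \<delta>(2)) auto
    have lo: "AE x in lborel. x \<in> cube 0 1 \<longrightarrow> mlog \<epsilon> x \<le> c0 + d"
      by (rule log_lower_bound[OF \<epsilon> refl c0 \<delta>(1) dg d(1)]) (use d(2) LB in auto)
    have hi: "AE x in lborel. x \<in> cube 0 1 \<longrightarrow> u x + \<epsilon> \<le> exp (- c0 + log_step + ln 2 + t)"
      by (rule log_upper_bound[OF \<epsilon> refl c0 \<delta>(1) dg t(1)]) (use t(2) LB LS in auto)
    show "\<exists>m>0. AE x in lborel. x \<in> cube 0 1 \<longrightarrow> m \<le> u x + \<epsilon> \<and> u x + \<epsilon> \<le> H * m"
    proof (intro exI[of _ "exp (- c0 - d)"] conjI)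
      show "AE x in lborel. x \<in> cube 0 1 \<longrightarrow> exp (- c0 - d) \<le> u x + \<epsilon> \<and> u x + \<epsilon> \<le> H * exp (- c0 - d)"
        using lo hi
      proof eventually_elim
        case (elim x)
        show ?case
        proof (intro impI conjI)
          assume x: "x \<in> cube 0 1"
          have p: "0 < u x + \<epsilon>" using u_nonneg[of x] \<epsilon> by linarith
          have "- c0 - d \<le> ln (u x + \<epsilon>)" using elim(1) x by (simp add: mlog_def)
          then have "exp (- c0 - d) \<le> exp (ln (u x + \<epsilon>))" by simp
          then show "exp (- c0 - d) \<le> u x + \<epsilon>" using p by simp
          have "u x + \<epsilon> \<le> exp (- c0 + log_step + ln 2 + t)" using elim(2) x by simp
          also have "\<dots> = H * exp (- c0 - d)" by (simp add: H_def LS flip: exp_add)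
          finally show "u x + \<epsilon> \<le> H * exp (- c0 - d)" .
        qed
      qed
    qed simp
  qed (simp add: H_def)
qed

section \<open>Mollifiers\<close>

text \<open>The functions P(1/t) exp(-1/t), extended by 0 to t \<le> 0. This family contains exp(-1/t) and
  is closed under differentiation (the derivative replaces P(s) by s^2 (P(s) - P'(s))), hence
  its members are smooth.\<close>

definition expinv_poly :: "real poly \<Rightarrow> real \<Rightarrow> real" where
  "expinv_poly P t = (if t > 0 then poly P (1 / t) * exp (- (1 / t)) else 0)"

definition expinv_deriv :: "real poly \<Rightarrow> real poly" where
  "expinv_deriv P = monom 1 2 * (P - pderiv P)"

lemma poly_exp_tendsto_zero: "((\<lambda>s. poly P s * exp (- s)) \<longlongrightarrow> (0::real)) at_top"
proof -
  have "((\<lambda>s. \<Sum>i\<le>degree P. coeff P i * (s ^ i / exp s)) \<longlongrightarrow> (\<Sum>i\<le>degree P. coeff P i * 0)) at_top"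
    by (intro tendsto_sum tendsto_mult tendsto_const tendsto_power_div_exp_0)
  then show ?thesis by (simp add: poly_altdef sum_distrib_right exp_minus divide_inverse mult.assoc)
qed

lemma expinv_poly_deriv: "(expinv_poly P has_real_derivative expinv_poly (expinv_deriv P) t) (at t)"
proof -
  consider "t > 0" | "t < 0" | "t = 0" by linarith
  then show ?thesis
  proof cases
    case 1
    have "((\<lambda>t. poly P (1 / t) * exp (- (1 / t))) has_real_derivative
        poly (pderiv P) (1 / t) * (- (1 / t\<^sup>2)) * exp (- (1 / t)) + exp (- (1 / t)) * (1 / t\<^sup>2) * poly P (1 / t)) (at t)"
      using 1 by (auto intro!: derivative_eq_intros DERIV_chain2[OF poly_DERIV] simp: power2_eq_square)
    then have "((\<lambda>t. poly P (1 / t) * exp (- (1 / t))) has_real_derivative expinv_poly (expinv_deriv P) t) (at t)"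
      using 1 by (simp add: expinv_poly_def expinv_deriv_def poly_monom power_divide algebra_simps add_divide_distrib diff_divide_distrib)
    then show ?thesis
      by (rule has_field_derivative_transform_within_open[of _ _ _ "{0<..}"]) (use 1 in \<open>auto simp: expinv_poly_def\<close>)
  next
    case 2
    have "((\<lambda>t. 0) has_real_derivative 0) (at t)" by simp
    then have "(expinv_poly P has_real_derivative 0) (at t)"
      by (rule has_field_derivative_transform_within_open[of _ _ _ "{..<0}"]) (use 2 in \<open>auto simp: expinv_poly_def\<close>)
    then show ?thesis using 2 by (simp add: expinv_poly_def)
  next
    case 3
    have "((\<lambda>y. poly (pCons 0 P) (inverse y) * exp (- inverse y)) \<longlongrightarrow> 0) (at_right (0::real))"
      by (rule filterlim_compose[OF poly_exp_tendsto_zero filterlim_inverse_at_top_right])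
    then have "((\<lambda>y. (expinv_poly P y - expinv_poly P 0) / (y - 0)) \<longlongrightarrow> 0) (at_right 0)"
      by (rule Lim_transform_eventually)
         (auto simp: eventually_at_filter expinv_poly_def divide_inverse mult_ac)
    moreover have "((\<lambda>y. (expinv_poly P y - expinv_poly P 0) / (y - 0)) \<longlongrightarrow> 0) (at_left 0)"
      by (rule Lim_transform_eventually[OF tendsto_const])
         (auto simp: eventually_at_filter expinv_poly_def)
    ultimately show ?thesis
      unfolding has_field_derivative_iff 3 using filterlim_split_at by (fastforce simp: expinv_poly_def)
  qed
qed

lemma partial_derivI:
  assumes "(f has_derivative f') (at x)" shows "partial_deriv i f x = f' (axis i 1)"
  unfolding partial_deriv_def using frechet_derivative_at[OF assms] by simp

text \<open>Rules for the predicate C_diff, by induction on the order. They suffice for products of the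
  functions above with polynomials.\<close>

lemma C_diff_less: "C_diff (Suc k) f \<Longrightarrow> C_diff k f"
proof (induction k arbitrary: f)
  case 0
  then show ?case
    by (auto intro!: continuous_at_imp_continuous_on differentiable_imp_continuous_within)
next
  case (Suc k)
  then show ?case by auto
qed

lemma C_diff_add: "C_diff k f \<Longrightarrow> C_diff k g \<Longrightarrow> C_diff k (\<lambda>x. f x + g x)"
proof (induction k arbitrary: f g)
  case 0
  then show ?case by (auto intro!: continuous_intros)
next
  case (Suc k)
  have "partial_deriv i (\<lambda>x. f x + g x) = (\<lambda>x. partial_deriv i f x + partial_deriv i g x)" for i
  proof
    fix x
    have "((\<lambda>x. f x + g x) has_derivative (\<lambda>h. frechet_derivative f (at x) h + frechet_derivative g (at x) h)) (at x)"
      using Suc.prems by (intro has_derivative_add) (auto simp: frechet_derivative_works[symmetric])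
    from partial_derivI[OF this] show "partial_deriv i (\<lambda>x. f x + g x) x = partial_deriv i f x + partial_deriv i g x"
      by (simp add: partial_deriv_def)
  qed
  then show ?case using Suc by (auto intro!: derivative_intros)
qed

lemma C_diff_mult: "C_diff k f \<Longrightarrow> C_diff k g \<Longrightarrow> C_diff k (\<lambda>x. f x * g x)"
proof (induction k arbitrary: f g)
  case 0
  then show ?case by (auto intro!: continuous_intros)
next
  case (Suc k)
  have pd: "partial_deriv i (\<lambda>x. f x * g x) = (\<lambda>x. f x * partial_deriv i g x + partial_deriv i f x * g x)" for i
  proof
    fix x
    have "((\<lambda>x. f x * g x) has_derivative (\<lambda>h. f x * frechet_derivative g (at x) h + frechet_derivative f (at x) h * g x)) (at x)"
      using Suc.prems by (intro has_derivative_mult) (auto simp: frechet_derivative_works[symmetric])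
    from partial_derivI[OF this] show "partial_deriv i (\<lambda>x. f x * g x) x = f x * partial_deriv i g x + partial_deriv i f x * g x"
      by (simp add: partial_deriv_def)
  qed
  have "C_diff k f" "C_diff k g" using Suc.prems C_diff_less by auto
  then have "C_diff k (\<lambda>x. f x * partial_deriv i g x + partial_deriv i f x * g x)" for i
    using Suc.prems by (intro C_diff_add Suc.IH) auto
  then show ?case using Suc.prems pd by (auto intro!: differentiable_mult)
qed

lemma C_diff_const: "C_diff k (\<lambda>x. c)"
proof (induction k arbitrary: c)
  case (Suc k)
  have "partial_deriv i (\<lambda>x::real^'a. c) = (\<lambda>x. 0)" for i
    by (rule ext, rule partial_derivI) (rule has_derivative_const)
  then show ?case using Suc by simp
qed simp

lemma C_diff_coord:
  fixes z :: "real^'n"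
  shows "C_diff k (\<lambda>x. c * (x $ i - z $ i))"
proof (induction k)
  case 0 show ?case by (auto intro!: continuous_intros)
next
  case (Suc k)
  have d: "((\<lambda>x. c * (x $ i - z $ i)) has_derivative (\<lambda>h. c * h $ i)) (at x)" for x :: "real^'n"
    by (auto intro!: derivative_eq_intros bounded_linear.has_derivative[OF bounded_linear_vec_nth])
  have "partial_deriv j (\<lambda>x. c * (x $ i - z $ i)) = (\<lambda>x. c * axis j 1 $ i)" for j
    by (rule ext, rule partial_derivI[OF d])
  then show ?case using d C_diff_const[of k] by (auto simp: differentiable_def)
qed

text \<open>Each partial derivative is again a function of this form, multiplied by an affine function, so
  the induction runs over all polynomials at once.\<close>

lemma C_diff_expinv_poly:
  fixes z :: "real^'n"
  shows "C_diff k (\<lambda>x. expinv_poly P (e - (x - z) \<bullet> (x - z)))"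
proof (induction k arbitrary: P)
  have d: "((\<lambda>x. expinv_poly P (e - (x - z) \<bullet> (x - z))) has_derivative
      (\<lambda>h. (- (2 * ((x - z) \<bullet> h))) * expinv_poly (expinv_deriv P) (e - (x - z) \<bullet> (x - z)))) (at x)" for x P
  proof -
    have 1: "((\<lambda>x. e - (x - z) \<bullet> (x - z)) has_derivative (\<lambda>h. - (2 * ((x - z) \<bullet> h)))) (at x)"
      by (auto intro!: derivative_eq_intros simp: inner_commute)
    have 2: "(expinv_poly P has_derivative (\<lambda>h. h * expinv_poly (expinv_deriv P) s)) (at s)" for s
      using expinv_poly_deriv[of P s] by (simp add: has_field_derivative_def mult_commute_abs)
    show ?thesis using has_derivative_compose[OF 1 2] by simp
  qed
  {
    case 0
    show ?case using d[of P] by (auto intro!: continuous_at_imp_continuous_on has_derivative_continuous)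
  next
    case (Suc k)
    have pd: "partial_deriv i (\<lambda>x. expinv_poly P (e - (x - z) \<bullet> (x - z)))
       = (\<lambda>x. (-2 * (x $ i - z $ i)) * expinv_poly (expinv_deriv P) (e - (x - z) \<bullet> (x - z)))" for i
      by (rule ext, subst partial_derivI[OF d]) (simp add: inner_axis)
    have "C_diff k (\<lambda>x. (-2 * (x $ i - z $ i)) * expinv_poly (expinv_deriv P) (e - (x - z) \<bullet> (x - z)))" for i
      by (rule C_diff_mult[OF C_diff_coord Suc])
    then show ?case unfolding C_diff.simps pd using d[of P] unfolding differentiable_def by blast
  }
qed

definition bump :: "real \<Rightarrow> real^'n \<Rightarrow> real" where "bump \<epsilon> x = expinv_poly 1 (\<epsilon>\<^sup>2 - x \<bullet> x)"

lemma bump_facts: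
  fixes x :: "real^'n"
  assumes "0 < \<epsilon>"
  shows "0 \<le> bump \<epsilon> x" "bump \<epsilon> x \<le> 1" "\<epsilon> \<le> norm x \<Longrightarrow> bump \<epsilon> x = 0" "norm x < \<epsilon> \<Longrightarrow> 0 < bump \<epsilon> x"
proof -
  have n: "x \<bullet> x = (norm x)\<^sup>2" by (simp add: power2_norm_eq_inner)
  show "0 \<le> bump \<epsilon> x" "bump \<epsilon> x \<le> 1" by (auto simp: bump_def expinv_poly_def)
  show "bump \<epsilon> x = 0" if "\<epsilon> \<le> norm x"
  proof -
    have "\<epsilon>\<^sup>2 \<le> (norm x)\<^sup>2" using that assms by (intro power_mono) auto
    then have "\<not> 0 < \<epsilon>\<^sup>2 - x \<bullet> x" unfolding n by linarith
    then show ?thesis by (simp add: bump_def expinv_poly_def)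
  qed
  show "0 < bump \<epsilon> x" if "norm x < \<epsilon>"
  proof -
    have "(norm x)\<^sup>2 < \<epsilon>\<^sup>2" using that by (intro power_strict_mono) auto
    then have "0 < \<epsilon>\<^sup>2 - x \<bullet> x" unfolding n by linarith
    then show ?thesis by (simp add: bump_def expinv_poly_def)
  qed
qed

definition mollifier :: "real \<Rightarrow> real^'n \<Rightarrow> real" where
  "mollifier \<epsilon> x = bump \<epsilon> x / (\<integral>y. bump \<epsilon> y \<partial>(lborel :: (real^'n) measure))"

lemma C_diff_mollifier: "C_diff k (\<lambda>x. mollifier \<epsilon> (x - z))"
proof -
  have "C_diff k (\<lambda>x. inverse (\<integral>y. bump \<epsilon> y \<partial>(lborel :: (real^'n) measure)) * expinv_poly 1 (\<epsilon>\<^sup>2 - (x - z) \<bullet> (x - z)))"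
    by (rule C_diff_mult[OF C_diff_const C_diff_expinv_poly])
  then show ?thesis by (simp add: mollifier_def bump_def divide_inverse mult.commute)
qed

lemma C_diff_borel: "C_diff k f \<Longrightarrow> f \<in> borel_measurable borel"
proof (induction k)
  case 0 then show ?case by (auto intro: borel_measurable_continuous_onI)
next
  case (Suc k) then show ?case using C_diff_less by blast
qed

lemma mollifier_borel[measurable]: "mollifier \<epsilon> \<in> borel_measurable borel"
  using C_diff_borel[OF C_diff_mollifier[of 0 \<epsilon> 0]] by simp

lemma bump_borel[measurable]: "bump \<epsilon> \<in> borel_measurable borel"
  using C_diff_borel[OF C_diff_expinv_poly[of 0 1 "\<epsilon>\<^sup>2" 0]] by (simp add: bump_def[abs_def])

lemma bump_integral:
  assumes "0 < \<epsilon>"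
  shows "integrable lborel (bump \<epsilon> :: real^'n \<Rightarrow> real)" "0 < (\<integral>y. bump \<epsilon> y \<partial>(lborel :: (real^'n) measure))"
proof -
  have "integrable lborel (indicator (cball 0 \<epsilon>) :: real^'n \<Rightarrow> real)"
    by (intro integrable_real_indicator emeasure_bounded_finite) auto
  then show int: "integrable lborel (bump \<epsilon> :: real^'n \<Rightarrow> real)"
    by (rule Bochner_Integration.integrable_bound)
       (use bump_facts[OF assms, where 'n='n] in \<open>auto intro!: AE_I2 simp: indicator_def not_le abs_of_nonneg\<close>)
  have "(\<integral>y. bump \<epsilon> y \<partial>(lborel :: (real^'n) measure)) \<noteq> 0"
  proof
    assume "(\<integral>y. bump \<epsilon> y \<partial>(lborel :: (real^'n) measure)) = 0"
    then have "AE y in (lborel :: (real^'n) measure). bump \<epsilon> y = 0"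
      using integral_nonneg_eq_0_iff_AE[OF int] bump_facts(1)[OF assms, where 'n='n] by simp
    then have "AE y in (lborel :: (real^'n) measure). y \<notin> ball 0 \<epsilon>"
      by eventually_elim (use bump_facts(4)[OF assms, where 'n='n] in force)
    then have "emeasure lborel (ball 0 \<epsilon> :: (real^'n) set) = 0"
      by (subst (asm) AE_iff_measurable[of "ball 0 \<epsilon>"]) auto
    then have "ball 0 \<epsilon> = ({} :: (real^'n) set)"
      using open_not_negligible[of "ball 0 \<epsilon> :: (real^'n) set"] assms
      by (auto simp: negligible_iff_null_sets null_sets_def)
    then show False using assms by simp
  qed
  moreover have "0 \<le> (\<integral>y. bump \<epsilon> y \<partial>(lborel :: (real^'n) measure))"
    using bump_facts(1)[OF assms, where 'n='n] by simp
  ultimately show "0 < (\<integral>y. bump \<epsilon> y \<partial>(lborel :: (real^'n) measure))" by simp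
qed

lemma mollifier_facts:
  fixes x :: "real^'n"
  assumes "0 < \<epsilon>"
  shows "0 \<le> mollifier \<epsilon> x" "\<epsilon> \<le> norm x \<Longrightarrow> mollifier \<epsilon> x = 0" "integrable lborel (mollifier \<epsilon> :: real^'n \<Rightarrow> real)"
    "(\<integral>y. mollifier \<epsilon> y \<partial>(lborel :: (real^'n) measure)) = 1" "mollifier \<epsilon> (- x) = mollifier \<epsilon> x"
proof -
  note b = bump_facts[OF assms, where 'n='n] and i = bump_integral[OF assms, where 'n='n]
  show "0 \<le> mollifier \<epsilon> x" using b(1)[of x] i(2) by (simp add: mollifier_def)
  show "\<epsilon> \<le> norm x \<Longrightarrow> mollifier \<epsilon> x = 0" using b(3)[of x] by (simp add: mollifier_def)
  show "integrable lborel (mollifier \<epsilon> :: real^'n \<Rightarrow> real)" using i(1) by (simp add: mollifier_def[abs_def])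
  show "(\<integral>y. mollifier \<epsilon> y \<partial>(lborel :: (real^'n) measure)) = 1" using i(2) by (simp add: mollifier_def)
  show "mollifier \<epsilon> (- x) = mollifier \<epsilon> x" by (simp add: mollifier_def bump_def[of \<epsilon> x] bump_def[of \<epsilon> "- x"])
qed

section \<open>Convolutions\<close>

lemma integral_lborel_reflect:
  fixes f :: "'a::euclidean_space \<Rightarrow> 'b::{banach, second_countable_topology}"
  assumes [measurable]: "f \<in> borel_measurable borel"
  shows "(\<integral>z. f (x - z) \<partial>lborel) = (\<integral>z. f z \<partial>lborel)"
    and "integrable lborel (\<lambda>z. f (x - z)) \<longleftrightarrow> integrable lborel f"
proof -
  have D: "(lborel :: 'a measure) = distr lborel borel (\<lambda>z. x - z)"
    using lborel_affine[of "-1" x] by (simp add: density_1)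
  have "(\<integral>z. f z \<partial>lborel) = (\<integral>z. f z \<partial>distr lborel borel (\<lambda>z. x - z))" using D by simp
  also have "\<dots> = (\<integral>z. f (x - z) \<partial>lborel)" by (subst integral_distr) auto
  finally show "(\<integral>z. f (x - z) \<partial>lborel) = (\<integral>z. f z \<partial>lborel)" ..
  have "integrable lborel f \<longleftrightarrow> integrable (distr lborel borel (\<lambda>z. x - z)) f" using D by simp
  also have "\<dots> \<longleftrightarrow> integrable lborel (\<lambda>z. f (x - z))" by (subst integrable_distr_eq) auto
  finally show "integrable lborel (\<lambda>z. f (x - z)) \<longleftrightarrow> integrable lborel f" ..
qed

text \<open>Convolution with a scalar first factor. The second factor may be vector-valued, so that
  gradients can be convolved.\<close>

definition conv :: "('a::euclidean_space \<Rightarrow> real) \<Rightarrow> ('a \<Rightarrow> 'b::euclidean_space) \<Rightarrow> 'a \<Rightarrow> 'b" where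
  "conv f g x = (\<integral>y. f y *\<^sub>R g (x - y) \<partial>lborel)"

lemma conv_commute:
  fixes f g :: "'a::euclidean_space \<Rightarrow> real"
  assumes [measurable]: "f \<in> borel_measurable borel" "g \<in> borel_measurable borel"
  shows "conv f g x = conv g f x"
proof -
  have "(\<integral>z. (\<lambda>y. f y * g (x - y)) (x - z) \<partial>lborel) = (\<integral>y. f y * g (x - y) \<partial>lborel)"
    by (rule integral_lborel_reflect) measurable
  then show ?thesis by (simp add: conv_def mult.commute)
qed

lemma integrable_scaleR_bounded:
  fixes f :: "'a::euclidean_space \<Rightarrow> real" and g :: "'a \<Rightarrow> 'b::euclidean_space"
  assumes f: "integrable lborel f" and [measurable]: "g \<in> borel_measurable borel" and b: "\<And>x. norm (g x) \<le> B"
  shows "integrable lborel (\<lambda>y. f y *\<^sub>R g y)"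
proof -
  have [measurable]: "f \<in> borel_measurable borel" using borel_measurable_integrable[OF f] by simp
  have "integrable lborel (\<lambda>y. B * f y)" using f by simp
  then show ?thesis
  proof (rule Bochner_Integration.integrable_bound)
    have "0 \<le> B" using b norm_ge_zero order_trans by blast
    then show "AE y in lborel. norm (f y *\<^sub>R g y) \<le> norm (B * f y)"
      using b by (intro AE_I2) (auto simp: abs_mult mult.commute[of B] intro!: mult_left_mono)
  qed measurable
qed

lemma compact_support_uniform:
  fixes g :: "'a::euclidean_space \<Rightarrow> 'b::euclidean_space"
  assumes c: "continuous_on UNIV g" and s: "\<And>x. R < norm x \<Longrightarrow> g x = 0"
  shows "\<exists>B. \<forall>x. norm (g x) \<le> B" "\<And>e. 0 < e \<Longrightarrow> \<exists>d>0. \<forall>x y. norm (x - y) < d \<longrightarrow> norm (g x - g y) < e"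
proof -
  have "compact (g ` cball 0 R)" by (intro compact_continuous_image continuous_on_subset[OF c]) auto
  then obtain B where B: "\<forall>x\<in>cball 0 R. norm (g x) \<le> B" using compact_imp_bounded bounded_iff by (metis imageI)
  have "norm (g x) \<le> max B 0" for x
    using B s[of x] by (cases "norm x \<le> R") (auto simp: max.coboundedI1)
  then show "\<exists>B. \<forall>x. norm (g x) \<le> B" by blast
  fix e :: real assume e: "0 < e"
  have "uniformly_continuous_on (cball 0 (R + 1)) g"
    by (intro compact_uniformly_continuous continuous_on_subset[OF c]) auto
  then obtain d where d: "d > 0" "\<And>x y. x \<in> cball 0 (R + 1) \<Longrightarrow> y \<in> cball 0 (R + 1) \<Longrightarrow> dist y x < d \<Longrightarrow> dist (g y) (g x) < e"
    unfolding uniformly_continuous_on_def using e by metis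
  show "\<exists>d>0. \<forall>x y. norm (x - y) < d \<longrightarrow> norm (g x - g y) < e"
  proof (intro exI[of _ "min d 1"] conjI allI impI)
    show "0 < min d 1" using d by simp
    fix x y :: 'a assume xy: "norm (x - y) < min d 1"
    show "norm (g x - g y) < e"
    proof (cases "norm x \<le> R \<or> norm y \<le> R")
      case True
      have "norm x \<le> norm y + norm (x - y)" "norm y \<le> norm x + norm (x - y)"
        by norm+
      then have "x \<in> cball 0 (R + 1)" "y \<in> cball 0 (R + 1)" using True xy by auto
      then show ?thesis using d(2)[of y x] xy by (simp add: dist_norm)
    next
      case False
      then show ?thesis using s[of x] s[of y] e by simp
    qed
  qed
qed

lemma norm_integral_le:
  fixes f :: "'a \<Rightarrow> 'b::euclidean_space"
  assumes "integrable M f" "integrable M g" "\<And>x. norm (f x) \<le> g x"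
  shows "norm (\<integral>x. f x \<partial>M) \<le> (\<integral>x. g x \<partial>M)"
  by (rule order_trans[OF integral_norm_bound integral_mono]) (use assms in auto)

lemma conv_continuous:
  fixes f :: "'a::euclidean_space \<Rightarrow> real" and g :: "'a \<Rightarrow> 'b::euclidean_space"
  assumes f: "integrable lborel f" and c: "continuous_on UNIV g" and s: "\<And>x. R < norm x \<Longrightarrow> g x = 0"
  shows "continuous_on UNIV (conv f g)"
proof (rule continuous_at_imp_continuous_on, rule ballI, unfold continuous_at_eps_delta, intro allI impI)
  fix x and e :: real assume e: "0 < e"
  have [measurable]: "g \<in> borel_measurable borel" using c by (rule borel_measurable_continuous_onI)
  have [measurable]: "f \<in> borel_measurable borel" using borel_measurable_integrable[OF f] by simp
  obtain B where B: "\<And>x. norm (g x) \<le> B" using compact_support_uniform(1)[OF c s] by blast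
  define I where "I = (\<integral>y. norm (f y) \<partial>lborel)"
  have I: "0 \<le> I" by (simp add: I_def)
  obtain d where d: "d > 0" "\<And>x y. norm (x - y) < d \<Longrightarrow> norm (g x - g y) < e / (I + 1)"
    using compact_support_uniform(2)[where g=g and R=R and e="e / (I + 1)", OF c s] e I by auto
  have int: "integrable lborel (\<lambda>y. f y *\<^sub>R g (x - y))" for x
    by (rule integrable_scaleR_bounded[OF f _ B]) measurable
  show "\<exists>d>0. \<forall>x'. dist x' x < d \<longrightarrow> dist (conv f g x') (conv f g x) < e"
  proof (intro exI[of _ d] conjI d allI impI)
    fix x' assume x': "dist x' x < d"
    have "conv f g x' - conv f g x = (\<integral>y. f y *\<^sub>R (g (x' - y) - g (x - y)) \<partial>lborel)"
      unfolding conv_def by (subst Bochner_Integration.integral_diff[symmetric]) (auto simp: int scaleR_diff_right)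
    also have "norm \<dots> \<le> (\<integral>y. norm (f y) * (e / (I + 1)) \<partial>lborel)"
    proof (rule norm_integral_le)
      show "integrable lborel (\<lambda>y. f y *\<^sub>R (g (x' - y) - g (x - y)))"
        using Bochner_Integration.integrable_diff[OF int[of x'] int[of x]] by (simp add: scaleR_diff_right)
      show "norm (f y *\<^sub>R (g (x' - y) - g (x - y))) \<le> norm (f y) * (e / (I + 1))" for y
        unfolding norm_scaleR real_norm_def
        using d(2)[of "x' - y" "x - y"] x' by (intro mult_left_mono[OF less_imp_le]) (auto simp: dist_norm)
    qed (use f in auto)
    also have "\<dots> = I * (e / (I + 1))" by (simp add: I_def)
    also have "\<dots> < e" using e I by (simp add: field_simps)
    finally show "dist (conv f g x') (conv f g x) < e" by (simp add: dist_norm)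
  qed
qed

lemma C1_support_grad:
  assumes g: "C1 g g'" and s: "\<And>x. R < norm x \<Longrightarrow> g x = 0" and x: "R < norm x"
  shows "g' x = 0"
  by (rule C1_grad_zero_on_open[OF g, of "- cball 0 R"]) (use s x in auto)

text \<open>The gradient falls on the second factor. The difference quotients converge uniformly because the
  gradient of a C1 function of bounded support is uniformly continuous.\<close>

lemma conv_C1:
  fixes f g :: "real^'n \<Rightarrow> real"
  assumes f: "integrable lborel f" and g: "C1 g g'" and s: "\<And>x. R < norm x \<Longrightarrow> g x = 0"
  shows "C1 (conv f g) (conv f g')"
proof -
  have s': "g' x = 0" if "R < norm x" for x using C1_support_grad[OF g s that] .
  have c': "continuous_on UNIV g'" using g by (simp add: C1_def)
  note [measurable] = C1_measurable[OF g]
  have [measurable]: "f \<in> borel_measurable borel" using borel_measurable_integrable[OF f] by simp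
  obtain B where B: "\<And>x. norm (g x) \<le> B" using compact_support_uniform(1)[OF C1_continuous[OF g] s] by blast
  obtain B' where B': "\<And>x. norm (g' x) \<le> B'" using compact_support_uniform(1)[OF c' s'] by blast
  define I where "I = (\<integral>y. norm (f y) \<partial>lborel)"
  have I: "0 \<le> I" by (simp add: I_def)
  have int: "integrable lborel (\<lambda>y. f y *\<^sub>R g (x - y))" for x
    by (rule integrable_scaleR_bounded[OF f _ B]) measurable
  have int': "integrable lborel (\<lambda>y. f y *\<^sub>R g' (x - y))" for x
    by (rule integrable_scaleR_bounded[OF f _ B']) measurable
  have "(conv f g has_derivative (\<lambda>h. conv f g' x \<bullet> h)) (at x)" for x
    unfolding has_derivative_at_alt
  proof (intro conjI allI impI)
    show "bounded_linear (\<lambda>h. conv f g' x \<bullet> h)" by (rule bounded_linear_inner_right)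
    fix e :: real assume e: "0 < e"
    obtain d where d: "d > 0" "\<And>x y. norm (x - y) < d \<Longrightarrow> norm (g' x - g' y) < e / (I + 1)"
      using compact_support_uniform(2)[where g=g' and R=R and e="e / (I + 1)", OF c' s'] e I by auto
    show "\<exists>d>0. \<forall>x'. norm (x' - x) < d \<longrightarrow> norm (conv f g x' - conv f g x - conv f g' x \<bullet> (x' - x)) \<le> e * norm (x' - x)"
    proof (intro exI[of _ d] conjI d allI impI)
      fix x' assume x': "norm (x' - x) < d"
      have lin: "norm (g (x' - y) - g (x - y) - g' (x - y) \<bullet> (x' - x)) \<le> norm (x' - x) * (e / (I + 1))" for y
      proof -
        have "norm (g (x' - y) - g (x - y) - g' (x - y) \<bullet> ((x' - y) - (x - y))) \<le> norm ((x' - y) - (x - y)) * (e / (I + 1))"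
        proof (rule differentiable_bound_linearization[where S="ball (x - y) d" and f'="\<lambda>z h. g' z \<bullet> h"])
          show "(x - y) + t *\<^sub>R ((x' - y) - (x - y)) \<in> ball (x - y) d" if "t \<in> {0..1}" for t
          proof -
            have "\<bar>t\<bar> * norm (x' - x) \<le> 1 * norm (x' - x)" using that by (intro mult_right_mono) auto
            then show ?thesis using x' by (simp add: dist_norm)
          qed
          show "(g has_derivative (\<lambda>h. g' z \<bullet> h)) (at z within ball (x - y) d)" for z
            using g by (auto simp: C1_def intro: has_derivative_at_withinI)
          show "onorm ((\<lambda>h. g' z \<bullet> h) - (\<lambda>h. g' (x - y) \<bullet> h)) \<le> e / (I + 1)" if "z \<in> ball (x - y) d" for z
          proof (rule onorm_le)
            fix h :: "real^'n"
            have "norm (g' z - g' (x - y)) \<le> e / (I + 1)" using d(2)[of z "x - y"] that by (auto simp: dist_norm norm_minus_commute)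
            then have "norm (g' z - g' (x - y)) * norm h \<le> e / (I + 1) * norm h" by (rule mult_right_mono) simp
            then show "norm (((\<lambda>h. g' z \<bullet> h) - (\<lambda>h. g' (x - y) \<bullet> h)) h) \<le> e / (I + 1) * norm h"
              using Cauchy_Schwarz_ineq2[of "g' z - g' (x - y)" h] by (simp add: inner_diff_left)
          qed
        qed (use d in auto)
        then show ?thesis by simp
      qed
      have int2: "integrable lborel (\<lambda>y. f y * (g (x' - y) - g (x - y) - g' (x - y) \<bullet> (x' - x)))"
      proof -
        have "integrable lborel (\<lambda>y. f y *\<^sub>R g (x' - y) - f y *\<^sub>R g (x - y) - (f y *\<^sub>R g' (x - y)) \<bullet> (x' - x))"
          by (intro Bochner_Integration.integrable_diff int integrable_inner_left int')
        then show ?thesis by (simp add: right_diff_distrib)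
      qed
      have "conv f g x' - conv f g x - conv f g' x \<bullet> (x' - x)
        = (\<integral>y. f y * (g (x' - y) - g (x - y) - g' (x - y) \<bullet> (x' - x)) \<partial>lborel)"
      proof -
        have "conv f g' x \<bullet> (x' - x) = (\<integral>y. (f y *\<^sub>R g' (x - y)) \<bullet> (x' - x) \<partial>lborel)"
          unfolding conv_def using int' by (intro integral_inner_left[symmetric]) auto
        moreover have "conv f g x' - conv f g x = (\<integral>y. f y *\<^sub>R g (x' - y) - f y *\<^sub>R g (x - y) \<partial>lborel)"
          unfolding conv_def by (rule Bochner_Integration.integral_diff[symmetric]) (rule int)+
        moreover have "(\<integral>y. f y *\<^sub>R g (x' - y) - f y *\<^sub>R g (x - y) \<partial>lborel) - (\<integral>y. (f y *\<^sub>R g' (x - y)) \<bullet> (x' - x) \<partial>lborel)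
          = (\<integral>y. f y *\<^sub>R g (x' - y) - f y *\<^sub>R g (x - y) - (f y *\<^sub>R g' (x - y)) \<bullet> (x' - x) \<partial>lborel)"
          by (rule Bochner_Integration.integral_diff[symmetric]) (intro Bochner_Integration.integrable_diff int integrable_inner_left int')+
        ultimately have "conv f g x' - conv f g x - conv f g' x \<bullet> (x' - x)
          = (\<integral>y. f y *\<^sub>R g (x' - y) - f y *\<^sub>R g (x - y) - (f y *\<^sub>R g' (x - y)) \<bullet> (x' - x) \<partial>lborel)"
          by simp
        then show ?thesis by (simp add: right_diff_distrib)
      qed
      also have "norm \<dots> \<le> (\<integral>y. norm (f y) * (norm (x' - x) * (e / (I + 1))) \<partial>lborel)"
      proof (rule norm_integral_le[OF int2])
          show "norm (f y * (g (x' - y) - g (x - y) - g' (x - y) \<bullet> (x' - x))) \<le> norm (f y) * (norm (x' - x) * (e / (I + 1)))" for y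
            unfolding norm_mult by (intro mult_left_mono lin) simp
        qed (use f in simp)
      also have "\<dots> = norm (x' - x) * (e * (I / (I + 1)))" by (simp add: I_def mult_ac)
      also have "\<dots> \<le> norm (x' - x) * (e * 1)" using e I by (intro mult_left_mono) auto
      finally show "norm (conv f g x' - conv f g x - conv f g' x \<bullet> (x' - x)) \<le> e * norm (x' - x)" by (simp add: mult.commute)
    qed
  qed
  then show ?thesis using conv_continuous[OF f c' s'] by (simp add: C1_def)
qed

definition grad :: "(real^'n \<Rightarrow> real) \<Rightarrow> real^'n \<Rightarrow> real^'n" where
  "grad f x = (\<chi> i. partial_deriv i f x)"

lemma C1_grad:
  assumes "C_diff 1 f" shows "C1 f (grad f)"
proof -
  have d: "\<And>x. f differentiable at x" and c: "\<And>i. continuous_on UNIV (partial_deriv i f)"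
    using assms by auto
  have "(f has_derivative (\<lambda>h. grad f x \<bullet> h)) (at x)" for x
  proof -
    have fd: "(f has_derivative frechet_derivative f (at x)) (at x)" using d frechet_derivative_works by blast
    then have lin: "linear (frechet_derivative f (at x))" by (rule has_derivative_linear)
    have "frechet_derivative f (at x) h = grad f x \<bullet> h" for h
    proof -
      have "frechet_derivative f (at x) h = frechet_derivative f (at x) (\<Sum>i\<in>UNIV. (h $ i) *\<^sub>R axis i 1)"
        using basis_expansion[of h] by (simp add: scalar_mult_eq_scaleR)
      also have "\<dots> = (\<Sum>i\<in>UNIV. h $ i * frechet_derivative f (at x) (axis i 1))"
        using lin by (simp add: linear_sum linear_scale)
      finally show ?thesis by (simp add: grad_def inner_vec_def partial_deriv_def mult.commute)
    qed
    then show ?thesis using fd by (metis (no_types, lifting) ext)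
  qed
  then show ?thesis unfolding C1_def grad_def using c by (auto intro!: continuous_on_vec_lambda)
qed

lemma C1_partial_deriv: "C1 f f' \<Longrightarrow> partial_deriv i f x = f' x $ i"
  using partial_derivI[of f "\<lambda>h. f' x \<bullet> h" x i] by (simp add: C1_def inner_axis)

lemma C1_unique: "C1 f f' \<Longrightarrow> grad f = f'"
  by (auto simp: grad_def C1_partial_deriv vec_eq_iff)

text \<open>Every partial derivative falls on the smooth factor and preserves its support.\<close>

lemma conv_C_diff:
  fixes f g :: "real^'n \<Rightarrow> real"
  assumes f: "integrable lborel f"
  shows "(\<And>k. C_diff k g) \<Longrightarrow> (\<And>x. R < norm x \<Longrightarrow> g x = 0) \<Longrightarrow> C_diff k (conv f g)"
proof (induction k arbitrary: g)
  case 0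
  have "continuous_on UNIV g" using 0(1)[of 0] by simp
  from conv_continuous[OF f this 0(2)] show ?case by simp
next
  case (Suc k)
  have C: "C1 g (grad g)" using Suc.prems(1)[of 1] by (intro C1_grad) simp
  have CC: "C1 (conv f g) (conv f (grad g))" by (rule conv_C1[OF f C Suc.prems(2)])
  have s: "partial_deriv i g x = 0" if "R < norm x" for i x
    using C1_support_grad[OF C Suc.prems(2) that] C1_partial_deriv[OF C, of i x] by simp
  have b: "\<exists>B. \<forall>x. norm (grad g x) \<le> B"
    using C C1_support_grad[OF C Suc.prems(2)] by (intro compact_support_uniform(1)[of _ R]) (auto simp: C1_def)
  have pd: "partial_deriv i (conv f g) = conv f (partial_deriv i g)" for i
  proof
    fix x
    obtain B where B: "\<And>x. norm (grad g x) \<le> B" using b by blast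
    note [measurable] = C1_measurable[OF C]
    have int: "integrable lborel (\<lambda>y. f y *\<^sub>R grad g (x - y))"
      by (rule integrable_scaleR_bounded[OF f _ B]) measurable
    have "partial_deriv i (conv f g) x = conv f (grad g) x \<bullet> axis i 1" by (simp add: C1_partial_deriv[OF CC] inner_axis)
    also have "\<dots> = (\<integral>y. (f y *\<^sub>R grad g (x - y)) \<bullet> axis i 1 \<partial>lborel)"
      unfolding conv_def using int by (intro integral_inner_left[symmetric]) auto
    finally show "partial_deriv i (conv f g) x = conv f (partial_deriv i g) x"
      by (simp add: inner_axis grad_def conv_def)
  qed
  have "C_diff k (conv f (partial_deriv i g))" for i
  proof (rule Suc.IH)
    show "C_diff k (partial_deriv i g)" for k using Suc.prems(1)[of "Suc k"] by simp
  qed (rule s)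
  moreover have "conv f g differentiable at x" for x using CC by (auto simp: C1_def differentiable_def)
  ultimately show ?case by (simp add: pd)
qed

section \<open>Approximation in L2 by mollification\<close>

lemma L2sq_indicator_bound:
  fixes f :: "'a::euclidean_space \<Rightarrow> 'b::euclidean_space"
  assumes "\<And>x. norm (f x) \<le> s" "\<And>x. R < norm x \<Longrightarrow> f x = 0" "0 \<le> s"
  shows "L2sq lborel f \<le> ennreal (s\<^sup>2) * emeasure lborel (cball (0::'a) R)"
proof -
  have "L2sq lborel f \<le> (\<integral>\<^sup>+x. ennreal (s\<^sup>2) * indicator (cball (0::'a) R) x \<partial>lborel)"
    unfolding L2sq_def
  proof (rule nn_integral_mono)
    fix x
    have "(norm (f x))\<^sup>2 \<le> s\<^sup>2" using assms(1)[of x] by (intro power_mono) auto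
    then show "ennreal ((norm (f x))\<^sup>2) \<le> ennreal (s\<^sup>2) * indicator (cball 0 R) x"
      using assms(2)[of x] by (cases "norm x \<le> R") (auto intro: ennreal_leI)
  qed
  moreover have "cball (0::'a) R \<in> sets lborel" by simp
  ultimately show ?thesis by (simp only: nn_integral_cmult_indicator)
qed

text \<open>After truncation of the values, g is an almost everywhere limit of continuous functions.
  Clipping these to the range of the truncation and cutting them off outside a ball makes
  dominated convergence applicable.\<close>

lemma L2sq_approx_continuous:
  fixes g :: "'a::euclidean_space \<Rightarrow> 'b::euclidean_space"
  assumes [measurable]: "g \<in> borel_measurable borel" and fin: "L2sq lborel g < \<infinity>"
    and supp: "\<And>x. R < norm x \<Longrightarrow> g x = 0" and e: "0 < e"
  shows "\<exists>h. continuous_on UNIV h \<and> (\<forall>x. R + 1 < norm x \<longrightarrow> h x = 0) \<and> L2sq lborel (\<lambda>x. g x - h x) < ennreal e"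
proof -
  have [measurable]: "cball (0::'a) (R + 1) \<in> sets borel" by simp
  define T where "T m x = (if norm (g x) \<le> real m then g x else 0)" for m :: nat and x
  have [measurable]: "T m \<in> borel_measurable borel" for m unfolding T_def[abs_def] by measurable
  have "(\<lambda>m. L2sq lborel (\<lambda>x. (if norm (g x) \<le> real m then 0 else 1) *\<^sub>R g x)) \<longlonglongrightarrow> 0"
  proof (rule L2sq_dominated[where L=1])
    show "AE x in lborel. (\<lambda>m. if norm (g x) \<le> real m then 0 else 1::real) \<longlonglongrightarrow> 0"
    proof (rule AE_I2, rule tendsto_eventually)
      fix x
      obtain k :: nat where k: "norm (g x) \<le> real k" using real_arch_simple by blast
      then show "\<forall>\<^sub>F m in sequentially. (if norm (g x) \<le> real m then 0 else 1::real) = 0"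
        unfolding eventually_sequentially by (intro exI[of _ k]) (auto intro: order_trans)
    qed
  qed (use fin in auto)
  moreover have "(if norm (g x) \<le> real m then 0 else 1) *\<^sub>R g x = g x - T m x" for m x by (simp add: T_def)
  ultimately have "(\<lambda>m. L2sq lborel (\<lambda>x. g x - T m x)) \<longlonglongrightarrow> 0" by simp
  then have "\<forall>\<^sub>F m in sequentially. L2sq lborel (\<lambda>x. g x - T m x) < ennreal (e / 8)"
    by (rule order_tendstoD) (use e in simp)
  then obtain m0 where m0: "\<And>m. m \<ge> m0 \<Longrightarrow> L2sq lborel (\<lambda>x. g x - T m x) < ennreal (e / 8)"
    unfolding eventually_sequentially by blast
  define m where "m = Suc m0"
  have m: "L2sq lborel (\<lambda>x. g x - T m x) < ennreal (e / 8)" "0 < real m" using m0[of m] by (simp_all add: m_def)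
  have Tb: "norm (T m x) \<le> real m" for x by (simp add: T_def)
  have "T m measurable_on UNIV"
    by (rule lebesgue_measurable_imp_measurable_on, rule measurable_completion) auto
  then obtain N G where N: "negligible N" and G: "\<And>n. continuous_on UNIV (G n)" "\<And>x. x \<notin> N \<Longrightarrow> (\<lambda>n. G n x) \<longlonglongrightarrow> T m x"
    unfolding measurable_on_def by auto
  have Nn: "AE x in lborel. x \<notin> N"
  proof -
    have "AE x in lebesgue. x \<notin> N" using N by (intro AE_not_in) (simp add: negligible_iff_null_sets)
    then show ?thesis by (simp add: AE_completion_iff)
  qed
  \<comment> \<open>The continuous projection onto the ball of radius m, and a cut-off function that is 1 on the
    ball containing the support of g.\<close>
  define clip where "clip v = (real m / max (real m) (norm v)) *\<^sub>R v" for v :: 'b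
  define cut where "cut x = max 0 (min 1 (R + 1 - norm x))" for x :: 'a
  define h where "h n x = cut x *\<^sub>R clip (G n x)" for n x
  have clip: "norm (clip v) \<le> real m" "norm v \<le> real m \<Longrightarrow> clip v = v" for v
  proof -
    have "norm (clip v) = real m * (norm v / max (real m) (norm v))" using m(2) by (simp add: clip_def)
    also have "\<dots> \<le> real m * 1" using m(2) by (intro mult_left_mono) (auto simp: divide_le_eq)
    finally show "norm (clip v) \<le> real m" by simp
    show "clip v = v" if "norm v \<le> real m" using that m(2) by (simp add: clip_def max_absorb1)
  qed
  have ccont: "continuous_on UNIV clip"
    unfolding clip_def using m(2) by (intro continuous_intros) auto
  have hcont: "continuous_on UNIV (h n)" for n
    unfolding h_def cut_def by (intro continuous_intros continuous_on_compose2[OF ccont G(1)]) auto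
  then have [measurable]: "h n \<in> borel_measurable borel" for n by (rule borel_measurable_continuous_onI)
  have hs: "h n x = 0" if "R + 1 < norm x" for n x using that by (simp add: h_def cut_def)
  have hb: "norm (h n x) \<le> real m" for n x
  proof -
    have "\<bar>cut x\<bar> * norm (clip (G n x)) \<le> 1 * real m" by (intro mult_mono clip) (auto simp: cut_def)
    then show ?thesis by (simp add: h_def)
  qed
  have Ts: "T m x = 0" if "R + 1 < norm x" for x using supp[of x] that by (simp add: T_def)
  have "(\<lambda>n. L2sq lborel (\<lambda>x. T m x - h n x)) \<longlonglongrightarrow> (\<integral>\<^sup>+x. 0 \<partial>(lborel :: 'a measure))"
    unfolding L2sq_def
  proof (rule nn_integral_dominated_convergence[where w="\<lambda>x. ennreal ((2 * real m)\<^sup>2) * indicator (cball 0 (R + 1)) x"])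
    show "AE x in lborel. ennreal ((norm (T m x - h n x))\<^sup>2) \<le> ennreal ((2 * real m)\<^sup>2) * indicator (cball 0 (R + 1)) x" for n
    proof (rule AE_I2)
      fix x
      have "norm (T m x - h n x) \<le> 2 * real m" using norm_triangle_ineq4[of "T m x" "h n x"] Tb[of x] hb[of n x] by linarith
      then have "(norm (T m x - h n x))\<^sup>2 \<le> (2 * real m)\<^sup>2" by (intro power_mono) auto
      then show "ennreal ((norm (T m x - h n x))\<^sup>2) \<le> ennreal ((2 * real m)\<^sup>2) * indicator (cball 0 (R + 1)) x"
        using Ts[of x] hs[of x n] by (cases "norm x \<le> R + 1") (auto intro: ennreal_leI simp del: power_mult_distrib)
    qed
    have "emeasure lborel (cball (0::'a) (R + 1)) < \<infinity>" by (rule emeasure_bounded_finite) simp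
    then show "(\<integral>\<^sup>+x. ennreal ((2 * real m)\<^sup>2) * indicator (cball (0::'a) (R + 1)) x \<partial>lborel) < \<infinity>"
      by (subst nn_integral_cmult_indicator) (auto simp: ennreal_mult_less_top)
    show "AE x in lborel. (\<lambda>n. ennreal ((norm (T m x - h n x))\<^sup>2)) \<longlonglongrightarrow> 0"
      using Nn
    proof eventually_elim
      case (elim x)
      have "isCont clip (T m x)" using ccont by (simp add: continuous_on_eq_continuous_at)
      from isCont_tendsto_compose[OF this G(2)[OF elim]]
      have "(\<lambda>n. h n x) \<longlonglongrightarrow> cut x *\<^sub>R clip (T m x)" unfolding h_def by (intro tendsto_intros)
      also have "cut x *\<^sub>R clip (T m x) = T m x"
        using clip(2)[OF Tb[of x]] supp[of x] by (cases "norm x \<le> R") (auto simp: cut_def T_def)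
      finally have "(\<lambda>n. (norm (T m x - h n x))\<^sup>2) \<longlonglongrightarrow> (norm (T m x - T m x))\<^sup>2" by (intro tendsto_intros)
      from tendsto_ennrealI[OF this] show ?case by simp
    qed
  qed measurable
  then have "\<forall>\<^sub>F n in sequentially. L2sq lborel (\<lambda>x. T m x - h n x) < ennreal (e / 8)"
    by (intro order_tendstoD(2)[where y=0]) (use e in simp_all)
  then obtain n where n: "L2sq lborel (\<lambda>x. T m x - h n x) < ennreal (e / 8)"
    by (auto simp: eventually_sequentially)
  have "L2sq lborel (\<lambda>x. g x - h n x) \<le> 2 * L2sq lborel (\<lambda>x. g x - T m x) + 2 * L2sq lborel (\<lambda>x. T m x - h n x)"
    by (rule L2sq_add_le') auto
  also have "\<dots> \<le> 2 * ennreal (e / 8) + 2 * ennreal (e / 8)"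
    using m n by (intro add_mono mult_left_mono less_imp_le) auto
  also have "\<dots> = ennreal (e / 2)"
  proof -
    have "2 * ennreal (e / 8) = ennreal (e / 4)" using e ennreal_mult[of 2 "e / 8"] by simp
    then show ?thesis using e by (simp flip: ennreal_plus)
  qed
  also have "\<dots> < ennreal e" using e by (simp add: ennreal_less_iff)
  finally show ?thesis using hcont hs by blast
qed

lemma L2sq_shift:
  fixes f :: "'a::euclidean_space \<Rightarrow> 'b::euclidean_space"
  assumes [measurable]: "f \<in> borel_measurable borel"
  shows "L2sq lborel (\<lambda>x. f (x - y)) = L2sq lborel f"
  using nn_integral_lborel_shift[of "\<lambda>x. ennreal ((norm (f x))\<^sup>2)" "- y"] by (simp add: L2sq_def)

text \<open>Clear for continuous functions of bounded support by uniform continuity, and these are dense.\<close>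

lemma L2sq_translation_continuous:
  fixes g :: "'a::euclidean_space \<Rightarrow> 'b::euclidean_space"
  assumes [measurable]: "g \<in> borel_measurable borel" and fin: "L2sq lborel g < \<infinity>"
    and supp: "\<And>x. R < norm x \<Longrightarrow> g x = 0" and e: "0 < e"
  shows "\<exists>d>0. \<forall>y. norm y < d \<longrightarrow> L2sq lborel (\<lambda>x. g (x - y) - g x) \<le> ennreal e"
proof -
  obtain h where h: "continuous_on UNIV h" "\<And>x. R + 1 < norm x \<Longrightarrow> h x = 0" "L2sq lborel (\<lambda>x. g x - h x) < ennreal (e / 12)"
    using L2sq_approx_continuous[where g=g and R=R and e="e / 12", OF assms(1) fin supp] e by auto
  have [measurable]: "h \<in> borel_measurable borel" using h(1) by (rule borel_measurable_continuous_onI)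
  define V where "V = enn2real (emeasure lborel (cball (0::'a) (R + 2)))"
  have "emeasure lborel (cball (0::'a) (R + 2)) < \<infinity>" by (rule emeasure_bounded_finite) simp
  then have V: "emeasure lborel (cball (0::'a) (R + 2)) = ennreal V" "0 \<le> V" by (auto simp: V_def)
  define s where "s = sqrt (e / (8 * (V + 1)))"
  have s: "0 < s" "s\<^sup>2 * V \<le> e / 8"
  proof -
    show "0 < s" using e V by (simp add: s_def)
    have "s\<^sup>2 * V = e / 8 * (V / (V + 1))" using e V by (simp add: s_def)
    also have "\<dots> \<le> e / 8 * 1" using e V by (intro mult_left_mono) auto
    finally show "s\<^sup>2 * V \<le> e / 8" by simp
  qed
  obtain d where d: "d > 0" "\<And>x y. norm (x - y) < d \<Longrightarrow> norm (h x - h y) < s"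
    using compact_support_uniform(2)[where g=h and R="R+1" and e=s, OF h(1,2)] s by auto
  show ?thesis
  proof (intro exI[of _ "min d 1"] conjI allI impI)
    show "0 < min d 1" using d by simp
    fix y :: 'a assume y: "norm y < min d 1"
    have 1: "L2sq lborel (\<lambda>x. h (x - y) - h x) \<le> ennreal (s\<^sup>2) * ennreal V"
      unfolding V(1)[symmetric]
    proof (rule L2sq_indicator_bound)
      show "norm (h (x - y) - h x) \<le> s" for x using d(2)[of "x - y" x] y by simp
      show "h (x - y) - h x = 0" if "R + 2 < norm x" for x
      proof -
        have "norm x \<le> norm (x - y) + norm y" by norm
        then have "R + 1 < norm (x - y)" using that y by linarith
        then show ?thesis using h(2)[of x] h(2)[of "x - y"] that by simp
      qed
    qed (use s in simp)
    have 2: "L2sq lborel (\<lambda>x. g (x - y) - h (x - y)) = L2sq lborel (\<lambda>x. g x - h x)"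
      by (rule L2sq_shift[of "\<lambda>x. g x - h x"]) measurable
    have 3: "L2sq lborel (\<lambda>x. h x - g x) = L2sq lborel (\<lambda>x. g x - h x)"
      by (simp add: L2sq_def norm_minus_commute)
    have "L2sq lborel (\<lambda>x. g (x - y) - g x) \<le> 2 * L2sq lborel (\<lambda>x. g (x - y) - h (x - y)) + 2 * L2sq lborel (\<lambda>x. h (x - y) - g x)"
      by (rule L2sq_add_le') auto
    also have "L2sq lborel (\<lambda>x. h (x - y) - g x) \<le> 2 * L2sq lborel (\<lambda>x. h (x - y) - h x) + 2 * L2sq lborel (\<lambda>x. h x - g x)"
      by (rule L2sq_add_le') auto
    finally have "L2sq lborel (\<lambda>x. g (x - y) - g x) \<le> 2 * L2sq lborel (\<lambda>x. g (x - y) - h (x - y)) + 2 * (2 * L2sq lborel (\<lambda>x. h (x - y) - h x) + 2 * L2sq lborel (\<lambda>x. h x - g x))"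
      by (simp add: mult_left_mono add_left_mono)
    also have "\<dots> \<le> 2 * ennreal (e / 12) + 2 * (2 * ennreal (e / 8) + 2 * ennreal (e / 12))"
    proof (intro add_mono mult_left_mono)
      show "L2sq lborel (\<lambda>x. h (x - y) - h x) \<le> ennreal (e / 8)"
      proof (rule order_trans[OF 1])
        have "ennreal (s\<^sup>2) * ennreal V = ennreal (s\<^sup>2 * V)" using V(2) by (intro ennreal_mult[symmetric]) auto
        then show "ennreal (s\<^sup>2) * ennreal V \<le> ennreal (e / 8)" using s(2) by (simp add: ennreal_leI)
      qed
    qed (use h(3) 2 3 in auto)
    also have "\<dots> = ennreal e"
    proof -
      have "2 * ennreal t = ennreal (2 * t)" if "0 \<le> t" for t using ennreal_mult[of 2 t] that by simp
      then show ?thesis using e by (simp flip: ennreal_plus)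
    qed
    finally show "L2sq lborel (\<lambda>x. g (x - y) - g x) \<le> ennreal e" .
  qed
qed

lemma integrable_of_L2sq_bounded_support:
  fixes g :: "'a::euclidean_space \<Rightarrow> 'b::euclidean_space"
  assumes [measurable]: "g \<in> borel_measurable borel" and fin: "L2sq lborel g < \<infinity>"
    and supp: "\<And>x. R < norm x \<Longrightarrow> g x = 0"
  shows "integrable lborel g"
proof (rule integrableI_bounded)
  have [measurable]: "cball (0::'a) R \<in> sets borel" by simp
  have "emeasure lborel (cball (0::'a) R) < \<infinity>" by (rule emeasure_bounded_finite) simp
  then have f: "(\<integral>\<^sup>+x. indicator (cball 0 R) x + ennreal ((norm (g x))\<^sup>2) \<partial>lborel) < \<infinity>"
    using fin by (subst nn_integral_add) (auto simp: L2sq_def)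
  have "(\<integral>\<^sup>+x. ennreal (norm (g x)) \<partial>lborel) \<le> (\<integral>\<^sup>+x. indicator (cball 0 R) x + ennreal ((norm (g x))\<^sup>2) \<partial>lborel)"
  proof (rule nn_integral_mono)
    fix x
    show "ennreal (norm (g x)) \<le> indicator (cball 0 R) x + ennreal ((norm (g x))\<^sup>2)"
    proof (cases "norm x \<le> R")
      case True
      have "2 * norm (g x) \<le> 1 + (norm (g x))\<^sup>2" using sum_squares_bound[of 1 "norm (g x)"] by simp
      then have "norm (g x) \<le> 1 + (norm (g x))\<^sup>2" using norm_ge_zero[of "g x"] by linarith
      then have "ennreal (norm (g x)) \<le> ennreal (1 + (norm (g x))\<^sup>2)" by (rule ennreal_leI)
      then show ?thesis using True by simp
    qed (use supp in auto)
  qed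
  then show "(\<integral>\<^sup>+x. ennreal (norm (g x)) \<partial>lborel) < \<infinity>" using f by (rule le_less_trans)
qed measurable

lemma mollifier_bounded:
  assumes "0 < \<epsilon>" shows "\<exists>B. \<forall>x::real^'n. norm (mollifier \<epsilon> x) \<le> B"
proof (rule compact_support_uniform(1)[where R=\<epsilon>])
  show "continuous_on UNIV (mollifier \<epsilon> :: real^'n \<Rightarrow> real)" using C_diff_mollifier[of 0 \<epsilon> "0::real^'n"] by simp
qed (use mollifier_facts(2)[OF assms, where 'n='n] in auto)

lemma mollifier_average:
  fixes g :: "real^'n \<Rightarrow> 'b::euclidean_space"
  assumes int: "integrable lborel g" and \<epsilon>: "0 < \<epsilon>"
  shows "integrable lborel (\<lambda>y. mollifier \<epsilon> y *\<^sub>R g (x - y))"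
    and "integrable lborel (\<lambda>y. mollifier \<epsilon> y *\<^sub>R (g (x - y) - g x))"
    and "conv (mollifier \<epsilon>) g x - g x = (\<integral>y. mollifier \<epsilon> y *\<^sub>R (g (x - y) - g x) \<partial>lborel)"
proof -
  let ?\<rho> = "mollifier \<epsilon> :: real^'n \<Rightarrow> real"
  note \<rho> = mollifier_facts[OF \<epsilon>, where 'n='n]
  have [measurable]: "g \<in> borel_measurable borel" using borel_measurable_integrable[OF int] by simp
  obtain B where B: "\<And>x. norm (?\<rho> x) \<le> B" using mollifier_bounded[OF \<epsilon>] by blast
  show i1: "integrable lborel (\<lambda>y. ?\<rho> y *\<^sub>R g (x - y))"
  proof (rule Bochner_Integration.integrable_bound)
    show "integrable lborel (\<lambda>y. B *\<^sub>R g (x - y))"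
      using integral_lborel_reflect(2)[of g x] int by simp
    have "0 \<le> B" using B norm_ge_zero order_trans by blast
    then show "AE y in lborel. norm (?\<rho> y *\<^sub>R g (x - y)) \<le> norm (B *\<^sub>R g (x - y))"
      using B by (intro AE_I2) (auto intro!: mult_right_mono)
  qed measurable
  have i2: "integrable lborel (\<lambda>y. ?\<rho> y *\<^sub>R g x)" using \<rho>(3) by simp
  show "integrable lborel (\<lambda>y. ?\<rho> y *\<^sub>R (g (x - y) - g x))"
    using Bochner_Integration.integrable_diff[OF i1 i2] by (simp add: scaleR_diff_right)
  have "(\<integral>y. ?\<rho> y *\<^sub>R g x \<partial>lborel) = g x" using \<rho>(3,4) by simp
  then have "conv ?\<rho> g x - g x = (\<integral>y. ?\<rho> y *\<^sub>R g (x - y) \<partial>lborel) - (\<integral>y. ?\<rho> y *\<^sub>R g x \<partial>lborel)"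
    by (simp add: conv_def)
  also have "\<dots> = (\<integral>y. ?\<rho> y *\<^sub>R g (x - y) - ?\<rho> y *\<^sub>R g x \<partial>lborel)"
    by (rule Bochner_Integration.integral_diff[OF i1 i2, symmetric])
  finally show "conv ?\<rho> g x - g x = (\<integral>y. ?\<rho> y *\<^sub>R (g (x - y) - g x) \<partial>lborel)" by (simp add: scaleR_diff_right)
qed

text \<open>A mollified function is an average of translates, so by the Cauchy-Schwarz inequality its
  distance to g is at most the largest distance of a translate by less than \<epsilon>.\<close>

lemma mollify_L2sq_le:
  fixes g :: "real^'n \<Rightarrow> 'b::euclidean_space"
  assumes [measurable]: "g \<in> borel_measurable borel" and int: "integrable lborel g" and \<epsilon>: "0 < \<epsilon>"
    and le: "\<And>y. norm y < \<epsilon> \<Longrightarrow> L2sq lborel (\<lambda>x. g (x - y) - g x) \<le> ennreal e"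
  shows "L2sq lborel (\<lambda>x. conv (mollifier \<epsilon>) g x - g x) \<le> ennreal e"
proof -
  let ?\<rho> = "mollifier \<epsilon> :: real^'n \<Rightarrow> real"
  note \<rho> = mollifier_facts[OF \<epsilon>, where 'n='n]
  have \<rho>1: "(\<integral>\<^sup>+y. ennreal (?\<rho> y) \<partial>lborel) = 1"
    using \<rho> by (subst nn_integral_eq_integral) auto
  have pw: "ennreal ((norm (conv ?\<rho> g x - g x))\<^sup>2) \<le> (\<integral>\<^sup>+y. ennreal (?\<rho> y) * ennreal ((norm (g (x - y) - g x))\<^sup>2) \<partial>lborel)" for x
  proof -
    let ?s = "\<lambda>y. ennreal (sqrt (?\<rho> y))"
    have sq: "?s y * ?s y = ennreal (?\<rho> y)" for y using \<rho>(1)[of y] by (simp flip: ennreal_mult)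
    have "ennreal ((norm (conv ?\<rho> g x - g x))\<^sup>2) = (ennreal (norm (\<integral>y. ?\<rho> y *\<^sub>R (g (x - y) - g x) \<partial>lborel)))\<^sup>2"
      by (simp add: mollifier_average(3)[OF int \<epsilon>] ennreal_power)
    also have "\<dots> \<le> (\<integral>\<^sup>+y. ennreal (norm (?\<rho> y *\<^sub>R (g (x - y) - g x))) \<partial>lborel)\<^sup>2"
      by (intro power_mono integral_norm_bound_ennreal mollifier_average(2)[OF int \<epsilon>]) simp
    also have "\<dots> = (\<integral>\<^sup>+y. ?s y * (?s y * ennreal (norm (g (x - y) - g x))) \<partial>lborel)\<^sup>2"
      using \<rho>(1) by (simp add: mult.assoc[symmetric] sq ennreal_mult)
    also have "\<dots> \<le> (\<integral>\<^sup>+y. (?s y)\<^sup>2 \<partial>lborel) * (\<integral>\<^sup>+y. (?s y * ennreal (norm (g (x - y) - g x)))\<^sup>2 \<partial>lborel)"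
      by (rule Cauchy_Schwarz_nn_integral) measurable
    also have "\<dots> = (\<integral>\<^sup>+y. ennreal (?\<rho> y) * ennreal ((norm (g (x - y) - g x))\<^sup>2) \<partial>lborel)"
      by (simp add: power_mult_distrib power2_eq_square[of "?s _"] sq \<rho>1 ennreal_power)
    finally show ?thesis .
  qed
  have "L2sq lborel (\<lambda>x. conv ?\<rho> g x - g x) \<le> (\<integral>\<^sup>+x. \<integral>\<^sup>+y. ennreal (?\<rho> y) * ennreal ((norm (g (x - y) - g x))\<^sup>2) \<partial>lborel \<partial>lborel)"
    unfolding L2sq_def by (intro nn_integral_mono pw)
  also have "\<dots> = (\<integral>\<^sup>+y. \<integral>\<^sup>+x. ennreal (?\<rho> y) * ennreal ((norm (g (x - y) - g x))\<^sup>2) \<partial>lborel \<partial>lborel)"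
    by (rule lborel_pair.Fubini') measurable
  also have "\<dots> = (\<integral>\<^sup>+y. ennreal (?\<rho> y) * L2sq lborel (\<lambda>x. g (x - y) - g x) \<partial>lborel)"
    unfolding L2sq_def by (intro nn_integral_cong nn_integral_cmult) measurable
  also have "\<dots> \<le> (\<integral>\<^sup>+y. ennreal (?\<rho> y) * ennreal e \<partial>lborel)"
  proof (rule nn_integral_mono)
    fix y :: "real^'n"
    show "ennreal (?\<rho> y) * L2sq lborel (\<lambda>x. g (x - y) - g x) \<le> ennreal (?\<rho> y) * ennreal e"
      using le[of y] \<rho>(2)[of y] by (cases "norm y < \<epsilon>") (auto intro: mult_left_mono)
  qed
  also have "\<dots> = ennreal e" using \<rho>1 by (simp add: nn_integral_multc)
  finally show ?thesis .
qed

text \<open>For x in S the function of y given by the mollifier at x - y is a test function in \<Omega>.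
  Hence at such points the gradient of the mollified u is the mollified weak gradient.\<close>

lemma sobolev_of_weak_gradient:
  fixes u :: "real^'n \<Rightarrow> real"
  assumes [measurable]: "u \<in> borel_measurable borel" "U \<in> borel_measurable borel"
    and fin: "L2sq lborel u < \<infinity>" "L2sq lborel U < \<infinity>"
    and supp: "\<And>x. R < norm x \<Longrightarrow> u x = 0" "\<And>x. R < norm x \<Longrightarrow> U x = 0"
    and S[measurable]: "S \<in> sets borel" and \<eta>: "0 < \<eta>" "\<And>x. x \<in> S \<Longrightarrow> cball x \<eta> \<subseteq> \<Omega>"
    and weak: "\<And>\<phi> i. \<phi> \<in> test_functions \<Omega> \<Longrightarrow> (\<integral>x. u x * partial_deriv i \<phi> x \<partial>lborel) = - (\<integral>x. U x $ i * \<phi> x \<partial>lborel)"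
  shows "sobolev S u U"
proof -
  have ui: "integrable lborel u" and Ui: "integrable lborel U"
    using integrable_of_L2sq_bounded_support assms by blast+
  note mono = L2sq_leb_le_lborel[OF S]
  have C: "C1 (mollifier \<epsilon> :: real^'n \<Rightarrow> real) (grad (mollifier \<epsilon>))" for \<epsilon>
    using C_diff_mollifier[of 1 \<epsilon> "0::real^'n"] by (intro C1_grad) simp
  have grad_eq: "conv u (grad (mollifier \<epsilon>)) x = conv (mollifier \<epsilon>) U x" if \<epsilon>: "0 < \<epsilon>" "\<epsilon> \<le> \<eta>" and x: "x \<in> S" for \<epsilon> x
  proof -
    let ?\<rho> = "mollifier \<epsilon> :: real^'n \<Rightarrow> real"
    note \<rho> = mollifier_facts[OF \<epsilon>(1), where 'n='n]
    define \<phi> where "\<phi> y = ?\<rho> (x - y)" for y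
    have \<phi>': "\<phi> = (\<lambda>y. ?\<rho> (y - x))" unfolding \<phi>_def using \<rho>(5)[of "_ - x"] by (auto simp: fun_eq_iff)
    have t: "\<phi> \<in> test_functions \<Omega>"
    proof -
      have sub: "closure {y. \<phi> y \<noteq> 0} \<subseteq> cball x \<epsilon>"
      proof (rule closure_minimal, rule subsetI)
        fix y assume "y \<in> {y. \<phi> y \<noteq> 0}"
        then have "\<not> \<epsilon> \<le> norm (x - y)" using \<rho>(2)[of "x - y"] by (auto simp: \<phi>_def)
        then show "y \<in> cball x \<epsilon>" by (simp add: dist_norm)
      qed simp
      moreover have "cball x \<epsilon> \<subseteq> \<Omega>" using \<eta>(2)[OF x] \<epsilon>(2) by (auto simp: subset_iff)
      moreover have "compact (closure {y. \<phi> y \<noteq> 0})"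
        using sub bounded_subset[OF bounded_cball[of x \<epsilon>]] closure_subset by (subst compact_closure) blast
      ultimately show ?thesis unfolding test_functions_def \<phi>' using C_diff_mollifier[of _ \<epsilon> x] by auto
    qed
    have pd: "partial_deriv i \<phi> y = - (grad ?\<rho> (x - y) $ i)" for i y
    proof -
      have 1: "((\<lambda>y. x - y) has_derivative (\<lambda>h. - h)) (at y)" by (auto intro!: derivative_eq_intros)
      have 2: "(?\<rho> has_derivative (\<lambda>h. grad ?\<rho> (x - y) \<bullet> h)) (at (x - y))" using C[of \<epsilon>] by (simp add: C1_def)
      have "(\<phi> has_derivative (\<lambda>h. grad ?\<rho> (x - y) \<bullet> (- h))) (at y)"
        unfolding \<phi>_def using has_derivative_compose[OF 1 2] .
      from partial_derivI[OF this] show ?thesis by (simp add: inner_axis)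
    qed
    have gs: "\<And>z. \<epsilon> < norm z \<Longrightarrow> grad ?\<rho> z = 0" by (rule C1_support_grad[OF C]) (use \<rho>(2) in auto)
    obtain B' where B': "\<And>x. norm (grad ?\<rho> x) \<le> B'"
      using compact_support_uniform(1)[of "grad ?\<rho>" \<epsilon>] gs C[of \<epsilon>] by (auto simp: C1_def)
    note [measurable] = C1_measurable[OF C]
    have i1: "integrable lborel (\<lambda>y. u y *\<^sub>R grad ?\<rho> (x - y))"
      by (rule integrable_scaleR_bounded[OF ui _ B']) measurable
    note i2 = mollifier_average(1)[OF Ui \<epsilon>(1), of x]
    have "conv u (grad ?\<rho>) x $ i = conv ?\<rho> U x $ i" for i
    proof -
      have "conv u (grad ?\<rho>) x $ i = conv u (grad ?\<rho>) x \<bullet> axis i 1" by (simp add: inner_axis)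
      also have "\<dots> = (\<integral>y. (u y *\<^sub>R grad ?\<rho> (x - y)) \<bullet> axis i 1 \<partial>lborel)"
        unfolding conv_def using i1 by (intro integral_inner_left[symmetric]) auto
      also have "\<dots> = - (\<integral>y. u y * partial_deriv i \<phi> y \<partial>lborel)" by (simp add: inner_axis pd)
      also have "\<dots> = (\<integral>y. U y $ i * \<phi> y \<partial>lborel)" by (simp add: weak[OF t])
      also have "\<dots> = conv (\<lambda>y. U y $ i) ?\<rho> x" by (simp add: conv_def \<phi>_def)
      also have "\<dots> = conv ?\<rho> (\<lambda>y. U y $ i) x" 
      proof (rule conv_commute)
        have "(\<lambda>y. U y \<bullet> axis i 1) \<in> borel_measurable borel" by measurable
        then show "(\<lambda>y. U y $ i) \<in> borel_measurable borel" by (simp add: inner_axis)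
      qed (rule mollifier_borel)
      also have "\<dots> = (\<integral>y. (?\<rho> y *\<^sub>R U (x - y)) \<bullet> axis i 1 \<partial>lborel)" by (simp add: conv_def inner_axis)
      also have "\<dots> = conv ?\<rho> U x \<bullet> axis i 1"
        unfolding conv_def using i2 by (intro integral_inner_left) auto
      finally show ?thesis by (simp add: inner_axis)
    qed
    then show ?thesis by (simp add: vec_eq_iff)
  qed
  show ?thesis unfolding sobolev_def
  proof (intro conjI allI impI)
    show "L2sq (leb S) u < \<infinity>" "L2sq (leb S) U < \<infinity>" using mono[of u] mono[of U] fin by (auto intro: le_less_trans)
    fix e :: real assume e: "0 < e"
    obtain d1 where d1: "d1 > 0" "\<And>y. norm y < d1 \<Longrightarrow> L2sq lborel (\<lambda>x. u (x - y) - u x) \<le> ennreal (e / 2)"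
      using L2sq_translation_continuous[where g=u and R=R and e="e / 2", OF _ fin(1) supp(1)] e by auto
    obtain d2 where d2: "d2 > 0" "\<And>y. norm y < d2 \<Longrightarrow> L2sq lborel (\<lambda>x. U (x - y) - U x) \<le> ennreal (e / 2)"
      using L2sq_translation_continuous[where g=U and R=R and e="e / 2", OF _ fin(2) supp(2)] e by auto
    define \<epsilon> where "\<epsilon> = min \<eta> (min d1 d2)"
    have \<epsilon>: "0 < \<epsilon>" "\<epsilon> \<le> \<eta>" "\<epsilon> \<le> d1" "\<epsilon> \<le> d2" using d1 d2 \<eta> by (auto simp: \<epsilon>_def)
    note \<rho> = mollifier_facts[OF \<epsilon>(1), where 'n='n]
    have ee: "ennreal (e / 2) < ennreal e" using e by (simp add: ennreal_less_iff)
    have CC: "C1 (conv u (mollifier \<epsilon>)) (conv u (grad (mollifier \<epsilon>)))"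
      by (rule conv_C1[OF ui C, where R=\<epsilon>]) (use \<rho>(2) in auto)
    note [measurable] = C1_measurable[OF CC]
    have a: "L2sq (leb S) (\<lambda>x. conv u (mollifier \<epsilon>) x - u x) < ennreal e"
    proof -
      have "L2sq (leb S) (\<lambda>x. conv u (mollifier \<epsilon>) x - u x) \<le> L2sq lborel (\<lambda>x. conv u (mollifier \<epsilon>) x - u x)"
        by (rule mono) measurable
      also have "\<dots> = L2sq lborel (\<lambda>x. conv (mollifier \<epsilon>) u x - u x)" by (subst conv_commute) auto
      also have "\<dots> \<le> ennreal (e / 2)" by (rule mollify_L2sq_le[OF _ ui \<epsilon>(1)]) (use d1 \<epsilon> in auto)
      finally show ?thesis using ee by (rule le_less_trans)
    qed
    have b: "L2sq (leb S) (\<lambda>x. conv u (grad (mollifier \<epsilon>)) x - U x) < ennreal e"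
    proof -
      have "L2sq (leb S) (\<lambda>x. conv u (grad (mollifier \<epsilon>)) x - U x) = (\<integral>\<^sup>+x. indicator S x * ennreal ((norm (conv u (grad (mollifier \<epsilon>)) x - U x))\<^sup>2) \<partial>lborel)"
        by (rule L2sq_leb) measurable
      also have "\<dots> \<le> L2sq lborel (\<lambda>x. conv (mollifier \<epsilon>) U x - U x)"
        unfolding L2sq_def by (rule nn_integral_mono) (use grad_eq[OF \<epsilon>(1,2)] in \<open>auto simp: indicator_def\<close>)
      also have "\<dots> \<le> ennreal (e / 2)" by (rule mollify_L2sq_le[OF _ Ui \<epsilon>(1)]) (use d2 \<epsilon> in auto)
      finally show ?thesis using ee by (rule le_less_trans)
    qed
    show "\<exists>f f'. C1 f f' \<and> L2sq (leb S) (\<lambda>x. f x - u x) < ennreal e \<and> L2sq (leb S) (\<lambda>x. f' x - U x) < ennreal e"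
      using CC a b by blast
  qed auto
qed

lemma integrable_continuous_bounded_support:
  fixes g :: "'a::euclidean_space \<Rightarrow> 'b::euclidean_space"
  assumes c: "continuous_on UNIV g" and s: "\<And>x. R < norm x \<Longrightarrow> g x = 0"
  shows "integrable lborel g"
proof (rule integrable_of_L2sq_bounded_support[OF _ _ s])
  obtain B where B: "\<And>x. norm (g x) \<le> B" using compact_support_uniform(1)[OF c s] by blast
  then have "0 \<le> B" using norm_ge_zero order_trans by blast
  have "emeasure lborel (cball (0::'a) R) < \<infinity>" by (rule emeasure_bounded_finite) simp
  then show "L2sq lborel g < \<infinity>"
    using L2sq_indicator_bound[of g B R, OF B s \<open>0 \<le> B\<close>] by (auto simp: ennreal_mult_less_top intro: le_less_trans)
qed (rule borel_measurable_continuous_onI[OF c])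

text \<open>A C1 function of compact support is mollified to a smooth one; the gradients converge uniformly.\<close>

lemma test_C1_of_test_smooth:
  fixes A :: "real^'n \<Rightarrow> real^'n"
  assumes Ai: "integrable lborel A" and z: "C1 z z'" "\<And>x. x \<notin> S \<Longrightarrow> z x = 0"
    and S: "\<And>x. x \<in> S \<Longrightarrow> norm x \<le> R" and \<eta>: "0 < \<eta>" "\<And>x. x \<in> S \<Longrightarrow> cball x \<eta> \<subseteq> \<Omega>"
    and weak: "\<And>\<phi>. \<phi> \<in> test_functions \<Omega> \<Longrightarrow> (\<integral>x. A x \<bullet> grad \<phi> x \<partial>lborel) = 0"
  shows "(\<integral>x. A x \<bullet> z' x \<partial>lborel) = 0"
proof -
  have [measurable]: "A \<in> borel_measurable borel" using borel_measurable_integrable[OF Ai] by simp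
  note [measurable] = C1_measurable[OF z(1)]
  have zs: "z x = 0" if "R < norm x" for x using z(2)[of x] S[of x] that by force
  have zs': "z' x = 0" if "R < norm x" for x by (rule C1_support_grad[OF z(1) zs that])
  have c': "continuous_on UNIV z'" using z(1) by (simp add: C1_def)
  obtain B' where B': "\<And>x. norm (z' x) \<le> B'" using compact_support_uniform(1)[OF c' zs'] by blast
  have zi: "integrable lborel z" by (rule integrable_continuous_bounded_support[OF C1_continuous[OF z(1)] zs])
  have zi': "integrable lborel z'" by (rule integrable_continuous_bounded_support[OF c' zs'])
  define I where "I = (\<integral>x. norm (A x) \<partial>lborel)"
  have I: "0 \<le> I" by (simp add: I_def)
  have small: "\<bar>\<integral>x. A x \<bullet> z' x \<partial>lborel\<bar> \<le> e" if e: "0 < e" for e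
  proof -
    obtain d where d: "d > 0" "\<And>x y. norm (x - y) < d \<Longrightarrow> norm (z' x - z' y) < e / (I + 1)"
      using compact_support_uniform(2)[where g=z' and R=R and e="e / (I + 1)", OF c' zs'] e I by auto
    define \<epsilon> where "\<epsilon> = min (\<eta> / 2) d"
    have \<epsilon>: "0 < \<epsilon>" "2 * \<epsilon> \<le> \<eta>" "\<epsilon> \<le> d" using d \<eta> by (auto simp: \<epsilon>_def)
    let ?\<rho> = "mollifier \<epsilon> :: real^'n \<Rightarrow> real"
    note \<rho> = mollifier_facts[OF \<epsilon>(1), where 'n='n]
    define \<phi> where "\<phi> = conv z ?\<rho>"
    have eq: "\<phi> = conv ?\<rho> z" unfolding \<phi>_def by (rule ext, rule conv_commute) measurable
    have C\<phi>: "C1 \<phi> (conv ?\<rho> z')" unfolding eq by (rule conv_C1[OF \<rho>(3) z(1) zs])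
    have t: "\<phi> \<in> test_functions \<Omega>"
    proof -
      have near: "\<exists>y\<in>S. norm (x - y) < \<epsilon>" if "\<phi> x \<noteq> 0" for x
      proof (rule ccontr)
        assume "\<not> ?thesis"
        then have 0: "z y *\<^sub>R ?\<rho> (x - y) = 0" for y using z(2)[of y] \<rho>(2)[of "x - y"] by (cases "y \<in> S") (auto simp: not_less)
        have "\<phi> x = (\<integral>y. 0 \<partial>(lborel :: (real^'n) measure))" unfolding \<phi>_def conv_def by (simp only: 0)
        then show False using that by simp
      qed
      have cl: "\<exists>y\<in>S. norm (x - y) \<le> 2 * \<epsilon>" if "x \<in> closure {x. \<phi> x \<noteq> 0}" for x
      proof -
        have "\<exists>x'\<in>{x. \<phi> x \<noteq> 0}. dist x' x < \<epsilon>" using that \<epsilon>(1) unfolding closure_approachable by blast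
        then obtain x' where x': "\<phi> x' \<noteq> 0" "dist x' x < \<epsilon>" by blast
        obtain y where y: "y \<in> S" "norm (x' - y) < \<epsilon>" using near[OF x'(1)] by blast
        have "norm (x - y) \<le> norm (x' - x) + norm (x' - y)" by norm
        then show ?thesis using x' y by (intro bexI[of _ y]) (auto simp: dist_norm)
      qed
      have "closure {x. \<phi> x \<noteq> 0} \<subseteq> \<Omega>"
      proof
        fix x assume "x \<in> closure {x. \<phi> x \<noteq> 0}"
        from cl[OF this] obtain y where "y \<in> S" "norm (x - y) \<le> 2 * \<epsilon>" by blast
        then have "x \<in> cball y \<eta>" using \<epsilon>(2) by (simp add: dist_norm norm_minus_commute)
        then show "x \<in> \<Omega>" using \<eta>(2)[OF \<open>y \<in> S\<close>] by blast
      qed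
      moreover have "bounded {x. \<phi> x \<noteq> 0}"
      proof (rule boundedI)
        fix x assume "x \<in> {x. \<phi> x \<noteq> 0}"
        then obtain y where y: "y \<in> S" "norm (x - y) < \<epsilon>" using near by blast
        have "norm x \<le> norm y + norm (x - y)" by norm
        then show "norm x \<le> R + \<epsilon>" using S[OF y(1)] y(2) by linarith
      qed
      moreover have "C_diff k \<phi>" for k unfolding \<phi>_def
        by (rule conv_C_diff[OF zi, where R=\<epsilon>]) (use C_diff_mollifier[of _ \<epsilon> "0::real^'n"] \<rho>(2) in auto)
      ultimately show ?thesis by (simp add: test_functions_def compact_closure)
    qed
    have unif: "norm (conv ?\<rho> z' x - z' x) \<le> e / (I + 1)" for x
    proof -
      have "norm (conv ?\<rho> z' x - z' x) \<le> (\<integral>y. ?\<rho> y * (e / (I + 1)) \<partial>lborel)"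
        unfolding mollifier_average(3)[OF zi' \<epsilon>(1)]
      proof (rule norm_integral_le[OF mollifier_average(2)[OF zi' \<epsilon>(1)]])
        show "norm (?\<rho> y *\<^sub>R (z' (x - y) - z' x)) \<le> ?\<rho> y * (e / (I + 1))" for y
        proof (cases "norm y < \<epsilon>")
          case True
          have "norm (z' (x - y) - z' x) \<le> e / (I + 1)" using d(2)[of "x - y" x] True \<epsilon>(3) by simp
          then have "?\<rho> y * norm (z' (x - y) - z' x) \<le> ?\<rho> y * (e / (I + 1))" by (rule mult_left_mono) (rule \<rho>(1))
          then show ?thesis using \<rho>(1)[of y] by simp
        next
          case False
          then show ?thesis using \<rho>(2)[of y] by simp
        qed
      qed (use \<rho>(3) in simp)
      also have "\<dots> = e / (I + 1)" using \<rho>(4) by simp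
      finally show ?thesis .
    qed
    note [measurable] = C1_measurable[OF C\<phi>]
    have iA: "integrable lborel (\<lambda>x. A x \<bullet> w x)" if [measurable]: "w \<in> borel_measurable borel" and b: "\<And>x. norm (w x) \<le> b" for w b
    proof (rule Bochner_Integration.integrable_bound)
      show "integrable lborel (\<lambda>x. b *\<^sub>R A x)" using Ai by simp
      have "0 \<le> b" using b norm_ge_zero order_trans by blast
      then show "AE x in lborel. norm (A x \<bullet> w x) \<le> norm (b *\<^sub>R A x)"
      proof (intro AE_I2)
        fix x
        have "\<bar>A x \<bullet> w x\<bar> \<le> norm (A x) * norm (w x)" by (rule Cauchy_Schwarz_ineq2)
        also have "\<dots> \<le> norm (A x) * b" using b by (intro mult_left_mono) auto
        finally show "norm (A x \<bullet> w x) \<le> norm (b *\<^sub>R A x)" using \<open>0 \<le> b\<close> by (simp add: mult.commute)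
      qed
    qed measurable
    have j1: "integrable lborel (\<lambda>x. A x \<bullet> z' x)" by (rule iA[OF _ B']) measurable
    have j2: "integrable lborel (\<lambda>x. A x \<bullet> conv ?\<rho> z' x)"
    proof (rule iA)
      show "norm (conv ?\<rho> z' x) \<le> B' + e / (I + 1)" for x
        using norm_triangle_ineq[of "conv ?\<rho> z' x - z' x" "z' x"] unif[of x] B'[of x] by simp
    qed measurable
    have "(\<integral>x. A x \<bullet> conv ?\<rho> z' x \<partial>lborel) = 0" using weak[OF t] C1_unique[OF C\<phi>] by simp
    then have "(\<integral>x. A x \<bullet> z' x \<partial>lborel) = (\<integral>x. A x \<bullet> z' x \<partial>lborel) - (\<integral>x. A x \<bullet> conv ?\<rho> z' x \<partial>lborel)" by simp
    also have "\<dots> = (\<integral>x. A x \<bullet> z' x - A x \<bullet> conv ?\<rho> z' x \<partial>lborel)"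
      by (rule Bochner_Integration.integral_diff[OF j1 j2, symmetric])
    also have "norm \<dots> \<le> (\<integral>x. norm (A x) * (e / (I + 1)) \<partial>lborel)"
    proof (rule norm_integral_le[OF Bochner_Integration.integrable_diff[OF j1 j2]])
      show "norm (A x \<bullet> z' x - A x \<bullet> conv ?\<rho> z' x) \<le> norm (A x) * (e / (I + 1))" for x
      proof -
        have "\<bar>A x \<bullet> (z' x - conv ?\<rho> z' x)\<bar> \<le> norm (A x) * norm (z' x - conv ?\<rho> z' x)" by (rule Cauchy_Schwarz_ineq2)
        also have "\<dots> \<le> norm (A x) * (e / (I + 1))" using unif[of x] by (intro mult_left_mono) (auto simp: norm_minus_commute)
        finally show ?thesis by (simp add: inner_diff_right)
      qed
    qed (use Ai in simp)
    also have "\<dots> = e * (I / (I + 1))" by (simp add: I_def)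
    also have "\<dots> \<le> e * 1" using e I by (intro mult_left_mono) auto
    finally show ?thesis by simp
  qed
  have "\<bar>\<integral>x. A x \<bullet> z' x \<partial>lborel\<bar> \<le> 0" by (rule field_le_epsilon) (use small in simp)
  then show ?thesis by simp
qed

section \<open>Weak solutions\<close>

lemma AE_lebesgue_on_iff:
  fixes Q :: "'a::euclidean_space set"
  assumes "Q \<in> sets borel"
  shows "(AE x in lebesgue_on Q. P x) \<longleftrightarrow> (AE x in lborel. x \<in> Q \<longrightarrow> P x)"
  using assms by (simp add: AE_restrict_space_iff AE_completion_iff)

text \<open>The values outside Q are set to 0, so that integrals over Q become integrals over the whole
  space.\<close>

definition borel_version :: "'a::euclidean_space set \<Rightarrow> ('a \<Rightarrow> real) \<Rightarrow> ('a \<Rightarrow> real) \<Rightarrow> bool" where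
  "borel_version Q f g \<longleftrightarrow> g \<in> borel_measurable borel \<and> (\<forall>x. x \<notin> Q \<longrightarrow> g x = 0) \<and> (AE x in lborel. x \<in> Q \<longrightarrow> f x = g x)"

lemma borel_version_exists:
  fixes f :: "'a::euclidean_space \<Rightarrow> real"
  assumes f: "f \<in> borel_measurable (lebesgue_on Q)" and Q[measurable]: "Q \<in> sets borel"
  shows "\<exists>g. borel_version Q f g"
proof -
  have "(\<lambda>x. if x \<in> Q then f x else 0) \<in> borel_measurable (completion lborel)"
    using f Q by (subst borel_measurable_if) auto
  then obtain g where g[measurable]: "g \<in> borel_measurable lborel" and eq: "AE x in lborel. (if x \<in> Q then f x else 0) = g x"
    using completion_ex_borel_measurable_real by blast
  have "borel_version Q f (\<lambda>x. indicator Q x * g x)"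
    unfolding borel_version_def
  proof (intro conjI)
    show "(\<lambda>x. indicator Q x * g x) \<in> borel_measurable borel" using g by measurable
    show "AE x in lborel. x \<in> Q \<longrightarrow> f x = indicator Q x * g x" using eq by eventually_elim auto
  qed auto
  then show ?thesis by blast
qed

lemma borel_version_indicator:
  fixes f :: "'a::euclidean_space \<Rightarrow> real"
  assumes f: "f \<in> borel_measurable (lebesgue_on Q)" and Q: "Q \<in> sets borel" and g: "borel_version Q f g"
  shows "(\<lambda>x. indicator Q x *\<^sub>R f x) \<in> borel_measurable lebesgue" "g \<in> borel_measurable lebesgue"
    "AE x in lebesgue. indicator Q x *\<^sub>R f x = g x"
proof -
  have "(\<lambda>x. if x \<in> Q then f x else 0) \<in> borel_measurable lebesgue"
    using f Q by (subst borel_measurable_if) auto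
  moreover have "(\<lambda>x. if x \<in> Q then f x else 0) = (\<lambda>x. indicator Q x *\<^sub>R f x)" by auto
  ultimately show "(\<lambda>x. indicator Q x *\<^sub>R f x) \<in> borel_measurable lebesgue" by simp
  show "g \<in> borel_measurable lebesgue" using g by (intro measurable_completion) (simp add: borel_version_def)
  have "AE x in lborel. indicator Q x *\<^sub>R f x = g x"
    using g unfolding borel_version_def by (elim conjE) (erule eventually_mono, auto simp: indicator_def)
  then show "AE x in lebesgue. indicator Q x *\<^sub>R f x = g x" by (simp add: AE_completion_iff)
qed

lemma integral_borel_version:
  fixes f :: "'a::euclidean_space \<Rightarrow> real"
  assumes f: "f \<in> borel_measurable (lebesgue_on Q)" and Q: "Q \<in> sets borel" and g: "borel_version Q f g"
  shows "(LINT x|lebesgue_on Q. f x) = (\<integral>x. g x \<partial>lborel)"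
    and "integrable (lebesgue_on Q) f \<longleftrightarrow> integrable lborel g"
proof -
  note b = borel_version_indicator[OF assms]
  have gb: "g \<in> borel_measurable lborel" using g by (simp add: borel_version_def)
  have "(LINT x|lebesgue_on Q. f x) = (\<integral>x. indicator Q x *\<^sub>R f x \<partial>lebesgue)"
    using Q by (intro integral_restrict_space) simp
  also have "\<dots> = (\<integral>x. g x \<partial>lebesgue)" by (rule integral_cong_AE[OF b])
  also have "\<dots> = (\<integral>x. g x \<partial>lborel)" by (rule integral_completion[OF gb])
  finally show "(LINT x|lebesgue_on Q. f x) = (\<integral>x. g x \<partial>lborel)" .
  have "integrable (lebesgue_on Q) f \<longleftrightarrow> integrable lebesgue (\<lambda>x. indicator Q x *\<^sub>R f x)"
    using Q by (intro integrable_restrict_space) simp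
  also have "\<dots> \<longleftrightarrow> integrable lebesgue g" by (rule integrable_cong_AE[OF b])
  also have "\<dots> \<longleftrightarrow> integrable lborel g" by (rule integrable_completion[OF gb])
  finally show "integrable (lebesgue_on Q) f \<longleftrightarrow> integrable lborel g" .
qed

lemma borel_version_L2:
  assumes f: "f \<in> L2 Q" and Q: "Q \<in> sets borel" and g: "borel_version Q f g"
  shows "integrable lborel (\<lambda>x. (g x)\<^sup>2)"
proof -
  have fm: "f \<in> borel_measurable (lebesgue_on Q)" and fi: "integrable (lebesgue_on Q) (\<lambda>x. (f x)\<^sup>2)"
    using f by (auto simp: L2_def)
  have "borel_version Q (\<lambda>x. (f x)\<^sup>2) (\<lambda>x. (g x)\<^sup>2)"
    using g unfolding borel_version_def by (auto elim!: eventually_mono)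
  with fi show ?thesis using integral_borel_version(2)[OF borel_measurable_integrable[OF fi] Q] by blast
qed

lemma borel_lebesgue_on:
  fixes \<phi> :: "'a::euclidean_space \<Rightarrow> real"
  assumes "\<phi> \<in> borel_measurable borel" shows "\<phi> \<in> borel_measurable (lebesgue_on Q)"
  using assms by (intro measurable_restrict_space1 measurable_completion) simp

lemma test_function_borel:
  assumes "\<phi> \<in> test_functions \<Omega>"
  shows "\<phi> \<in> borel_measurable borel" "partial_deriv i \<phi> \<in> borel_measurable borel"
proof -
  have "C_diff 1 \<phi>" using assms by (simp add: test_functions_def)
  from C1_measurable[OF C1_grad[OF this]] show "\<phi> \<in> borel_measurable borel" by simp
  have "C_diff 0 (partial_deriv i \<phi>)" using \<open>C_diff 1 \<phi>\<close> by simp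
  then show "partial_deriv i \<phi> \<in> borel_measurable borel" by (rule C_diff_borel)
qed

text \<open>The gradient vanishes outside the closure of S, and the boundary of a convex set is a null set.\<close>

lemma C1_grad_zero_outside_convex:
  assumes z: "C1 z z'" "\<And>x. x \<notin> S \<Longrightarrow> z x = 0" and S: "convex S"
  shows "AE x in lborel. x \<notin> S \<longrightarrow> z' x = 0"
proof -
  have "frontier S \<in> null_sets lebesgue" using negligible_convex_frontier[OF S] by (simp add: negligible_iff_null_sets)
  then have "AE x in lebesgue. x \<notin> frontier S" by (rule AE_not_in)
  then have "AE x in lborel. x \<notin> frontier S" by (simp add: AE_completion_iff)
  then show ?thesis
  proof eventually_elim
    case (elim x)
    show ?case
    proof
      assume "x \<notin> S"
      then have x: "x \<in> - closure S" using elim interior_subset by (auto simp: frontier_def)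
      show "z' x = 0"
        by (rule C1_grad_zero_on_open[OF z(1) _ _ x]) (use z(2) closure_subset in auto)
    qed
  qed
qed

text \<open>The coefficients, the solution and its gradient are replaced by Borel versions, and the flux is
  formed from them. The passage from the cube of side 6 to that of side 5 leaves the room that
  mollification needs.\<close>

lemma weak_solution_elliptic:
  fixes a :: "real^'n \<Rightarrow> real^'n^'n" and u :: "real^'n \<Rightarrow> real"
  assumes lam: "0 < lam" "lam \<le> Lam"
    and am: "\<And>i j. (\<lambda>x. a x $ i $ j) \<in> borel_measurable (lebesgue_on (cube 0 6))"
    and ell: "uniformly_elliptic (cube 0 6) lam Lam a" and sol: "weak_solution (cube 0 6) a u"
    and nonneg: "AE x in lebesgue_on (cube 0 6). 0 \<le> u x"
  shows "\<exists>v V A. elliptic_solution (cube 0 5 :: (real^'n) set) lam (real CARD('n) * real CARD('n) * Lam) v V A \<and>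
           (AE x in lborel. x \<in> cube 0 6 \<longrightarrow> u x = v x)"
proof -
  let ?Q = "cube 0 6 :: (real^'n) set" and ?S = "cube 0 5 :: (real^'n) set"
  let ?n = "real CARD('n)"
  have Q: "?Q \<in> sets borel" by simp
  have Lam: "0 < Lam" using lam by linarith
  obtain Du where uL2: "u \<in> L2 ?Q" and grad: "has_L2_weak_gradient ?Q u Du" and
    test: "\<And>\<phi>. \<phi> \<in> test_functions ?Q \<Longrightarrow> (LINT x|lebesgue_on ?Q. (\<Sum>i\<in>UNIV. \<Sum>j\<in>UNIV. a x $ i $ j * Du i x * partial_deriv j \<phi> x)) = 0"
    using sol by (auto simp: weak_solution_def H1_def)
  have um: "u \<in> borel_measurable (lebesgue_on ?Q)" using uL2 by (simp add: L2_def)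
  have DuL2: "Du i \<in> L2 ?Q" and Dum: "Du i \<in> borel_measurable (lebesgue_on ?Q)" and
    weak: "\<And>\<phi>. \<phi> \<in> test_functions ?Q \<Longrightarrow> (LINT x|lebesgue_on ?Q. u x * partial_deriv i \<phi> x) = - (LINT x|lebesgue_on ?Q. Du i x * \<phi> x)" for i
    using grad by (auto simp: has_L2_weak_gradient_def has_weak_partial_deriv_def L2_def)
  obtain v0 where v0: "borel_version ?Q u v0" using borel_version_exists[OF um Q] by blast
  define v where "v x = max 0 (v0 x)" for x
  have nn: "AE x in lborel. x \<in> ?Q \<longrightarrow> 0 \<le> u x" using nonneg by (simp add: AE_lebesgue_on_iff)
  have v: "borel_version ?Q u v"
  proof -
    have "AE x in lborel. x \<in> ?Q \<longrightarrow> u x = v0 x" using v0 by (simp add: borel_version_def)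
    then have "AE x in lborel. x \<in> ?Q \<longrightarrow> u x = v x" using nn by eventually_elim (auto simp: v_def)
    then show ?thesis using v0 by (auto simp: borel_version_def v_def[abs_def])
  qed
  have "\<exists>g. borel_version ?Q (Du i) g" for i by (rule borel_version_exists[OF Dum Q])
  then obtain g where g: "\<And>i. borel_version ?Q (Du i) (g i)" by metis
  have "\<exists>b. borel_version ?Q (\<lambda>x. a x $ i $ j) b" for i j by (rule borel_version_exists[OF am Q])
  then obtain b where b: "\<And>i j. borel_version ?Q (\<lambda>x. a x $ i $ j) (b i j)" by metis
  define V where "V x = (\<chi> i. g i x)" for x
  define A where "A x = (\<chi> j. \<Sum>i\<in>UNIV. b i j x * g i x)" for x
  have vm[measurable]: "v \<in> borel_measurable borel" and gm[measurable]: "\<And>i. g i \<in> borel_measurable borel"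
    and bm[measurable]: "\<And>i j. b i j \<in> borel_measurable borel"
    using v g b by (auto simp: borel_version_def)
  have vecm: "(\<lambda>x. \<chi> i. f i x) \<in> borel_measurable borel" if [measurable]: "\<And>i. f i \<in> borel_measurable borel"
    for f :: "'n \<Rightarrow> real^'n \<Rightarrow> real"
  proof -
    have "(\<lambda>x. \<Sum>i\<in>UNIV. f i x *\<^sub>R axis i (1::real)) \<in> borel_measurable borel"
      by (intro borel_measurable_sum borel_measurable_scaleR that borel_measurable_const)
    moreover have "(\<lambda>x. \<Sum>i\<in>UNIV. f i x *\<^sub>R axis i 1) = (\<lambda>x. (\<chi> i. f i x))"
      using basis_expansion[of "\<chi> i. f i _"] by (simp add: scalar_mult_eq_scaleR fun_eq_iff)
    ultimately show ?thesis by simp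
  qed
  have Vm[measurable]: "V \<in> borel_measurable borel" unfolding V_def by (rule vecm) measurable
  have Am[measurable]: "A \<in> borel_measurable borel" unfolding A_def by (rule vecm) measurable
  have v0': "v x = 0" "V x = 0" "A x = 0" if "x \<notin> ?Q" for x
    using v g that by (auto simp: borel_version_def V_def A_def vec_eq_iff)
  have L2v: "L2sq lborel v < \<infinity>"
    using borel_version_L2[OF uL2 Q v] unfolding L2sq_def by (auto simp: integrable_iff_bounded)
  have L2V: "L2sq lborel V < \<infinity>"
  proof -
    have eq: "(norm (V x))\<^sup>2 = (\<Sum>i\<in>UNIV. (g i x)\<^sup>2)" for x
      unfolding power2_norm_eq_inner inner_vec_def by (simp add: V_def power2_eq_square)
    have "integrable lborel (\<lambda>x. \<Sum>i\<in>UNIV. (g i x)\<^sup>2)"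
      by (intro Bochner_Integration.integrable_sum borel_version_L2[OF DuL2 Q g])
    then have "integrable lborel (\<lambda>x. (norm (V x))\<^sup>2)" by (simp only: eq)
    then show ?thesis unfolding L2sq_def by (auto simp: integrable_iff_bounded)
  qed
  have AEb: "AE x in lborel. \<forall>i\<in>UNIV. \<forall>j\<in>UNIV. x \<in> ?Q \<longrightarrow> a x $ i $ j = b i j x"
    using b by (intro AE_ball_countable[THEN iffD2] ballI) (auto simp: borel_version_def countable_finite)
  moreover have "AE x in lborel. x \<in> ?Q \<longrightarrow> (\<forall>\<xi>. (\<Sum>i\<in>UNIV. \<Sum>j\<in>UNIV. a x $ i $ j * \<xi> $ i * \<xi> $ j) \<ge> lam * (norm \<xi>)\<^sup>2) \<and> (\<forall>i j. \<bar>a x $ i $ j\<bar> \<le> Lam)"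
    using ell unfolding uniformly_elliptic_def by (rule AE_lebesgue_on_iff[OF Q, THEN iffD1])
  ultimately have AEell: "AE x in lborel. lam * (norm (V x))\<^sup>2 \<le> A x \<bullet> V x \<and> norm (A x) \<le> ?n * ?n * Lam * norm (V x)"
  proof eventually_elim
    case (elim x)
    show ?case
    proof (cases "x \<in> ?Q")
      case True
      then have ab: "a x $ i $ j = b i j x" for i j using elim by blast
      have bL: "\<bar>b i j x\<bar> \<le> Lam" for i j using elim True ab[of i j] by metis
      have gV: "\<bar>g i x\<bar> \<le> norm (V x)" for i using component_le_norm_cart[of "V x" i] by (simp add: V_def)
      have "lam * (norm (V x))\<^sup>2 \<le> (\<Sum>i\<in>UNIV. \<Sum>j\<in>UNIV. a x $ i $ j * V x $ i * V x $ j)" using elim True by blast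
      also have "\<dots> = (\<Sum>j\<in>UNIV. \<Sum>i\<in>UNIV. b i j x * g i x * g j x)"
        by (subst sum.swap) (simp add: ab V_def)
      also have "\<dots> = A x \<bullet> V x" by (simp add: A_def V_def inner_vec_def sum_distrib_right)
      finally have 1: "lam * (norm (V x))\<^sup>2 \<le> A x \<bullet> V x" .
      have "norm (A x) \<le> (\<Sum>j\<in>UNIV. \<bar>A x $ j\<bar>)" by (rule norm_le_l1_cart)
      also have "\<dots> \<le> (\<Sum>j\<in>(UNIV::'n set). \<Sum>i\<in>(UNIV::'n set). Lam * norm (V x))"
      proof (rule sum_mono)
        fix j
        have "\<bar>A x $ j\<bar> \<le> (\<Sum>i\<in>UNIV. \<bar>b i j x * g i x\<bar>)" unfolding A_def by (simp add: sum_abs)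
        also have "\<dots> \<le> (\<Sum>i\<in>(UNIV::'n set). Lam * norm (V x))"
          using bL gV Lam by (intro sum_mono) (auto simp: abs_mult intro!: mult_mono)
        finally show "\<bar>A x $ j\<bar> \<le> (\<Sum>i\<in>(UNIV::'n set). Lam * norm (V x))" .
      qed
      finally show ?thesis using 1 by simp
    next
      case False
      then show ?thesis using v0' by simp
    qed
  qed
  have L2A: "L2sq lborel A < \<infinity>"
  proof -
    have "L2sq lborel A \<le> ennreal ((?n * ?n * Lam)\<^sup>2) * L2sq lborel V"
      using AEell by (intro L2sq_le_scale) (auto elim: eventually_mono)
    then show ?thesis using L2V by (auto simp: ennreal_mult_less_top intro: le_less_trans)
  qed
  obtain R where R: "\<And>x. x \<in> ?Q \<Longrightarrow> norm x \<le> R" using bounded_cube[of "0::real^'n" 6] unfolding bounded_iff by blast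
  have zero: "v x = 0" "V x = 0" "A x = 0" if "R < norm x" for x using v0'[of x] R[of x] that by force+
  have near: "cball x (1/4) \<subseteq> ?Q" if "x \<in> ?S" for x
  proof
    fix y assume y: "y \<in> cball x (1/4)"
    have "\<bar>y $ i - 0 $ i\<bar> < 6 / 2" for i
    proof -
      have "\<bar>y $ i - x $ i\<bar> \<le> 1/4" using component_le_norm_cart[of "y - x" i] y by (simp add: dist_norm norm_minus_commute)
      moreover have "\<bar>x $ i - 0 $ i\<bar> < 5 / 2" using that unfolding cube_def by blast
      moreover have "\<bar>y $ i\<bar> \<le> \<bar>y $ i - x $ i\<bar> + \<bar>x $ i\<bar>"
        using abs_triangle_ineq[of "y $ i - x $ i" "x $ i"] by simp
      ultimately show ?thesis by simp
    qed
    then show "y \<in> ?Q" by (simp add: cube_def)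
  qed
  have SQ: "?S \<subseteq> ?Q" by (rule cube_mono) simp
  have sob: "sobolev ?S v V"
  proof (rule sobolev_of_weak_gradient[OF vm Vm L2v L2V zero(1,2) _ _ near])
    fix \<phi> i assume \<phi>: "\<phi> \<in> test_functions ?Q"
    note m[measurable] = test_function_borel[OF \<phi>]
    have 1: "(LINT x|lebesgue_on ?Q. u x * partial_deriv i \<phi> x) = (\<integral>x. v x * partial_deriv i \<phi> x \<partial>lborel)"
      by (rule integral_borel_version(1)[OF borel_measurable_times[OF um borel_lebesgue_on[OF m(2)]] Q])
         (use v in \<open>auto simp: borel_version_def elim!: eventually_mono\<close>)
    have 2: "(LINT x|lebesgue_on ?Q. Du i x * \<phi> x) = (\<integral>x. g i x * \<phi> x \<partial>lborel)"
      by (rule integral_borel_version(1)[OF borel_measurable_times[OF Dum borel_lebesgue_on[OF m(1)]] Q])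
         (use g[of i] in \<open>auto simp: borel_version_def elim!: eventually_mono\<close>)
    show "(\<integral>x. v x * partial_deriv i \<phi> x \<partial>lborel) = - (\<integral>x. V x $ i * \<phi> x \<partial>lborel)"
      using weak[OF \<phi>, of i] unfolding 1 2 by (simp add: V_def)
  qed auto
  have testA: "(\<integral>x. A x \<bullet> grad \<phi> x \<partial>lborel) = 0" if \<phi>: "\<phi> \<in> test_functions ?Q" for \<phi>
  proof -
    note m[measurable] = test_function_borel[OF \<phi>]
    have eq: "A x \<bullet> grad \<phi> x = (\<Sum>i\<in>UNIV. \<Sum>j\<in>UNIV. b i j x * g i x * partial_deriv j \<phi> x)" for x
      by (subst sum.swap) (simp add: A_def grad_def inner_vec_def sum_distrib_right)
    have "(LINT x|lebesgue_on ?Q. (\<Sum>i\<in>UNIV. \<Sum>j\<in>UNIV. a x $ i $ j * Du i x * partial_deriv j \<phi> x))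
      = (\<integral>x. (\<Sum>i\<in>UNIV. \<Sum>j\<in>UNIV. b i j x * g i x * partial_deriv j \<phi> x) \<partial>lborel)"
    proof (rule integral_borel_version(1)[OF _ Q])
      show "(\<lambda>x. \<Sum>i\<in>UNIV. \<Sum>j\<in>UNIV. a x $ i $ j * Du i x * partial_deriv j \<phi> x) \<in> borel_measurable (lebesgue_on ?Q)"
        by (intro borel_measurable_sum borel_measurable_times am Dum borel_lebesgue_on m)
      have "AE x in lborel. \<forall>i\<in>UNIV. x \<in> ?Q \<longrightarrow> Du i x = g i x"
        using g by (intro AE_ball_countable[THEN iffD2] ballI) (auto simp: borel_version_def countable_finite)
      with AEb have "AE x in lborel. x \<in> ?Q \<longrightarrow> (\<Sum>i\<in>UNIV. \<Sum>j\<in>UNIV. a x $ i $ j * Du i x * partial_deriv j \<phi> x)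
        = (\<Sum>i\<in>UNIV. \<Sum>j\<in>UNIV. b i j x * g i x * partial_deriv j \<phi> x)"
        by eventually_elim (auto intro!: sum.cong)
      moreover have "(\<lambda>x. \<Sum>i\<in>UNIV. \<Sum>j\<in>UNIV. b i j x * g i x * partial_deriv j \<phi> x) \<in> borel_measurable borel"
        by measurable
      ultimately show "borel_version ?Q (\<lambda>x. \<Sum>i\<in>UNIV. \<Sum>j\<in>UNIV. a x $ i $ j * Du i x * partial_deriv j \<phi> x)
          (\<lambda>x. \<Sum>i\<in>UNIV. \<Sum>j\<in>UNIV. b i j x * g i x * partial_deriv j \<phi> x)"
        using g unfolding borel_version_def by (auto intro!: sum.neutral)
    qed
    then show ?thesis using test[OF \<phi>] by (simp add: eq)
  qed
  have Ai: "integrable lborel A" by (rule integrable_of_L2sq_bounded_support[OF Am L2A zero(3)])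
  have "elliptic_solution ?S lam (?n * ?n * Lam) v V A"
  proof unfold_locales
    show "convex ?S" "bounded ?S" "?S \<in> sets borel" by simp_all
    show "0 < lam" by (rule lam)
    show "0 < ?n * ?n * Lam" using Lam by simp
    show "sobolev ?S v V" by (rule sob)
    show "0 \<le> v x" for x by (simp add: v_def)
    show "A \<in> borel_measurable borel" by (rule Am)
    show "L2sq (leb ?S) A < \<infinity>" using L2sq_leb_le_lborel[OF sets_cube Am] L2A by (rule le_less_trans)
    show "AE x in leb ?S. lam * (norm (V x))\<^sup>2 \<le> A x \<bullet> V x" using AEell by (auto simp: AE_leb elim: eventually_mono)
    show "AE x in leb ?S. norm (A x) \<le> ?n * ?n * Lam * norm (V x)" using AEell by (auto simp: AE_leb elim: eventually_mono)
    fix z z' assume z: "C1 z z'" "\<And>x. x \<notin> ?S \<Longrightarrow> z x = 0"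
    note [measurable] = C1_measurable[OF z(1)]
    have "(\<integral>x. A x \<bullet> z' x \<partial>leb ?S) = (\<integral>x. indicator ?S x *\<^sub>R (A x \<bullet> z' x) \<partial>lborel)"
    proof -
      have "leb ?S = density lborel (\<lambda>x. ennreal (indicator ?S x))" by (simp add: leb_def ennreal_indicator)
      then show ?thesis by (simp only:) (rule integral_density, auto)
    qed
    also have "\<dots> = (\<integral>x. A x \<bullet> z' x \<partial>lborel)"
    proof (rule integral_cong_AE)
      have "AE x in lborel. x \<notin> ?S \<longrightarrow> z' x = 0"
        by (rule C1_grad_zero_outside_convex[OF z(1) _ convex_cube]) (rule z(2))
      then show "AE x in lborel. indicator ?S x *\<^sub>R (A x \<bullet> z' x) = A x \<bullet> z' x"
        by eventually_elim (auto simp: indicator_def)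
    qed measurable
    also have "\<dots> = 0"
      by (rule test_C1_of_test_smooth[OF Ai z(1,2) _ _ near testA]) (use R SQ in auto)
    finally show "(\<integral>x. A x \<bullet> z' x \<partial>leb ?S) = 0" .
  qed
  then show ?thesis using v by (auto simp: borel_version_def)
qed

theorem theorem1p1:
  fixes lam Lam :: real
  assumes "0 < lam" and "lam \<le> Lam"
  shows "\<exists>C::real. \<forall>(a :: real ^ 'n \<Rightarrow> real ^ 'n ^ 'n) (u :: real ^ 'n \<Rightarrow> real).
    (\<forall>i j. (\<lambda>x. a x $ i $ j) \<in> borel_measurable (lebesgue_on (cube 0 6))) \<longrightarrow>
    uniformly_elliptic (cube 0 6) lam Lam a \<longrightarrow>
    weak_solution (cube 0 6) a u \<longrightarrow>
    (AE x in lebesgue_on (cube 0 6). u x \<ge> 0) \<longrightarrow>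
    esssup (lebesgue_on (cube 0 1)) (\<lambda>x. ereal (u x))
      \<le> ereal C * essinf (lebesgue_on (cube 0 1)) (\<lambda>x. ereal (u x))"
proof -
  have "0 < real CARD('n) * real CARD('n) * Lam" using assms by simp
  from harnack_elliptic_solution[OF assms(1) this] obtain H where H: "0 < H"
    "\<And>u U A \<epsilon>. elliptic_solution (cube 0 5 :: (real^'n) set) lam (real CARD('n) * real CARD('n) * Lam) u U A \<Longrightarrow> 0 < \<epsilon> \<Longrightarrow>
      \<exists>m>0. AE x in lborel. x \<in> cube 0 1 \<longrightarrow> m \<le> u x + \<epsilon> \<and> u x + \<epsilon> \<le> H * m"
    by blast
  show ?thesis
  proof (intro exI[of _ H] allI impI)
    fix a :: "real ^ 'n \<Rightarrow> real ^ 'n ^ 'n" and u :: "real ^ 'n \<Rightarrow> real"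
    assume am: "\<forall>i j. (\<lambda>x. a x $ i $ j) \<in> borel_measurable (lebesgue_on (cube 0 6))"
      and ell: "uniformly_elliptic (cube 0 6) lam Lam a" and sol: "weak_solution (cube 0 6) a u"
      and nonneg: "AE x in lebesgue_on (cube 0 6). u x \<ge> 0"
    let ?M = "lebesgue_on (cube 0 1 :: (real^'n) set)"
    obtain v V A where es: "elliptic_solution (cube 0 5 :: (real^'n) set) lam (real CARD('n) * real CARD('n) * Lam) v V A"
      and uv: "AE x in lborel. x \<in> cube 0 6 \<longrightarrow> u x = v x"
      using weak_solution_elliptic[OF assms _ ell sol nonneg] am by blast
    have c16: "cube 0 1 \<subseteq> (cube 0 6 :: (real^'n) set)" by (rule cube_mono) simp
    have um: "u \<in> borel_measurable ?M"
      using sol c16 measurable_restrict_mono by (auto simp: weak_solution_def H1_def L2_def)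
    then have em: "(\<lambda>x. ereal (u x)) \<in> borel_measurable ?M" "(\<lambda>x. - ereal (u x)) \<in> borel_measurable ?M" by auto
    let ?s = "esssup ?M (\<lambda>x. ereal (u x))" and ?t = "essinf ?M (\<lambda>x. ereal (u x))"
    have bound: "\<exists>m>0. ?s \<le> ereal (H * m - \<epsilon>) \<and> ereal (m - \<epsilon>) \<le> ?t" if \<epsilon>: "0 < \<epsilon>" for \<epsilon>
    proof -
      obtain m where m: "m > 0" "AE x in lborel. x \<in> cube 0 1 \<longrightarrow> m \<le> v x + \<epsilon> \<and> v x + \<epsilon> \<le> H * m"
        using H(2)[OF es \<epsilon>] by blast
      have "AE x in lborel. x \<in> cube 0 1 \<longrightarrow> m - \<epsilon> \<le> u x \<and> u x \<le> H * m - \<epsilon>"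
        using m(2) uv by eventually_elim (use c16 in auto)
      then have ae: "AE x in ?M. m - \<epsilon> \<le> u x \<and> u x \<le> H * m - \<epsilon>"
        by (rule AE_lebesgue_on_iff[OF sets_cube, THEN iffD2])
      have "?s \<le> ereal (H * m - \<epsilon>)"
        by (rule esssup_I[OF em(1)]) (use ae in \<open>auto elim: eventually_mono\<close>)
      moreover have "esssup ?M (\<lambda>x. - ereal (u x)) \<le> - ereal (m - \<epsilon>)"
        by (rule esssup_I[OF em(2)]) (use ae in \<open>auto elim: eventually_mono\<close>)
      then have "- (- ereal (m - \<epsilon>)) \<le> ?t" unfolding essinf_def by (simp only: ereal_minus_le_minus)
      then have "ereal (m - \<epsilon>) \<le> ?t" by (simp only: ereal_uminus_uminus)
      ultimately show ?thesis using m(1) by blast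
    qed
    show "?s \<le> ereal H * ?t"
    proof (cases ?t)
      case PInf
      then show ?thesis using H(1) by simp
    next
      case MInf
      then show ?thesis using bound[of 1] by auto
    next
      case (real t)
      have le: "?s \<le> ereal (H * t) + ereal e" if e: "0 < e" for e
      proof -
        \<comment> \<open>The shift e / H costs H times as much, which is e.\<close>
        obtain m where m: "?s \<le> ereal (H * m - e / H)" "ereal (m - e / H) \<le> ?t" using bound[of "e / H"] e H(1) by auto
        have "m \<le> t + e / H" using m(2) real by simp
        then have "H * m \<le> H * (t + e / H)" using H(1) by (intro mult_left_mono) auto
        also have "\<dots> = H * t + e" using H(1) by (simp add: distrib_left)
        finally have "H * m - e / H \<le> H * t + e" using e H(1) by (simp add: add_increasing2 diff_le_eq)
        then have "ereal (H * m - e / H) \<le> ereal (H * t + e)" by simp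
        from order_trans[OF m(1) this] show ?thesis by simp
      qed
      have "?s \<le> ereal (H * t)" by (rule ereal_le_epsilon2) (rule le)
      then show ?thesis using real by simp
    qed
  qed
qed

end
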